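(* Let $q\in\mathbb Z^+$, $k\in\mathbb Z$, $\theta>0$, and let $g$ be a multiplicative function supported on squarefree integers such that $$g(p)=\frac kp+O\!\left(\frac1{p^{1+\theta}}\right)\qquad\text{for all primes }p\nmid q,\ p\to+\infty.$$ For $x\ge 1$ and integers $m\ge0$ put $$M_g(x,m,q)=\sum_{\substack{n\le x\\ (n,q)=1}} g(n)\Big(\log\frac xn\Big)^m .$$ Then for every integer $m\ge\max(0,-k)$, $$M_g(x,m,q)=\mathfrak S(q)\,\frac{m!}{(k+m)!}(\log x)^{k+m}+O\big\{(\log x)^{k+m-1}(\log\log q)^{M}\big\},$$ where $M=M(k,m)\ge0$ is effectively computable and the implied constant in the $O$-term depends at most on $k$ and $m$.
   Context: Here $p$ always denotes a prime, and $$\mathfrak S(q)=\prod_{p\nmid q}(1+g(p))\Big(1-\frac1p\Big)^k\prod_{p\mid q}\Big(1-\frac1p\Big)^k,$$ a convergent product.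
   Formalization: The implied constant may also depend on θ and on the constant in the hypothesis on g(p) (independence fails, e.g. g(2)=t large); the formula is asserted for x≥2 (it fails at x=1 for k=2, m=0); log log q is read as 1 for q=1,2, where it is undefined or negative. *)

theory Defs
  imports
    "HOL-Analysis.Analysis"
    "HOL-Computational_Algebra.Squarefree"
    "HOL-Library.Nat_Bijection"
    "HOL-Real_Asymp.Real_Asymp"
begin

definition multiplicative :: "(nat \<Rightarrow> complex) \<Rightarrow> bool" where
  "multiplicative g \<longleftrightarrow>
     g 1 = 1 \<and> (\<forall>m>0. \<forall>n>0. coprime m n \<longrightarrow> g (m * n) = g m * g n)"

definition supported_on_squarefree :: "(nat \<Rightarrow> complex) \<Rightarrow> bool" where
  "supported_on_squarefree g \<longleftrightarrow> (\<forall>n>0. \<not> squarefree n \<longrightarrow> g n = 0)"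

definition log_sum :: "(nat \<Rightarrow> complex) \<Rightarrow> real \<Rightarrow> nat \<Rightarrow> nat \<Rightarrow> complex" where
  "log_sum g x m q =
     (\<Sum>n | 0 < n \<and> real n \<le> x \<and> coprime n q. g n * of_real (ln (x / real n) ^ m))"

text \<open>The infinite product is taken over all natural numbers in increasing order, with factor 1 at
  the indices that are not primes coprime to the modulus.\<close>

definition euler_factor :: "(nat \<Rightarrow> complex) \<Rightarrow> int \<Rightarrow> nat \<Rightarrow> nat \<Rightarrow> complex" where
  "euler_factor g k q p =
     (if prime p \<and> \<not> p dvd q then (1 + g p) * of_real ((1 - 1 / real p) powi k) else 1)"

definition singular_series :: "(nat \<Rightarrow> complex) \<Rightarrow> int \<Rightarrow> nat \<Rightarrow> complex" where
  "singular_series g k q =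
     (\<Prod>p. euler_factor g k q p) *
     of_real (\<Prod>p | prime p \<and> p dvd q. (1 - 1 / real p) powi k)"

text \<open>The iterated logarithm of 1 is undefined and that of 2 is negative; for these two moduli the
  factor is read as 1.\<close>

definition loglog :: "nat \<Rightarrow> real" where
  "loglog q = (if q \<ge> 3 then ln (ln (real q)) else 1)"

text \<open>Effective computability is Kleene's: a partial recursive term computes the function, with the
  integer argument coded as a natural number. An argument tuple is a list.\<close>

datatype recf =
    Zero
  | Succ
  | Proj nat
  | Comp recf "recf list"
  | Prec recf recf
  | Mini recf

inductive rec_eval :: "recf \<Rightarrow> nat list \<Rightarrow> nat \<Rightarrow> bool" where
  "rec_eval Zero xs 0"
| "rec_eval Succ [n] (Suc n)"
| "i < length xs \<Longrightarrow> rec_eval (Proj i) xs (xs ! i)"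
| "list_all2 (\<lambda>h y. rec_eval h xs y) hs ys \<Longrightarrow> rec_eval f ys v \<Longrightarrow> rec_eval (Comp f hs) xs v"
| "rec_eval f xs v \<Longrightarrow> rec_eval (Prec f h) (0 # xs) v"
| "rec_eval (Prec f h) (n # xs) y \<Longrightarrow> rec_eval h (n # y # xs) v \<Longrightarrow>
     rec_eval (Prec f h) (Suc n # xs) v"
| "rec_eval f (n # xs) 0 \<Longrightarrow> (\<forall>i<n. \<exists>y. rec_eval f (i # xs) (Suc y)) \<Longrightarrow>
     rec_eval (Mini f) xs n"

definition effectively_computable :: "(int \<Rightarrow> nat \<Rightarrow> nat) \<Rightarrow> bool" where
  "effectively_computable M \<longleftrightarrow> (\<exists>r. \<forall>k m. rec_eval r [int_encode k, m] (M k m))"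

lemma convergent_euler_factor:
  fixes g :: "nat \<Rightarrow> complex" and k :: int and q :: nat and \<theta> A :: real
  assumes th: "\<theta> > 0"
    and g: "\<And>p. prime p \<Longrightarrow> \<not> p dvd q \<Longrightarrow>
              norm (g p - of_int k / of_nat p) \<le> A / real p powr (1 + \<theta>)"
  shows "convergent_prod (euler_factor g k q)"
proof -
  define u where "u = (\<lambda>n. (1 - 1 / real n) powr real_of_int k)"
  define K where "K = real_of_int k"
  have "(\<lambda>n. (1 + K / real n) * (1 - 1 / real n) powr K - 1) \<in> O(\<lambda>n. 1 / real n ^ 2)"
    by real_asymp
  then obtain c where c: "eventually (\<lambda>n. norm ((1 + K / real n) * u n - 1) \<le> c * norm (1 / real n ^ 2)) at_top"
    unfolding u_def K_def by (elim landau_o.bigE)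
  have "u \<longlonglongrightarrow> 1" unfolding u_def K_def[symmetric] by real_asymp
  then have u2: "eventually (\<lambda>n. u n < 2) at_top"
    by (rule order_tendstoD) simp
  have ev: "eventually (\<lambda>p. norm (norm (euler_factor g k q p - 1))
      \<le> \<bar>c\<bar> * (1 / real p ^ 2) + 2 * \<bar>A\<bar> * (1 / real p powr (1 + \<theta>))) sequentially"
    using c u2 eventually_gt_at_top[of 1]
  proof eventually_elim
    case (elim p)
    show ?case
    proof (cases "prime p \<and> \<not> p dvd q")
      case False
      then show ?thesis by (auto simp: euler_factor_def)
    next
      case True
      have pos: "1 - 1 / real p > 0" using elim by simp
      have up: "(1 - 1 / real p) powi k = u p"
        unfolding u_def using pos by (intro powr_real_of_int'[symmetric]) auto
      have un: "u p \<ge> 0" unfolding u_def by simp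
      have eq: "euler_factor g k q p - 1 =
          of_real ((1 + K / real p) * u p - 1) + (g p - of_int k / of_nat p) * of_real (u p)"
        using True by (simp add: euler_factor_def up K_def algebra_simps)
      have "norm (euler_factor g k q p - 1) \<le>
          norm ((1 + K / real p) * u p - 1) + norm (g p - of_int k / of_nat p) * u p"
        unfolding eq using un
        by (intro order_trans[OF norm_triangle_ineq] add_mono)
           (simp_all only: norm_of_real norm_mult real_norm_def abs_of_nonneg order_refl)
      also have "norm ((1 + K / real p) * u p - 1) \<le> \<bar>c\<bar> * (1 / real p ^ 2)"
        using elim(1) by (rule order_trans) (auto intro!: mult_right_mono simp: divide_right_mono)
      also have "norm (g p - of_int k / of_nat p) * u p \<le> (\<bar>A\<bar> / real p powr (1 + \<theta>)) * 2"
      proof (rule mult_mono)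
        show "norm (g p - of_int k / of_nat p) \<le> \<bar>A\<bar> / real p powr (1 + \<theta>)"
          by (rule order_trans[OF g]) (use True in \<open>auto intro!: divide_right_mono\<close>)
      qed (use elim un in auto)
      finally show ?thesis by (simp add: mult_ac)
    qed
  qed
  have s1: "summable (\<lambda>p. 1 / real p ^ 2)"
    using inverse_power_summable[of 2, where ?'a = real] by (simp add: inverse_eq_divide)
  have s2: "summable (\<lambda>p. 1 / real p powr (1 + \<theta>))"
  proof -
    have "summable (\<lambda>p. real p powr (- (1 + \<theta>)))"
      using th by (subst summable_real_powr_iff) auto
    then show ?thesis by (simp only: powr_minus inverse_eq_divide)
  qed
  have "summable (\<lambda>p. norm (euler_factor g k q p - 1))"
    by (rule summable_comparison_test_ev[OF ev]) (intro summable_add summable_mult s1 s2)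
  then have "abs_convergent_prod (euler_factor g k q)"
    by (simp add: abs_convergent_prod_conv_summable)
  then show ?thesis by (rule abs_convergent_prod_imp_convergent_prod)
qed

end

theory Submission
  imports Defs "HOL-Probability.Probability" "HOL-Complex_Analysis.Complex_Analysis"
begin

text \<open>Let \<open>\<tau>\<^sub>k\<close> be the coefficients of \<open>\<zeta>(1+s)\<^sup>k\<close>. The function \<open>g\<close>, restricted to integers coprime to
  \<open>q\<close>, is the convolution of \<open>\<tau>\<^sub>k\<close> with a function \<open>h\<close> whose series at \<open>s = 0\<close> is the singular series and for
  which \<open>\<Sum> |h(d)| (1 + log d)\<close> is bounded by a power of \<open>log log q\<close>. Hence it suffices to know
  \<open>\<Sum>\<^sub>n\<^sub>\<le>\<^sub>y \<tau>\<^sub>k(n) log(y/n)\<^sup>m\<close> up to a relative error \<open>1 / log y\<close>.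

  For \<open>k \<ge> 0\<close> this follows from \<open>\<Sum>\<^sub>n\<^sub>\<le>\<^sub>y log(y/n)\<^sup>r / n = (log y)\<^sup>r\<^sup>+\<^sup>1 / (r + 1) + O((log y)\<^sup>r)\<close> by induction on \<open>k\<close>.
  For \<open>k = -j < 0\<close> it has the depth of the prime number theorem. If \<open>m = j\<close>, the sum minus \<open>j!\<close>, as a
  function of \<open>u = log y\<close>, has Laplace transform \<open>j! ((s \<zeta>(1+s))\<^sup>-\<^sup>j - 1) / s\<close>. By the 3-4-1 inequality its second
  derivative is integrable on vertical lines uniformly up to \<open>Re s = 0\<close>, and Fourier inversion bounds the
  difference by \<open>O(u\<^sup>-\<^sup>2)\<close>. Larger \<open>m\<close> follow by integrating in \<open>u\<close>.\<close>

section \<open>Formal Dirichlet series\<close>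

text \<open>Two demands shape the analytic part. The error for \<open>m = j\<close> has to be
  integrable in \<open>u\<close>: a bound \<open>1 / u\<close> would do for this \<open>m\<close>,
  but one integration would turn it into \<open>log u\<close>, too large for
  \<open>m = j + 1\<close>. Hence two derivatives of the transform and not one. They also repair its
  decay: the subtracted \<open>1 / s\<close> is not absolutely integrable on a vertical line, while
  its second derivative is. On the arithmetic side the full function \<open>h\<close> is never
  formed. In the ring of formal Dirichlet series, a product over the primes up to \<open>P\<close>
  gives an identity that is exact for all \<open>n \<le> P\<close>. The estimates are uniform over
  finite sets of primes, and only the value at \<open>s = 0\<close> is taken to the limit
  \<open>P \<rightarrow> \<infinity>\<close>. This treats both signs of \<open>k\<close> alike. The
  exponent of \<open>log log q\<close> is in essence \<open>9 |k| + 1\<close>: the primes dividing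
  \<open>q\<close> contribute \<open>exp (9 |k| log (1 + log log q))\<close>, where
  \<open>9 = 3 * 3\<close> comes from bounding two small powers of \<open>p\<close> by 3 each, and
  the logarithmic weight contributes one more factor.\<close>

typedef dser = "{f :: nat \<Rightarrow> complex. f 0 = 0}"
  morphisms dnth Abs_dser
  by (rule exI[of _ "\<lambda>_. 0"]) simp

setup_lifting type_definition_dser

text \<open>At \<open>n = 0\<close> this set is infinite, and a sum over an infinite set is 0. That
  is what keeps convolution inside \<open>dser\<close>, whose elements vanish at 0.\<close>

definition factor_pairs :: "nat \<Rightarrow> (nat \<times> nat) set" where
  "factor_pairs n = {(a, b). a * b = n}"

lemma finite_factor_pairs: "n > 0 \<Longrightarrow> finite (factor_pairs n)"
proof -
  assume n: "n > 0"
  have "factor_pairs n \<subseteq> {..n} \<times> {..n}"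
    using n by (auto simp: factor_pairs_def)
  then show ?thesis by (rule finite_subset) auto
qed

lemma infinite_factor_pairs_0: "\<not> finite (factor_pairs 0)"
proof
  assume "finite (factor_pairs 0)"
  then have "finite (snd ` factor_pairs 0)" by (rule finite_imageI)
  moreover have "snd ` factor_pairs 0 = UNIV"
    by (auto simp: factor_pairs_def image_iff)
  ultimately show False by simp
qed

lemma dnth_0 [simp]: "dnth f 0 = 0"
  using dnth[of f] by simp

lemma dser_eqI: "(\<And>n. n > 0 \<Longrightarrow> dnth f n = dnth g n) \<Longrightarrow> f = g"
proof -
  assume *: "\<And>n. n > 0 \<Longrightarrow> dnth f n = dnth g n"
  have "dnth f n = dnth g n" for n
    using * by (cases "n = 0") auto
  then show ?thesis by (simp add: dnth_inject[symmetric] fun_eq_iff)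
qed

instantiation dser :: comm_ring_1
begin

lift_definition zero_dser :: dser is "\<lambda>_. 0" by simp
lift_definition one_dser :: dser is "\<lambda>n. if n = 1 then 1 else 0" by simp
lift_definition plus_dser :: "dser \<Rightarrow> dser \<Rightarrow> dser" is "\<lambda>f g n. f n + g n" by simp
lift_definition minus_dser :: "dser \<Rightarrow> dser \<Rightarrow> dser" is "\<lambda>f g n. f n - g n" by simp
lift_definition uminus_dser :: "dser \<Rightarrow> dser" is "\<lambda>f n. - f n" by simp
lift_definition times_dser :: "dser \<Rightarrow> dser \<Rightarrow> dser" is
  "\<lambda>f g n. \<Sum>(a, b)\<in>factor_pairs n. f a * g b"
  by (simp add: infinite_factor_pairs_0)

instance
proof
  fix f g h :: dser
  show "f * g * h = f * (g * h)"
  proof (rule dser_eqI)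
    fix n :: nat assume n: "n > 0"
    have fin: "finite (factor_pairs m)" if "m dvd n" for m
      using that n by (intro finite_factor_pairs) (auto intro!: Nat.gr0I)
    have fin1: "finite (factor_pairs (fst p))" "finite (factor_pairs (snd p))" if "p \<in> factor_pairs n" for p
      using that fin by (force simp: factor_pairs_def)+
    have "dnth (f * g * h) n =
        (\<Sum>p\<in>factor_pairs n. \<Sum>r\<in>factor_pairs (fst p). dnth f (fst r) * dnth g (snd r) * dnth h (snd p))"
      by (simp add: times_dser.rep_eq case_prod_beta sum_distrib_right)
    also have "\<dots> = (\<Sum>(p, r)\<in>(SIGMA p:factor_pairs n. factor_pairs (fst p)).
                       dnth f (fst r) * dnth g (snd r) * dnth h (snd p))"
      using n fin1 by (subst sum.Sigma) (auto intro: finite_factor_pairs)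
    \<comment> \<open>Both index sets are the triples with product \<open>n\<close>, bracketed to
      the left before and to the right now.\<close>
    also have "\<dots> = (\<Sum>(p, r)\<in>(SIGMA p:factor_pairs n. factor_pairs (snd p)).
                       dnth f (fst p) * dnth g (fst r) * dnth h (snd r))"
      by (rule sum.reindex_bij_witness[of _
            "\<lambda>(p, r). ((fst p * fst r, snd r), (fst p, fst r))"
            "\<lambda>(p, r). ((fst r, snd r * snd p), (snd r, snd p))"])
         (auto simp: factor_pairs_def mult_ac)
    also have "\<dots> = (\<Sum>p\<in>factor_pairs n. \<Sum>r\<in>factor_pairs (snd p). dnth f (fst p) * dnth g (fst r) * dnth h (snd r))"
      using n fin1 by (subst sum.Sigma) (auto intro: finite_factor_pairs)
    also have "\<dots> = dnth (f * (g * h)) n"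
      by (simp add: times_dser.rep_eq case_prod_beta sum_distrib_left mult_ac)
    finally show "dnth (f * g * h) n = dnth (f * (g * h)) n" .
  qed
  show "f * g = g * f"
  proof (rule dser_eqI)
    fix n :: nat
    show "dnth (f * g) n = dnth (g * f) n"
      unfolding times_dser.rep_eq
      by (rule sum.reindex_bij_witness[of _ prod.swap prod.swap]) (auto simp: factor_pairs_def mult_ac)
  qed
  show "1 * f = f"
  proof (rule dser_eqI)
    fix n :: nat assume n: "n > 0"
    have "dnth (1 * f) n = (\<Sum>p\<in>factor_pairs n. if p = (1, n) then dnth f n else 0)"
      unfolding times_dser.rep_eq one_dser.rep_eq
      by (rule sum.cong) (auto simp: factor_pairs_def split: if_splits)
    also have "\<dots> = dnth f n"
      using n by (simp add: finite_factor_pairs) (simp add: factor_pairs_def)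
    finally show "dnth (1 * f) n = dnth f n" .
  qed
  show "(f + g) * h = f * h + g * h"
    by (rule dser_eqI)
       (simp add: times_dser.rep_eq plus_dser.rep_eq case_prod_beta ring_distribs sum.distrib)
  show "(0::dser) \<noteq> 1"
    by (simp add: dnth_inject[symmetric] fun_eq_iff zero_dser.rep_eq one_dser.rep_eq)
qed (auto intro!: dser_eqI simp: zero_dser.rep_eq one_dser.rep_eq plus_dser.rep_eq minus_dser.rep_eq uminus_dser.rep_eq)

end

lemma dnth_plus [simp]: "dnth (f + g) n = dnth f n + dnth g n"
  and dnth_minus [simp]: "dnth (f - g) n = dnth f n - dnth g n"
  and dnth_uminus [simp]: "dnth (- f) n = - dnth f n"
  and dnth_zero [simp]: "dnth 0 n = 0"
  by (simp_all add: plus_dser.rep_eq minus_dser.rep_eq uminus_dser.rep_eq zero_dser.rep_eq)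

lemma dnth_one: "dnth 1 n = (if n = 1 then 1 else 0)"
  by (simp add: one_dser.rep_eq)

lemma dnth_times: "dnth (f * g) n = (\<Sum>(a, b)\<in>factor_pairs n. dnth f a * dnth g b)"
  by (simp add: times_dser.rep_eq)

lift_definition dmonom :: "complex \<Rightarrow> nat \<Rightarrow> dser" is
  "\<lambda>c p n. if n = p \<and> n > 0 then c else 0" by simp

lemma dnth_dmonom: "dnth (dmonom c p) n = (if n = p \<and> n > 0 then c else 0)"
  by (simp add: dmonom.rep_eq)

lemma dnth_dmonom_times:
  assumes "p > 0"
  shows "dnth (dmonom c p * f) n = (if p dvd n then c * dnth f (n div p) else 0)"
proof (cases "n = 0")
  case n: False
  have "dnth (dmonom c p * f) n =
      (\<Sum>r\<in>factor_pairs n. if r = (p, n div p) then c * dnth f (n div p) else 0)"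
    unfolding dnth_times dnth_dmonom using assms
    by (intro sum.cong) (auto simp: factor_pairs_def split: if_splits)
  also have "\<dots> = (if p dvd n then c * dnth f (n div p) else 0)"
  proof -
    have "(p, n div p) \<in> factor_pairs n \<longleftrightarrow> p dvd n"
      unfolding factor_pairs_def by (metis (mono_tags, lifting) case_prod_conv dvd_mult_div_cancel dvd_triv_left mem_Collect_eq)
    then show ?thesis using finite_factor_pairs[of n] n by simp
  qed
  finally show ?thesis .
qed auto

text \<open>Truncation stands in for infinite Euler products. Divisors of a number up to
  \<open>P\<close> are themselves at most \<open>P\<close>, so products respect the
  relation.\<close>

definition eq_upto :: "nat \<Rightarrow> dser \<Rightarrow> dser \<Rightarrow> bool" where
  "eq_upto P f g \<longleftrightarrow> (\<forall>n\<le>P. dnth f n = dnth g n)"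

lemma eq_upto_refl [simp]: "eq_upto P f f"
  by (simp add: eq_upto_def)

lemma eq_upto_mult:
  assumes "eq_upto P f f'" "eq_upto P g g'"
  shows "eq_upto P (f * g) (f' * g')"
  unfolding eq_upto_def
proof safe
  fix n assume n: "n \<le> P"
  show "dnth (f * g) n = dnth (f' * g') n"
  proof (cases "n = 0")
    case False
    have "a \<le> P \<and> b \<le> P" if "(a, b) \<in> factor_pairs n" for a b
    proof -
      have "a dvd n" "b dvd n" using that by (auto simp: factor_pairs_def)
      then have "a \<le> n" "b \<le> n" using False by (auto intro: dvd_imp_le)
      then show ?thesis using n by auto
    qed
    then show ?thesis unfolding dnth_times using assms
      by (intro sum.cong) (auto simp: eq_upto_def)
  qed simp
qed

lemma eq_upto_power: "eq_upto P f f' \<Longrightarrow> eq_upto P (f ^ j) (f' ^ j)"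
  by (induction j) (auto intro: eq_upto_mult)

text \<open>The norm with weight \<open>n\<^sup>w\<close> is handled through its upper bounds, so that summability never has
  to be assumed separately.\<close>

definition dbound :: "real \<Rightarrow> dser \<Rightarrow> real \<Rightarrow> bool" where
  "dbound w f B \<longleftrightarrow> (\<forall>N. (\<Sum>n\<in>{1..N}. norm (dnth f n) * real n powr w) \<le> B)"

lemma dboundD: "dbound w f B \<Longrightarrow> (\<Sum>n\<in>{1..N}. norm (dnth f n) * real n powr w) \<le> B"
  by (simp add: dbound_def)

lemma dbound_nonneg: "dbound w f B \<Longrightarrow> B \<ge> 0"
  using dboundD[of w f B 0] by simp

lemma dbound_mono: "dbound w f B \<Longrightarrow> B \<le> C \<Longrightarrow> dbound w f C"
  by (auto simp: dbound_def intro: order_trans)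

lemma dbound_add:
  assumes "dbound w f B" "dbound w g C"
  shows "dbound w (f + g) (B + C)"
  unfolding dbound_def
proof
  fix N
  have "(\<Sum>n\<in>{1..N}. norm (dnth (f + g) n) * real n powr w) \<le>
        (\<Sum>n\<in>{1..N}. norm (dnth f n) * real n powr w + norm (dnth g n) * real n powr w)"
    by (intro sum_mono) (auto simp: ring_distribs[symmetric] intro!: mult_right_mono norm_triangle_ineq)
  also have "\<dots> \<le> B + C"
    using dboundD[OF assms(1), of N] dboundD[OF assms(2), of N] by (simp add: sum.distrib)
  finally show "(\<Sum>n\<in>{1..N}. norm (dnth (f + g) n) * real n powr w) \<le> B + C" .
qed

text \<open>Every pair with \<open>a * b \<le> N\<close> lies in the square \<open>{1..N} \<times> {1..N}\<close>.\<close>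

lemma sum_norm_times_le:
  fixes v :: "nat \<Rightarrow> real"
  assumes v: "\<And>a b. v (a * b) = v a * v b" "\<And>a. v a \<ge> 0"
  shows "(\<Sum>n\<in>{1..N}. norm (dnth (f * g) n) * v n) \<le>
         (\<Sum>n\<in>{1..N}. norm (dnth f n) * v n) * (\<Sum>n\<in>{1..N}. norm (dnth g n) * v n)"
proof -
  let ?u = "\<lambda>f n. norm (dnth f n) * v n"
  have "(\<Sum>n\<in>{1..N}. norm (dnth (f * g) n) * v n) \<le>
        (\<Sum>n\<in>{1..N}. \<Sum>r\<in>factor_pairs n. ?u f (fst r) * ?u g (snd r))"
  proof (rule sum_mono)
    fix n assume "n \<in> {1..N}"
    have "norm (dnth (f * g) n) * v n \<le> (\<Sum>r\<in>factor_pairs n. norm (dnth f (fst r) * dnth g (snd r))) * v n"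
      unfolding dnth_times case_prod_beta by (intro mult_right_mono sum_norm_le v) auto
    also have "\<dots> = (\<Sum>r\<in>factor_pairs n. ?u f (fst r) * ?u g (snd r))"
      unfolding sum_distrib_right by (intro sum.cong refl) (auto simp: factor_pairs_def norm_mult v)
    finally show "norm (dnth (f * g) n) * v n \<le> (\<Sum>r\<in>factor_pairs n. ?u f (fst r) * ?u g (snd r))" .
  qed
  also have "\<dots> = (\<Sum>(n, r)\<in>(SIGMA n:{1..N}. factor_pairs n). ?u f (fst r) * ?u g (snd r))"
    by (subst sum.Sigma) (auto intro: finite_factor_pairs)
  also have "\<dots> = (\<Sum>r\<in>{(a, b). a \<in> {1..N} \<and> b \<in> {1..N} \<and> a * b \<le> N}. ?u f (fst r) * ?u g (snd r))"
  proof (rule sum.reindex_bij_witness[of _ "\<lambda>r. (fst r * snd r, r)" snd])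
    fix x assume "x \<in> (SIGMA n:{1..N}. factor_pairs n)"
    then obtain n a b where x: "x = (n, (a, b))" and n: "n \<in> {1..N}" and ab: "a * b = n"
      by (cases x) (auto simp: factor_pairs_def)
    have "a \<le> n" "b \<le> n" "a > 0" "b > 0" using ab n by (auto intro!: Nat.gr0I)
    then show "snd x \<in> {(a, b). a \<in> {1..N} \<and> b \<in> {1..N} \<and> a * b \<le> N}"
      using n ab x by auto
  qed (auto simp: factor_pairs_def Suc_le_eq)
  also have "\<dots> \<le> (\<Sum>r\<in>{1..N} \<times> {1..N}. ?u f (fst r) * ?u g (snd r))"
    by (intro sum_mono2) (auto simp: v)
  also have "\<dots> = (\<Sum>n\<in>{1..N}. ?u f n) * (\<Sum>n\<in>{1..N}. ?u g n)"
    by (simp add: sum_product sum.cartesian_product case_prod_beta)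
  finally show ?thesis .
qed

lemma dbound_mult:
  assumes "dbound w f B" "dbound w g C"
  shows "dbound w (f * g) (B * C)"
  unfolding dbound_def
proof
  fix N
  have "(\<Sum>n\<in>{1..N}. norm (dnth (f * g) n) * real n powr w) \<le>
        (\<Sum>n\<in>{1..N}. norm (dnth f n) * real n powr w) * (\<Sum>n\<in>{1..N}. norm (dnth g n) * real n powr w)"
    by (rule sum_norm_times_le) (auto simp: powr_mult)
  also have "\<dots> \<le> B * C"
    by (intro mult_mono dboundD assms sum_nonneg) (use dbound_nonneg[OF assms(1)] in auto)
  finally show "(\<Sum>n\<in>{1..N}. norm (dnth (f * g) n) * real n powr w) \<le> B * C" .
qed

lemma dbound_dmonom:
  assumes "p > 0"
  shows "dbound w (dmonom c p) (norm c * real p powr w)"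
  unfolding dbound_def
proof
  fix N
  have "(\<Sum>n\<in>{1..N}. norm (dnth (dmonom c p) n) * real n powr w) =
        (\<Sum>n\<in>{1..N}. if n = p then norm c * real p powr w else 0)"
    using assms by (intro sum.cong) (auto simp: dnth_dmonom)
  also have "\<dots> \<le> norm c * real p powr w"
    by simp
  finally show "(\<Sum>n\<in>{1..N}. norm (dnth (dmonom c p) n) * real n powr w) \<le> norm c * real p powr w" .
qed

lemma dmonom_1: "dmonom 1 1 = 1"
  by (rule dser_eqI) (simp add: dnth_dmonom dnth_one)

lemma dbound_1: "dbound w 1 1"
  using dbound_dmonom[of 1 w 1] by (simp add: dmonom_1[simplified])

lemma dbound_power: "dbound w f B \<Longrightarrow> dbound w (f ^ j) (B ^ j)"
  by (induction j) (auto intro: dbound_1 dbound_mult)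

lemma dbound_prod:
  assumes "\<And>p. p \<in> S \<Longrightarrow> dbound w (f p) (B p)"
  shows "dbound w (prod f S) (prod B S)"
  using assms by (induction S rule: infinite_finite_induct) (auto intro: dbound_1 dbound_mult)

lemma dbound_summable:
  assumes "dbound w f B"
  shows "summable (\<lambda>n. norm (dnth f n) * real n powr w)"
    and "(\<Sum>n. norm (dnth f n) * real n powr w) \<le> B"
proof -
  have bd: "(\<Sum>n<N. norm (dnth f n) * real n powr w) \<le> B" for N
  proof -
    have "(\<Sum>n<N. norm (dnth f n) * real n powr w) \<le> (\<Sum>n\<in>{0..N}. norm (dnth f n) * real n powr w)"
      by (intro sum_mono2) auto
    also have "\<dots> = (\<Sum>n\<in>{1..N}. norm (dnth f n) * real n powr w)"
      by (intro sum.mono_neutral_right) auto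
    finally show ?thesis using dboundD[OF assms, of N] by linarith
  qed
  show "summable (\<lambda>n. norm (dnth f n) * real n powr w)"
    by (rule summableI_nonneg_bounded[where x = B]) (use bd in auto)
  then show "(\<Sum>n. norm (dnth f n) * real n powr w) \<le> B"
    by (rule suminf_le_const) (use bd in auto)
qed

section \<open>Evaluation of a series at a complex point\<close>

definition deval :: "complex \<Rightarrow> dser \<Rightarrow> complex" where
  "deval s f = (\<Sum>\<^sub>\<infinity>n\<in>{0<..}. dnth f n * of_nat n powr (- s))"

definition dsummable :: "complex \<Rightarrow> dser \<Rightarrow> bool" where
  "dsummable s f \<longleftrightarrow> (\<lambda>n. norm (dnth f n * of_nat n powr (- s))) summable_on {0<..}"

lemma norm_nat_powr: "n > 0 \<Longrightarrow> norm (of_nat n powr s :: complex) = real n powr Re s"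
  using norm_powr_real_powr[of "of_nat n" s] by simp

lemma dbound_imp_dsummable:
  assumes "dbound (- Re s) f B"
  shows "dsummable s f"
proof -
  have "summable (\<lambda>n. norm (norm (dnth f n) * real n powr (- Re s)))"
    using dbound_summable(1)[OF assms] by (simp add: abs_mult)
  then have "(\<lambda>n. norm (dnth f n) * real n powr (- Re s)) summable_on UNIV"
    by (rule norm_summable_imp_summable_on)
  then have "(\<lambda>n. norm (dnth f n) * real n powr (- Re s)) summable_on {0<..}"
    by (rule summable_on_subset_banach) auto
  then show ?thesis unfolding dsummable_def
    by (rule summable_on_cong[THEN iffD1, rotated]) (auto simp: norm_mult norm_nat_powr)
qed

text \<open>Values are unordered sums, so the absolutely convergent double sum over
  \<open>(a, b)\<close> may be regrouped along \<open>n = a * b\<close>; \<open>bij\<close> is this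
  regrouping.\<close>

lemma deval_mult:
  assumes f: "dsummable s f" and g: "dsummable s g"
  shows "dsummable s (f * g)" and "deval s (f * g) = deval s f * deval s g"
proof -
  let ?u = "\<lambda>f n. dnth f n * of_nat n powr (- s)"
  have ab: "(\<lambda>r. norm (case r of (a, b) \<Rightarrow> ?u f a * ?u g b)) summable_on {0<..} \<times> {0<..}"
    using f g unfolding dsummable_def
    by (subst Infinite_Sum.abs_summable_on_Sigma_iff)
       (auto simp: norm_mult infsum_cmult_right' abs_mult intro!: summable_on_cmult_right summable_on_cmult_left)
  have bij: "bij_betw (\<lambda>(n::nat, r::nat\<times>nat). r) (SIGMA n:{0<..}. factor_pairs n) ({0<..} \<times> {0<..})"
    by (rule bij_betwI[of _ _ _ "\<lambda>r. (fst r * snd r, r)"]) (auto simp: factor_pairs_def)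
  have ab2: "(\<lambda>z. norm (case z of (n, r) \<Rightarrow> ?u f (fst r) * ?u g (snd r))) summable_on (SIGMA n:{0<..}. factor_pairs n)"
    using summable_on_reindex_bij_betw[OF bij, of "\<lambda>r. norm (?u f (fst r) * ?u g (snd r))"] ab
    by (simp add: case_prod_beta)
  have inner: "(\<Sum>\<^sub>\<infinity>r\<in>factor_pairs n. ?u f (fst r) * ?u g (snd r)) = ?u (f * g) n" if "n > 0" for n
  proof -
    have "(\<Sum>\<^sub>\<infinity>r\<in>factor_pairs n. ?u f (fst r) * ?u g (snd r)) =
          (\<Sum>r\<in>factor_pairs n. dnth f (fst r) * dnth g (snd r) * of_nat n powr (- s))"
      using finite_factor_pairs[OF that]
      by (auto intro!: sum.cong simp: factor_pairs_def powr_times_real)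
    then show ?thesis by (simp add: dnth_times sum_distrib_right case_prod_beta)
  qed
  have "(\<lambda>n. norm (\<Sum>\<^sub>\<infinity>r\<in>factor_pairs n. ?u f (fst r) * ?u g (snd r))) summable_on {0<..}"
  proof -
    have "(\<lambda>n. \<Sum>\<^sub>\<infinity>r\<in>factor_pairs n. norm (?u f (fst r) * ?u g (snd r))) summable_on {0<..}"
      using summable_on_Sigma_banach[of "\<lambda>n r. norm (?u f (fst r) * ?u g (snd r))" "{0<..}" factor_pairs] ab2
      by (simp add: case_prod_unfold)
    then show ?thesis
      by (rule summable_on_comparison_test) 
         (auto simp: finite_factor_pairs intro!: sum_norm_le)
  qed
  then show "dsummable s (f * g)"
    unfolding dsummable_def by (rule summable_on_cong[THEN iffD1, rotated]) (simp add: inner)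
  have "deval s f * deval s g = (\<Sum>\<^sub>\<infinity>(a, b)\<in>{0<..} \<times> {0<..}. ?u f a * ?u g b)"
    using infsum_Sigma_banach[OF Infinite_Sum.abs_summable_summable[OF ab], symmetric]
    by (simp add: deval_def infsum_cmult_right' infsum_cmult_left')
  also have "\<dots> = (\<Sum>\<^sub>\<infinity>(n, r)\<in>(SIGMA n:{0<..}. factor_pairs n). ?u f (fst r) * ?u g (snd r))"
    using infsum_reindex_bij_betw[OF bij, of "\<lambda>r. ?u f (fst r) * ?u g (snd r)"]
    by (simp add: case_prod_unfold)
  also have "\<dots> = (\<Sum>\<^sub>\<infinity>n\<in>{0<..}. \<Sum>\<^sub>\<infinity>r\<in>factor_pairs n. ?u f (fst r) * ?u g (snd r))"
    using infsum_Sigma_banach[OF Infinite_Sum.abs_summable_summable[OF ab2]] by simp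
  also have "\<dots> = deval s (f * g)"
    unfolding deval_def by (intro infsum_cong) (simp add: inner)
  finally show "deval s (f * g) = deval s f * deval s g" ..
qed

section \<open>Euler products over finite sets of primes\<close>

text \<open>Expanding the product selects a subset of \<open>S\<close>. By unique factorization the
  subset is recovered from the product of its members, so a squarefree \<open>n\<close> arises
  exactly once and no other \<open>n\<close> arises.\<close>

lemma dnth_prod_linear:
  assumes "finite S" "\<And>p. p \<in> S \<Longrightarrow> prime p"
  shows "dnth (\<Prod>p\<in>S. 1 + dmonom (a p) p) n =
    (if squarefree n \<and> prime_factors n \<subseteq> S then \<Prod>p\<in>prime_factors n. a p else 0)"
  using assms
proof (induction S arbitrary: n rule: finite_induct)
  case empty
  have "prime_factors n = {} \<longleftrightarrow> n = 1" if "squarefree n"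
    using that by (cases "n = 0") (auto simp: prime_factorization_empty_iff)
  then show ?case by (auto simp: dnth_one)
next
  case (insert p S)
  define F where "F = (\<Prod>p\<in>S. 1 + dmonom (a p) p)"
  have p: "prime p" "p > 0" using insert.prems prime_gt_0_nat by auto
  have IH: "dnth F m = (if squarefree m \<and> prime_factors m \<subseteq> S then \<Prod>p\<in>prime_factors m. a p else 0)" for m
    unfolding F_def using insert by auto
  have "dnth (\<Prod>p\<in>insert p S. 1 + dmonom (a p) p) n = dnth F n + (if p dvd n then a p * dnth F (n div p) else 0)"
    using insert.hyps p by (simp add: F_def[symmetric] ring_distribs dnth_dmonom_times)
  also have "\<dots> = (if squarefree n \<and> prime_factors n \<subseteq> insert p S then \<Prod>p\<in>prime_factors n. a p else 0)"
  proof (cases "n = 0")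
    case n: False
    show ?thesis
    proof (cases "p dvd n")
      case False
      then have "p \<notin> prime_factors n" by auto
      then show ?thesis using False by (auto simp: IH)
    next
      case True
      then obtain m where m: "n = p * m" by auto
      have m0: "m > 0" using n m by auto
      \<comment> \<open>Since \<open>p\<close> is not in \<open>S\<close>, the old product has no
        coefficient at a multiple of \<open>p\<close>; everything comes from
        \<open>n div p\<close>.\<close>
      have "p \<in> prime_factors n" using True p n by (auto simp: prime_factors_dvd)
      then have Fn: "dnth F n = 0" using insert.hyps by (auto simp: IH)
      have pf: "prime_factors n = insert p (prime_factors m)"
        using p m0 unfolding m by (subst prime_factors_product) (auto simp: prime_prime_factors)
      show ?thesis
      proof (cases "p dvd m")
        case True
        then have "p ^ 2 dvd n" by (auto simp: m power2_eq_square)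
        then have "\<not> squarefree n" using p by (auto simp: squarefree_def)
        moreover have "p \<in> prime_factors m" using True p m0 by (auto simp: prime_factors_dvd)
        ultimately show ?thesis using True Fn insert.hyps p by (auto simp: IH m)
      next
        case False
        then have cop: "coprime p m" using p by (simp add: prime_imp_coprime)
        have sq: "squarefree n \<longleftrightarrow> squarefree m"
          unfolding m using squarefree_mult_coprime[OF cop squarefree_prime[OF p(1)]] squarefree_mono[of m "p * m"] by auto
        have "p \<notin> prime_factors m" using False by auto
        then show ?thesis using Fn p insert.hyps unfolding sq pf by (auto simp: IH m)
      qed
    qed
  qed auto
  finally show ?case .
qed

text \<open>The coefficients carry a factor \<open>1 / n\<close>, so evaluation of \<open>dZ\<close> at \<open>s\<close> is \<open>\<zeta>(1 + s)\<close> and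
  that of \<open>dMu\<close> is its inverse.\<close>

lift_definition dZ :: dser is "\<lambda>n. 1 / of_nat n" by simp

lemma dnth_dZ: "dnth dZ n = 1 / of_nat n"
  by (simp add: dZ.rep_eq)

lift_definition dMu :: dser is
  "\<lambda>n. if squarefree n then \<Prod>p\<in>prime_factors n. - 1 / of_nat p else 0"
  by simp

lemma dnth_dMu: "dnth dMu n = (if squarefree n then \<Prod>p\<in>prime_factors n. - 1 / of_nat p else 0)"
  by (simp add: dMu.rep_eq)

text \<open>The geometric series in \<open>1 / p\<close>, that is, the Euler factor of
  \<open>\<zeta>(1 + s)\<close> at the single prime \<open>p\<close>. It inverts
  \<open>1 - 1 / p\<close> at \<open>p\<close> when \<open>k\<close> is negative.\<close>

lift_definition dG :: "nat \<Rightarrow> dser" is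
  "\<lambda>p n. if n > 0 \<and> (\<exists>i. n = p ^ i) then 1 / of_nat n else 0" by simp

lemma dnth_dG: "dnth (dG p) n = (if n > 0 \<and> (\<exists>i. n = p ^ i) then 1 / of_nat n else 0)"
  by (simp add: dG.rep_eq)

definition mu_part :: "nat set \<Rightarrow> dser" where
  "mu_part S = (\<Prod>p\<in>S. 1 + dmonom (- 1 / of_nat p) p)"

text \<open>The sieve of Eratosthenes. Because \<open>1 / n\<close> is completely multiplicative,
  the factor belonging to \<open>p\<close> cancels exactly the multiples of
  \<open>p\<close>.\<close>

lemma dnth_dZ_mu_part:
  assumes "finite S" "\<And>p. p \<in> S \<Longrightarrow> prime p"
  shows "dnth (dZ * mu_part S) n = (if \<forall>p\<in>S. \<not> p dvd n then 1 / of_nat n else 0)"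
  using assms unfolding mu_part_def
proof (induction S arbitrary: n rule: finite_induct)
  case empty
  show ?case by (simp add: dnth_dZ)
next
  case (insert p S)
  define F where "F = dZ * (\<Prod>p\<in>S. 1 + dmonom (- 1 / of_nat p) p)"
  have p: "prime p" "p > 0" using insert.prems prime_gt_0_nat by auto
  have IH: "dnth F m = (if \<forall>p\<in>S. \<not> p dvd m then 1 / of_nat m else 0)" for m
    unfolding F_def using insert by auto
  have "dZ * (\<Prod>p\<in>insert p S. 1 + dmonom (- 1 / of_nat p) p) = F + dmonom (- 1 / of_nat p) p * F"
    using insert.hyps by (simp add: F_def algebra_simps)
  then have eq: "dnth (dZ * (\<Prod>p\<in>insert p S. 1 + dmonom (- 1 / of_nat p) p)) n =
      dnth F n + (if p dvd n then - 1 / of_nat p * dnth F (n div p) else 0)"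
    using p by (simp add: dnth_dmonom_times)
  show ?case
  proof (cases "p dvd n")
    case True
    then obtain m where m: "n = p * m" by auto
    have "(\<forall>r\<in>S. \<not> r dvd n) \<longleftrightarrow> (\<forall>r\<in>S. \<not> r dvd m)"
    proof -
      have "r dvd n \<longleftrightarrow> r dvd m" if "r \<in> S" for r
        using that insert.hyps insert.prems p primes_dvd_imp_eq[of r p] unfolding m
        by (auto simp: prime_dvd_mult_iff)
      then show ?thesis by blast
    qed
    then show ?thesis unfolding eq IH using True p by (auto simp: m)
  next
    case False
    then show ?thesis unfolding eq IH by simp
  qed
qed

abbreviation primes_upto :: "nat \<Rightarrow> nat set" where
  "primes_upto P \<equiv> {p. prime p \<and> p \<le> P}"

lemma finite_primes_upto [simp]: "finite (primes_upto P)"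
  by (rule finite_subset[of _ "{..P}"]) auto

lemma prime_factors_le: "n \<le> P \<Longrightarrow> prime_factors n \<subseteq> primes_upto (P::nat)"
proof
  fix p assume n: "n \<le> P" and "p \<in> prime_factors n"
  then have "prime p" "p dvd n" "n > 0" by (auto simp: prime_factors_dvd intro!: Nat.gr0I)
  then show "p \<in> primes_upto P" using n by (auto dest: dvd_imp_le)
qed

lemma dMu_eq_upto: "eq_upto P dMu (mu_part (primes_upto P))"
  unfolding eq_upto_def mu_part_def using prime_factors_le
  by (subst dnth_prod_linear) (auto simp: dnth_dMu)

text \<open>No \<open>n\<close> with \<open>1 < n \<le> P\<close> survives the sieve by all primes
  up to \<open>P\<close>.\<close>

lemma dZ_mu_part_eq_upto: "eq_upto P (dZ * mu_part (primes_upto P)) 1"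
  unfolding eq_upto_def
proof safe
  fix n assume n: "n \<le> P"
  have "(\<forall>p\<in>primes_upto P. \<not> p dvd n) \<longleftrightarrow> n = 1" if n0: "n > 0"
  proof
    assume *: "\<forall>p\<in>primes_upto P. \<not> p dvd n"
    show "n = 1"
    proof (rule ccontr)
      assume "n \<noteq> 1"
      then obtain p where p: "prime p" "p dvd n" using prime_factor_nat by blast
      then have "p \<le> n" using n0 by (auto intro: dvd_imp_le)
      with p * n show False by auto
    qed
  qed (auto simp: prime_gt_1_nat)
  then show "dnth (dZ * mu_part (primes_upto P)) n = dnth 1 n"
    by (subst dnth_dZ_mu_part) (auto simp: dnth_one)
qed

lemma dZ_dMu: "dZ * dMu = 1"
proof (rule dser_eqI)
  fix n :: nat
  have "eq_upto n (dZ * dMu) (dZ * mu_part (primes_upto n))"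
    by (intro eq_upto_mult dMu_eq_upto) auto
  then show "dnth (dZ * dMu) n = dnth 1 n"
    using dZ_mu_part_eq_upto[of n] by (simp add: eq_upto_def)
qed

lemma dG_inverse:
  assumes p: "prime p"
  shows "dG p * (1 + dmonom (- 1 / of_nat p) p) = 1"
proof (rule dser_eqI)
  fix n :: nat assume n: "n > 0"
  have p1: "p > 1" "p > 0" using p prime_gt_1_nat prime_gt_0_nat by auto
  have "dG p * (1 + dmonom (- 1 / of_nat p) p) = dG p + dmonom (- 1 / of_nat p) p * dG p"
    by (simp add: algebra_simps)
  then have eq: "dnth (dG p * (1 + dmonom (- 1 / of_nat p) p)) n =
      dnth (dG p) n + (if p dvd n then - 1 / of_nat p * dnth (dG p) (n div p) else 0)"
    using p1 by (simp add: dnth_dmonom_times)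
  show "dnth (dG p * (1 + dmonom (- 1 / of_nat p) p)) n = dnth 1 n"
  proof (cases "p dvd n")
    case True
    then obtain m where m: "n = p * m" by auto
    have iff: "(\<exists>i. n = p ^ i) \<longleftrightarrow> (\<exists>i. m = p ^ i)"
    proof
      assume "\<exists>i. n = p ^ i"
      then obtain i where i: "n = p ^ i" ..
      with True p1 have "i \<noteq> 0" by (intro notI) auto
      then obtain i' where "i = Suc i'" by (cases i) auto
      with i m p1 show "\<exists>i. m = p ^ i" by auto
    next
      assume "\<exists>i. m = p ^ i"
      then obtain i where "m = p ^ i" ..
      then have "n = p ^ Suc i" by (simp add: m)
      then show "\<exists>i. n = p ^ i" ..
    qed
    have "n \<noteq> 1" using True p1 by auto
    then show ?thesis unfolding eq dnth_dG iff using True p1 n m by (auto simp: dnth_one)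
  next
    case False
    have "(\<exists>i. n = p ^ i) \<longleftrightarrow> n = 1"
    proof
      assume "\<exists>i. n = p ^ i"
      then obtain i where "n = p ^ i" ..
      with False show "n = 1" by (cases i) auto
    next
      assume "n = 1"
      then show "\<exists>i. n = p ^ i" by (intro exI[of _ 0]) auto
    qed
    then show ?thesis unfolding eq dnth_dG using False n by (auto simp: dnth_one)
  qed
qed

section \<open>Explicit bounds for zeta to the right of its pole\<close>

lemma powr_telescope_bound:
  fixes \<sigma> :: real
  assumes "\<sigma> > 0" "n \<ge> 1"
  shows "\<sigma> * real (Suc n) powr (- 1 - \<sigma>) \<le> real n powr (- \<sigma>) - real (Suc n) powr (- \<sigma>)"
proof -
  define x where "x = 1 / real (Suc n)"
  have x: "0 < x" "x < 1" using assms by (auto simp: x_def)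
  have "1 + \<sigma> * x \<le> exp (\<sigma> * x)" using exp_ge_add_one_self[of "\<sigma> * x"] by simp
  also have "\<dots> \<le> exp (- \<sigma> * ln (1 - x))"
    using assms x ln_le_minus_one[of "1 - x"] by (simp add: mult_left_mono[of x "- ln (1 - x)" \<sigma>, simplified])
  also have "\<dots> = (1 - x) powr (- \<sigma>)" using x by (simp add: powr_def)
  finally have *: "1 + \<sigma> * x \<le> (1 - x) powr (- \<sigma>)" .
  have "real n = real (Suc n) * (1 - x)" by (simp add: x_def field_simps)
  then have "real n powr (- \<sigma>) = real (Suc n) powr (- \<sigma>) * (1 - x) powr (- \<sigma>)"
    using x by (metis powr_mult)
  also have "\<dots> \<ge> real (Suc n) powr (- \<sigma>) * (1 + \<sigma> * x)"
    using * by (intro mult_left_mono) auto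
  also have "real (Suc n) powr (- \<sigma>) * (1 + \<sigma> * x) =
      real (Suc n) powr (- \<sigma>) + \<sigma> * (real (Suc n) powr (- \<sigma>) * x)"
    by (simp add: algebra_simps)
  also have "real (Suc n) powr (- \<sigma>) * x = real (Suc n) powr (- 1 - \<sigma>)"
    by (simp add: x_def powr_diff powr_minus field_simps)
  finally show ?thesis by simp
qed

text \<open>The telescoping bound replaces comparison with an integral. The explicit
  \<open>1 / \<sigma>\<close> matters: it enters the 3-4-1 argument close to the line, and it is
  used with \<open>\<sigma> = 1 / LL q\<close> for the primes dividing \<open>q\<close>.\<close>

lemma sum_powr_le:
  fixes \<sigma> :: real
  assumes "\<sigma> > 0"
  shows "(\<Sum>n=1..N. real n powr (- 1 - \<sigma>)) \<le> 1 + 1 / \<sigma>"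
proof -
  have "(\<Sum>n=1..N. real n powr (- 1 - \<sigma>)) \<le> 1 + (1 - real N powr (- \<sigma>)) / \<sigma>" if "N \<ge> 1" for N
    using that
  proof (induction N rule: dec_induct)
    case (step n)
    have "real (Suc n) powr (- 1 - \<sigma>) \<le> (real n powr (- \<sigma>) - real (Suc n) powr (- \<sigma>)) / \<sigma>"
      using powr_telescope_bound[of \<sigma> n] step assms by (simp add: field_simps)
    moreover have "(real n powr (- \<sigma>) - real (Suc n) powr (- \<sigma>)) / \<sigma> =
        (1 - real (Suc n) powr (- \<sigma>)) / \<sigma> - (1 - real n powr (- \<sigma>)) / \<sigma>"
      by (simp add: diff_divide_distrib)
    ultimately show ?case using step by simp
  qed auto
  moreover have "(1 - real N powr (- \<sigma>)) / \<sigma> \<le> 1 / \<sigma>"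
    using assms by (intro divide_right_mono) auto
  ultimately show ?thesis
    using assms by (cases "N \<ge> 1") (force, simp add: not_le)
qed

lemma dbound_zeta:
  assumes "\<sigma> > 0" "\<And>n. n > 0 \<Longrightarrow> norm (dnth f n) \<le> 1 / real n"
  shows "dbound (- \<sigma>) f (1 + 1 / \<sigma>)"
  unfolding dbound_def
proof
  fix N
  have "(\<Sum>n\<in>{1..N}. norm (dnth f n) * real n powr - \<sigma>) \<le> (\<Sum>n=1..N. real n powr (- 1 - \<sigma>))"
  proof (rule sum_mono)
    fix n assume n: "n \<in> {1..N}"
    have "norm (dnth f n) * real n powr - \<sigma> \<le> 1 / real n * real n powr - \<sigma>"
      using n assms by (intro mult_right_mono) auto
    also have "\<dots> = real n powr (- 1 - \<sigma>)"
      using n by (simp add: powr_diff powr_minus field_simps)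
    finally show "norm (dnth f n) * real n powr - \<sigma> \<le> real n powr (- 1 - \<sigma>)" .
  qed
  also have "\<dots> \<le> 1 + 1 / \<sigma>" by (rule sum_powr_le) fact
  finally show "(\<Sum>n\<in>{1..N}. norm (dnth f n) * real n powr - \<sigma>) \<le> 1 + 1 / \<sigma>" .
qed

lemma norm_dZ: "norm (dnth dZ n) = 1 / real n"
  by (simp add: dnth_dZ norm_divide)

lemma squarefree_prod_prime_factors:
  fixes n :: nat
  assumes "squarefree n"
  shows "(\<Prod>p\<in>prime_factors n. p) = n"
proof -
  have n: "n > 0" using assms by (auto intro!: Nat.gr0I)
  have "(\<Prod>p\<in>prime_factors n. p) = (\<Prod>p\<in>prime_factors n. p ^ multiplicity p n)"
    using assms n squarefree_factorial_semiring'[of n] by (intro prod.cong) auto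
  also have "\<dots> = n" using n by (simp add: prod_prime_factors)
  finally show ?thesis .
qed

lemma norm_dMu:
  assumes "n > 0"
  shows "norm (dnth dMu n) \<le> 1 / real n"
proof (cases "squarefree n")
  case True
  have "norm (dnth dMu n) = (\<Prod>p\<in>prime_factors n. 1 / real p)"
    using True by (simp add: dnth_dMu prod_norm[symmetric] norm_divide)
  also have "\<dots> = 1 / real (\<Prod>p\<in>prime_factors n. p)"
    by (simp add: prod_dividef)
  finally show ?thesis using True by (simp add: squarefree_prod_prime_factors)
qed (simp add: dnth_dMu)

section \<open>Values of zeta, of its inverse and of finite Euler products\<close>

lemma dsummable_dZ_dMu:
  assumes "Re s > 0"
  shows "dsummable s dZ" "dsummable s dMu"
  using assms by (auto intro!: dbound_imp_dsummable dbound_zeta norm_dMu simp: norm_dZ)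

lemma deval_one: "deval s 1 = 1" "dsummable s 1"
proof -
  show "dsummable s 1" by (rule dbound_imp_dsummable[OF dbound_1])
  have "deval s 1 = (\<Sum>\<^sub>\<infinity>n\<in>{1::nat}. 1)"
    unfolding deval_def by (rule infsum_cong_neutral) (auto simp: dnth_one)
  then show "deval s 1 = 1" by simp
qed

lemma deval_dmonom:
  assumes "p > 0"
  shows "deval s (dmonom c p) = c * of_nat p powr (- s)" "dsummable s (dmonom c p)"
proof -
  show "dsummable s (dmonom c p)" by (rule dbound_imp_dsummable[OF dbound_dmonom[OF assms]])
  have "deval s (dmonom c p) = (\<Sum>\<^sub>\<infinity>n\<in>{p}. c * of_nat n powr (- s))"
    unfolding deval_def by (rule infsum_cong_neutral) (use assms in \<open>auto simp: dnth_dmonom\<close>)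
  then show "deval s (dmonom c p) = c * of_nat p powr (- s)" by simp
qed

lemma deval_add:
  assumes "dsummable s f" "dsummable s g"
  shows "dsummable s (f + g)" "deval s (f + g) = deval s f + deval s g"
proof -
  have *: "(\<lambda>n. norm (dnth f n * of_nat n powr - s) + norm (dnth g n * of_nat n powr - s)) summable_on {0<..}"
    using assms unfolding dsummable_def by (rule summable_on_add)
  show "dsummable s (f + g)" unfolding dsummable_def
    by (rule summable_on_comparison_test[OF *]) (auto simp: ring_distribs norm_triangle_ineq)
  show "deval s (f + g) = deval s f + deval s g"
    unfolding deval_def using assms[unfolded dsummable_def, THEN Infinite_Sum.abs_summable_summable]
    by (simp add: ring_distribs infsum_add)
qed

lemma deval_power:
  assumes "dsummable s f"
  shows "dsummable s (f ^ j) \<and> deval s (f ^ j) = deval s f ^ j"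
  using assms by (induction j) (auto simp: deval_one deval_mult)

lemma deval_prod:
  assumes "\<And>p. p \<in> S \<Longrightarrow> dsummable s (f p)"
  shows "dsummable s (prod f S) \<and> deval s (prod f S) = (\<Prod>p\<in>S. deval s (f p))"
  using assms by (induction S rule: infinite_finite_induct) (auto simp: deval_one deval_mult)

lemma deval_dZ_dMu:
  assumes "Re s > 0"
  shows "deval s dZ * deval s dMu = 1"
  using deval_mult(2)[OF dsummable_dZ_dMu[OF assms]] by (simp add: dZ_dMu deval_one)

lemma deval_mu_part:
  assumes "\<And>p. p \<in> S \<Longrightarrow> prime p"
  shows "dsummable s (mu_part S) \<and> deval s (mu_part S) = (\<Prod>p\<in>S. 1 - of_nat p powr (- 1 - s))"
proof -
  have 1: "dsummable s (1 + dmonom (- 1 / of_nat p) p)"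
     "deval s (1 + dmonom (- 1 / of_nat p) p) = 1 - of_nat p powr (- 1 - s)" if "p \<in> S" for p
  proof -
    have p: "p > 0" using assms that prime_gt_0_nat by blast
    note * = deval_add[OF deval_one(2) deval_dmonom(2)[OF p], of s "- 1 / of_nat p"]
    show "dsummable s (1 + dmonom (- 1 / of_nat p) p)" by (rule *)
    show "deval s (1 + dmonom (- 1 / of_nat p) p) = 1 - of_nat p powr (- 1 - s)"
      unfolding *(2) deval_one deval_dmonom(1)[OF p] using p
      by (simp add: powr_diff powr_minus field_simps)
  qed
  show ?thesis unfolding mu_part_def
    using deval_prod[of S s "\<lambda>p. 1 + dmonom (- 1 / of_nat p) p"] 1 by simp
qed

lemma harm_le_ln: "N \<ge> 1 \<Longrightarrow> (\<Sum>n=1..N. 1 / real n) \<le> 1 + ln (real N)"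
proof (induction N rule: dec_induct)
  case (step n)
  have "ln (real n / real (Suc n)) \<le> real n / real (Suc n) - 1"
    using step by (intro ln_le_minus_one) auto
  then have "1 / real (Suc n) \<le> ln (real (Suc n)) - ln (real n)"
    using step by (simp add: ln_div field_simps)
  with step show ?case by simp
qed auto

lemma sum_norm_power_le:
  assumes f: "\<And>n. n > 0 \<Longrightarrow> norm (dnth f n) \<le> 1 / real n" and N: "N \<ge> 1"
  shows "(\<Sum>n=1..N. norm (dnth (f ^ j) n)) \<le> (1 + ln (real N)) ^ j"
proof (induction j)
  case 0
  have "(\<Sum>n=1..N. norm (dnth 1 n)) = (\<Sum>n=1..N. if n = 1 then 1 else 0)"
    by (intro sum.cong) (auto simp: dnth_one)
  also have "\<dots> \<le> 1" by simp
  finally show ?case by simp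
next
  case (Suc j)
  have "(\<Sum>n=1..N. norm (dnth (f ^ Suc j) n)) \<le>
      (\<Sum>n=1..N. norm (dnth f n)) * (\<Sum>n=1..N. norm (dnth (f ^ j) n))"
    using sum_norm_times_le[of "\<lambda>_. 1" f "f ^ j" N] by simp
  also have "\<dots> \<le> (1 + ln (real N)) * (1 + ln (real N)) ^ j"
  proof (intro mult_mono Suc)
    have "(\<Sum>n=1..N. norm (dnth f n)) \<le> (\<Sum>n=1..N. 1 / real n)"
      by (intro sum_mono f) auto
    also have "\<dots> \<le> 1 + ln (real N)" by (rule harm_le_ln[OF N])
    finally show "(\<Sum>n=1..N. norm (dnth f n)) \<le> 1 + ln (real N)" .
  qed (use N in \<open>auto intro: sum_nonneg\<close>)
  finally show ?case by simp
qed

section \<open>The 3-4-1 inequality\<close>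

lemma deval_partial_sums:
  assumes "dsummable s f"
  shows "(\<lambda>N. \<Sum>n=1..N. dnth f n * of_nat n powr (- s)) \<longlonglongrightarrow> deval s f"
proof -
  have "((\<lambda>n. dnth f n * of_nat n powr (- s)) has_sum deval s f) {0<..}"
    unfolding deval_def using assms unfolding dsummable_def
    by (rule has_sum_infsum[OF Infinite_Sum.abs_summable_summable])
  moreover have "((\<lambda>n. dnth f n * of_nat n powr (- s)) has_sum deval s f) {0<..} \<longleftrightarrow>
      ((\<lambda>n. dnth f n * of_nat n powr (- s)) has_sum deval s f) UNIV"
    by (rule has_sum_cong_neutral) auto
  ultimately have "(\<lambda>N. \<Sum>n<N. dnth f n * of_nat n powr (- s)) \<longlonglongrightarrow> deval s f"
    using has_sum_imp_sums[of "\<lambda>n. dnth f n * of_nat n powr (- s)"] by (simp add: sums_def)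
  then have "(\<lambda>N. \<Sum>n<Suc N. dnth f n * of_nat n powr (- s)) \<longlonglongrightarrow> deval s f"
    by (rule LIMSEQ_Suc)
  moreover have "(\<Sum>n<Suc N. dnth f n * of_nat n powr (- s)) = (\<Sum>n=1..N. dnth f n * of_nat n powr (- s))" for N
    by (rule sum.mono_neutral_right) auto
  ultimately show ?thesis by (simp only:)
qed

text \<open>Only terms with \<open>n > P\<close> differ. Half of the exponent \<open>Re s\<close> is
  spent on smallness in \<open>P\<close>, and the other half keeps the sum convergent.\<close>

lemma norm_deval_diff_le:
  assumes f: "dsummable s f" and g: "dsummable s g" and P: "eq_upto P f g"
    and bf: "\<And>n. n > 0 \<Longrightarrow> norm (dnth f n) \<le> 1 / real n"
    and bg: "\<And>n. n > 0 \<Longrightarrow> norm (dnth g n) \<le> 1 / real n"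
    and s: "Re s > 0"
  shows "norm (deval s f - deval s g) \<le> (2 + 4 / Re s) * (real (Suc P)) powr (- Re s / 2)"
proof -
  define \<sigma> where "\<sigma> = Re s"
  have "norm ((\<Sum>n=1..N. dnth f n * of_nat n powr (- s)) - (\<Sum>n=1..N. dnth g n * of_nat n powr (- s)))
      \<le> (2 + 4 / \<sigma>) * (real (Suc P)) powr (- \<sigma> / 2)" for N
  proof -
    have "norm ((\<Sum>n=1..N. dnth f n * of_nat n powr (- s)) - (\<Sum>n=1..N. dnth g n * of_nat n powr (- s)))
       \<le> (\<Sum>n=1..N. 2 * real (Suc P) powr (- \<sigma> / 2) * real n powr (- 1 - \<sigma> / 2))"
      unfolding sum_subtractf[symmetric] left_diff_distrib[symmetric]
    proof (rule sum_norm_le)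
      fix n assume n: "n \<in> {1..N}"
      show "norm ((dnth f n - dnth g n) * of_nat n powr - s)
          \<le> 2 * real (Suc P) powr (- \<sigma> / 2) * real n powr (- 1 - \<sigma> / 2)"
      proof (cases "n \<le> P")
        case True
        then show ?thesis using P by (simp add: eq_upto_def)
      next
        case False
        have "norm ((dnth f n - dnth g n) * of_nat n powr - s) \<le> (2 / real n) * real n powr (- \<sigma>)"
        proof -
          have "norm (dnth f n - dnth g n) \<le> 2 / real n"
            using norm_triangle_ineq4[of "dnth f n" "dnth g n"] bf[of n] bg[of n] n by simp
          moreover have "norm (of_nat n powr - s :: complex) = real n powr (- \<sigma>)"
            using n by (simp add: norm_nat_powr \<sigma>_def)
          ultimately show ?thesis
            unfolding norm_mult by (simp only:) (rule mult_right_mono, auto)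
        qed
        also have "\<dots> = 2 * real n powr (- \<sigma> / 2) * real n powr (- 1 - \<sigma> / 2)"
        proof -
          have "real n powr (- \<sigma> / 2) * real n powr (- 1 - \<sigma> / 2) = real n powr (- \<sigma> - 1)"
            by (simp add: powr_add[symmetric])
          also have "\<dots> = real n powr (- \<sigma>) / real n" using n by (simp add: powr_diff)
          finally show ?thesis by simp
        qed
        also have "\<dots> \<le> 2 * real (Suc P) powr (- \<sigma> / 2) * real n powr (- 1 - \<sigma> / 2)"
          using False s by (intro mult_right_mono mult_left_mono powr_mono2') (auto simp: \<sigma>_def)
        finally show ?thesis .
      qed
    qed
    also have "\<dots> = 2 * real (Suc P) powr (- \<sigma> / 2) * (\<Sum>n=1..N. real n powr (- 1 - \<sigma> / 2))"
      by (simp add: sum_distrib_left)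
    also have "\<dots> \<le> 2 * real (Suc P) powr (- \<sigma> / 2) * (1 + 1 / (\<sigma> / 2))"
      using s by (intro mult_left_mono sum_powr_le) (auto simp: \<sigma>_def)
    also have "\<dots> = (2 + 4 / \<sigma>) * (real (Suc P)) powr (- \<sigma> / 2)"
      by (simp add: algebra_simps)
    finally show ?thesis .
  qed
  then show ?thesis unfolding \<sigma>_def[symmetric]
    using LIMSEQ_le_const2[OF tendsto_norm[OF tendsto_diff[OF deval_partial_sums[OF f] deval_partial_sums[OF g]]]] by blast
qed

lemma norm_mu_part:
  assumes "finite S" "\<And>p. p \<in> S \<Longrightarrow> prime p" "n > 0"
  shows "norm (dnth (mu_part S) n) \<le> 1 / real n"
proof -
  have "norm (dnth (mu_part S) n) \<le> norm (dnth dMu n)"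
    using dnth_prod_linear[OF assms(1,2), where a = "\<lambda>p. - 1 / of_nat p" and n = n]
    by (simp add: mu_part_def dnth_dMu)
  then show ?thesis using norm_dMu[OF assms(3)] by simp
qed

lemma mu_part_tendsto:
  assumes s: "Re s > 0"
  shows "(\<lambda>P. \<Prod>p\<in>primes_upto P. 1 - of_nat p powr (- 1 - s)) \<longlonglongrightarrow> deval s dMu"
proof -
  have ds: "dsummable s (mu_part (primes_upto P))" for P
    by (rule deval_mu_part[THEN conjunct1]) simp
  have bound: "norm (deval s (mu_part (primes_upto P)) - deval s dMu) \<le> (2 + 4 / Re s) * (real (Suc P)) powr (- Re s / 2)" for P
  proof (rule norm_deval_diff_le[OF ds dsummable_dZ_dMu(2)[OF s] _ norm_mu_part norm_dMu s])
    show "eq_upto P (mu_part (primes_upto P)) dMu"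
      using dMu_eq_upto[of P] by (auto simp: eq_upto_def)
  qed auto
  have "(\<lambda>P. real (Suc P) powr (- Re s / 2)) \<longlonglongrightarrow> 0"
    using s by real_asymp
  then have lim: "(\<lambda>P. (2 + 4 / Re s) * real (Suc P) powr (- Re s / 2)) \<longlonglongrightarrow> 0"
    by (rule tendsto_mult_right_zero)
  have "(\<lambda>P. deval s (mu_part (primes_upto P)) - deval s dMu) \<longlonglongrightarrow> 0"
    by (rule Lim_null_comparison[OF always_eventually[OF allI[OF bound]] lim])
  then have "(\<lambda>P. deval s (mu_part (primes_upto P))) \<longlonglongrightarrow> deval s dMu"
    by (rule LIM_zero_cancel)
  moreover have "deval s (mu_part (primes_upto P)) = (\<Prod>p\<in>primes_upto P. 1 - of_nat p powr (- 1 - s))" for P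
    by (rule deval_mu_part[THEN conjunct2]) simp
  ultimately show ?thesis by (simp only:)
qed

text \<open>Taking logarithms turns the product into a power series in \<open>r\<close> whose
  coefficients are \<open>- (3 + 4 cos x + cos 2x) / n\<close> with \<open>x\<close> a multiple of
  the argument of \<open>z\<close>, and
  \<open>3 + 4 cos x + cos 2x = 2 (1 + cos x)^2\<close>.\<close>

lemma norm_341_local:
  fixes z :: complex
  assumes r: "0 \<le> r" "r < 1" and z: "norm z = 1"
  shows "norm (1 - of_real r :: complex) ^ 3 * norm (1 - of_real r * z) ^ 4 * norm (1 - of_real r * z\<^sup>2) \<le> 1"
proof -
  \<comment> \<open>The series may start at \<open>n = 0\<close>, since division by 0 makes that
    term 0.\<close>
  have ln: "(\<lambda>n. - Re (w ^ n) / real n) sums ln (norm (1 - w))" if "norm w < 1" for w :: complex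
  proof -
    have "w \<noteq> 1" using that by auto
    have "(\<lambda>n. - (w ^ n) / of_nat n) sums ln (1 - w)"
      using Ln_series'[of "- w"] that by simp
    then have "(\<lambda>n. Re (- (w ^ n) / of_nat n)) sums Re (ln (1 - w))"
      by (rule sums_Re)
    then show ?thesis using \<open>w \<noteq> 1\<close> by (simp add: Re_divide_of_nat)
  qed
  let ?w1 = "of_real r :: complex" and ?w2 = "of_real r * z" and ?w3 = "of_real r * z\<^sup>2"
  have nw: "norm ?w1 < 1" "norm ?w2 < 1" "norm ?w3 < 1" using r z by (auto simp: norm_mult norm_power)
  have sm: "(\<lambda>n. 3 * (- Re (?w1 ^ n) / real n) + 4 * (- Re (?w2 ^ n) / real n) + - Re (?w3 ^ n) / real n)
     sums (3 * ln (norm (1 - ?w1)) + 4 * ln (norm (1 - ?w2)) + ln (norm (1 - ?w3)))"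
    by (intro sums_add sums_mult ln nw)
  have le: "3 * (- Re (?w1 ^ n) / real n) + 4 * (- Re (?w2 ^ n) / real n) + - Re (?w3 ^ n) / real n \<le> 0" for n
  proof -
    define u where "u = z ^ n"
    have u: "norm u = 1" using z by (simp add: u_def norm_power)
    have "(Re u)\<^sup>2 + (Im u)\<^sup>2 = 1" using u by (metis cmod_power2 power_one)
    then have "Re (u\<^sup>2) = 2 * (Re u)\<^sup>2 - 1" by (simp add: Re_power2)
    moreover have "0 \<le> 2 * (1 + Re u)\<^sup>2" by simp
    ultimately have *: "3 + 4 * Re u + Re (u\<^sup>2) \<ge> 0" by (simp add: power2_eq_square algebra_simps)
    have "(z\<^sup>2) ^ n = u\<^sup>2" unfolding u_def by (metis mult.commute power_mult)
    then have w: "?w1 ^ n = of_real (r ^ n)" "?w2 ^ n = of_real (r ^ n) * u" "?w3 ^ n = of_real (r ^ n) * u\<^sup>2"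
      by (simp_all add: u_def power_mult_distrib)
    have "Re (?w1 ^ n) = r ^ n" "Re (?w2 ^ n) = r ^ n * Re u" "Re (?w3 ^ n) = r ^ n * Re (u\<^sup>2)"
      unfolding w by (simp_all del: of_real_power)
    then have "3 * (- Re (?w1 ^ n) / real n) + 4 * (- Re (?w2 ^ n) / real n) + - Re (?w3 ^ n) / real n =
      - (r ^ n * (3 + 4 * Re u + Re (u\<^sup>2)) / real n)"
      by (simp only:) (simp add: divide_inverse algebra_simps)
    also have "\<dots> \<le> 0" using * r by simp
    finally show ?thesis .
  qed
  have le0: "3 * ln (norm (1 - ?w1)) + 4 * ln (norm (1 - ?w2)) + ln (norm (1 - ?w3)) \<le> 0"
    by (rule sums_le[OF le sm sums_zero])
  have pos: "norm (1 - ?w1) > 0" "norm (1 - ?w2) > 0" "norm (1 - ?w3) > 0"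
    using nw by auto
  have "ln (norm (1 - ?w1) ^ 3 * norm (1 - ?w2) ^ 4 * norm (1 - ?w3)) =
      3 * ln (norm (1 - ?w1)) + 4 * ln (norm (1 - ?w2)) + ln (norm (1 - ?w3))"
    unfolding ln_mult_pos[OF mult_pos_pos[OF zero_less_power[OF pos(1)] zero_less_power[OF pos(2)]] pos(3)]
      ln_mult_pos[OF zero_less_power[OF pos(1)] zero_less_power[OF pos(2)]]
      ln_realpow by simp
  with le0 have "ln (norm (1 - ?w1) ^ 3 * norm (1 - ?w2) ^ 4 * norm (1 - ?w3)) \<le> 0" by simp
  then show ?thesis
    using ln_le_zero_iff[OF mult_pos_pos[OF mult_pos_pos[OF zero_less_power[OF pos(1)] zero_less_power[OF pos(2)]] pos(3)]]
    by blast
qed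

text \<open>Written for \<open>1 / \<zeta>\<close>, whose truncated Euler products are finite
  products of the local factors: the local inequality multiplies up over the primes and passes to
  the limit.\<close>

lemma zeta_341:
  assumes "\<sigma> > 0"
  shows "norm (deval (of_real \<sigma>) dMu) ^ 3 * norm (deval (Complex \<sigma> t) dMu) ^ 4 *
         norm (deval (Complex \<sigma> (2 * t)) dMu) \<le> 1"
proof -
  let ?Q = "\<lambda>s P. \<Prod>p\<in>primes_upto P. 1 - of_nat p powr (- 1 - s) :: complex"
  have "norm (?Q (of_real \<sigma>) P) ^ 3 * norm (?Q (Complex \<sigma> t) P) ^ 4 * norm (?Q (Complex \<sigma> (2 * t)) P) \<le> 1" for P
  proof -
    have "norm (?Q (of_real \<sigma>) P) ^ 3 * norm (?Q (Complex \<sigma> t) P) ^ 4 * norm (?Q (Complex \<sigma> (2 * t)) P) =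
      (\<Prod>p\<in>primes_upto P. norm (1 - of_nat p powr (- 1 - of_real \<sigma>) :: complex) ^ 3 *
          norm (1 - of_nat p powr (- 1 - Complex \<sigma> t) :: complex) ^ 4 *
          norm (1 - of_nat p powr (- 1 - Complex \<sigma> (2 * t)) :: complex))"
      by (simp add: prod_norm[symmetric] prod.distrib prod_power_distrib)
    also have "\<dots> \<le> 1"
    proof (rule prod_le_1, safe)
      fix p :: nat assume p: "prime p"
      have p1: "real p > 1" using prime_gt_1_nat[OF p] by simp
      define r where "r = real p powr (- 1 - \<sigma>)"
      define z where "z = (of_nat p :: complex) powr (- \<i> * of_real t)"
      have r: "0 \<le> r" "r < 1" using p1 assms powr_less_one[of "real p" "- 1 - \<sigma>"] by (auto simp: r_def)
      have z: "norm z = 1" using p1 by (simp add: z_def norm_nat_powr)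
      have "complex_of_real r = of_nat p powr of_real (- 1 - \<sigma>)" using p1
        by (simp add: r_def powr_of_real[symmetric])
      then have 1: "of_nat p powr (- 1 - of_real \<sigma>) = complex_of_real r" by simp
      have 2: "of_nat p powr (- 1 - Complex \<sigma> t) = of_real r * z"
        unfolding 1[symmetric] z_def powr_add[symmetric] by (simp add: Complex_eq algebra_simps)
      have "z\<^sup>2 = of_nat p powr (- \<i> * of_real (2 * t))"
        unfolding z_def power2_eq_square powr_add[symmetric] by (simp add: algebra_simps)
      then have 3: "of_nat p powr (- 1 - Complex \<sigma> (2 * t)) = of_real r * z\<^sup>2"
        unfolding 1[symmetric] by (simp add: powr_add[symmetric] Complex_eq algebra_simps)
      show "norm (1 - of_nat p powr (- 1 - of_real \<sigma>) :: complex) ^ 3 *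
          norm (1 - of_nat p powr (- 1 - Complex \<sigma> t) :: complex) ^ 4 *
          norm (1 - of_nat p powr (- 1 - Complex \<sigma> (2 * t)) :: complex) \<le> 1"
        unfolding 1 2 3 by (rule norm_341_local[OF r z])
    qed auto
    finally show ?thesis .
  qed
  moreover have "(\<lambda>P. norm (?Q (of_real \<sigma>) P) ^ 3 * norm (?Q (Complex \<sigma> t) P) ^ 4 * norm (?Q (Complex \<sigma> (2 * t)) P))
    \<longlonglongrightarrow> norm (deval (of_real \<sigma>) dMu) ^ 3 * norm (deval (Complex \<sigma> t) dMu) ^ 4 *
         norm (deval (Complex \<sigma> (2 * t)) dMu)"
    using assms by (intro tendsto_intros mu_part_tendsto) auto
  ultimately show ?thesis by (intro LIMSEQ_le_const2) auto
qed

lemma norm_deval_le: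
  assumes "dbound (- Re s) f B"
  shows "norm (deval s f) \<le> B"
proof (rule LIMSEQ_le_const2[OF tendsto_norm[OF deval_partial_sums]])
  show "dsummable s f" by (rule dbound_imp_dsummable) fact
  have "norm (\<Sum>n=1..N. dnth f n * of_nat n powr - s) \<le> B" for N
  proof -
    have "norm (\<Sum>n=1..N. dnth f n * of_nat n powr - s) \<le> (\<Sum>n=1..N. norm (dnth f n) * real n powr (- Re s))"
      by (rule sum_norm_le) (auto simp: norm_mult norm_nat_powr)
    also have "\<dots> \<le> B" by (rule dboundD[OF assms])
    finally show ?thesis .
  qed
  then show "\<exists>N. \<forall>n\<ge>N. norm (\<Sum>n=1..n. dnth f n * of_nat n powr - s) \<le> B" by blast
qed

section \<open>Zeta near the line of absolute convergence\<close>

text \<open>The terms of \<open>s * \<zeta>(1 + s) - 1\<close>, regrouped so that the series converges to the left of \<open>Re s = 0\<close>.\<close>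

definition wterm :: "nat \<Rightarrow> complex \<Rightarrow> complex" where
  "wterm n s = s * of_nat n powr (- 1 - s) + of_nat (Suc n) powr (- s) - of_nat n powr (- s)"

definition W :: "complex \<Rightarrow> complex" where
  "W s = 1 + (\<Sum>n. wterm (Suc n) s)"

lemma closed_segment_nat_Suc:
  assumes "z \<in> closed_segment (of_nat n :: complex) (of_nat (Suc n))"
  obtains x where "z = of_real x" "real n \<le> x" "x \<le> real (Suc n)"
proof -
  have "closed_segment (of_real (real n) :: complex) (of_real (real (Suc n))) = of_real ` closed_segment (real n) (real (Suc n))"
    by (rule closed_segment_of_real)
  with assms obtain x where "z = of_real x" "x \<in> closed_segment (real n) (real (Suc n))"
    by auto
  then show ?thesis using that by (auto simp: closed_segment_eq_real_ivl)
qed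

text \<open>\<open>wterm n s\<close> is the increment over \<open>[n, n + 1]\<close> of a function
  with derivative \<open>s * (n powr (-1 - s) - z powr (-1 - s))\<close>. Bounding both powers
  separately gives the first estimate; a second mean value step gains \<open>1 / n\<close> at the
  price of a factor of size \<open>|s|\<close> and gives the other.\<close>

lemma norm_wterm_le:
  assumes n: "n > 0" and s: "Re s \<ge> - 1"
  shows "norm (wterm n s) \<le> 2 * norm s * real n powr (- 1 - Re s)"
    and "norm (wterm n s) \<le> norm s * (1 + norm s) * real n powr (- 2 - Re s)"
proof -
  let ?S = "closed_segment (of_nat n :: complex) (of_nat (Suc n))"
  have pos: "z \<notin> \<real>\<^sub>\<le>\<^sub>0 \<and> z \<in> \<real> \<and> real n \<le> Re z" if "z \<in> ?S" for z
    using closed_segment_nat_Suc[OF that] n by (metis Re_complex_of_real Reals_of_real complex_nonpos_Reals_iff not_le of_nat_0_less_iff order_less_le_trans)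
  have np: "norm (z powr w) \<le> real n powr Re w" if "z \<in> ?S" "Re w \<le> 0" for z w
    using pos[OF that(1)] that(2) n
    by (subst norm_powr_real_powr) (auto intro!: powr_mono2')
  define f where "f = (\<lambda>z. s * z * of_nat n powr (- 1 - s) + z powr (- s))"
  define f' where "f' = (\<lambda>z. s * of_nat n powr (- 1 - s) + (- s) * z powr (- s - 1))"
  have df: "(f has_field_derivative f' z) (at z within ?S)" if "z \<in> ?S" for z
    unfolding f_def f'_def using pos[OF that]
    by (auto intro!: derivative_eq_intros has_field_derivative_powr[THEN DERIV_subset] simp: has_field_derivative_at_within)
  have wf: "wterm n s = f (of_nat (Suc n)) - f (of_nat n)"
    by (simp add: wterm_def f_def algebra_simps)
  have main: "norm (wterm n s) \<le> B" if "\<And>z. z \<in> ?S \<Longrightarrow> norm (f' z) \<le> B" for B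
    using field_differentiable_bound[of ?S f f' B "of_nat (Suc n)" "of_nat n", OF _ df that]
    unfolding wf by simp
  have Suc: "- s - 1 = - 1 - s" by simp
  show "norm (wterm n s) \<le> 2 * norm s * real n powr (- 1 - Re s)"
  proof (rule main)
    fix z assume z: "z \<in> ?S"
    have "norm (f' z) \<le> norm s * norm (of_nat n powr (- 1 - s) :: complex) + norm s * norm (z powr (- 1 - s))"
      unfolding f'_def Suc by (rule order_trans[OF norm_triangle_ineq]) (simp add: norm_mult)
    also have "\<dots> \<le> norm s * real n powr (- 1 - Re s) + norm s * real n powr (- 1 - Re s)"
      using np[of _ "- 1 - s"] z s by (intro add_mono mult_left_mono) auto
    finally show "norm (f' z) \<le> 2 * norm s * real n powr (- 1 - Re s)" by simp
  qed
  show "norm (wterm n s) \<le> norm s * (1 + norm s) * real n powr (- 2 - Re s)"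
  proof (rule main)
    fix z assume z: "z \<in> ?S"
    have d: "((\<lambda>z. z powr (- 1 - s)) has_field_derivative (- 1 - s) * w powr (- 1 - s - 1)) (at w within ?S)" if "w \<in> ?S" for w
      using has_field_derivative_powr[of w "- 1 - s"] pos[OF that] has_field_derivative_at_within by blast
    have "norm ((of_nat n :: complex) powr (- 1 - s) - z powr (- 1 - s)) \<le>
       (1 + norm s) * real n powr (- 2 - Re s) * norm (of_nat n - z)"
    proof (rule field_differentiable_bound[OF _ d])
      fix w assume w: "w \<in> ?S"
      have "norm (- 1 - s) \<le> 1 + norm s" using norm_triangle_ineq4[of "- 1" s] by simp
      moreover have "norm (w powr (- 1 - s - 1)) \<le> real n powr (- 2 - Re s)"
        using np[OF w, of "- 1 - s - 1"] s by simp
      ultimately show "norm ((- 1 - s) * w powr (- 1 - s - 1)) \<le> (1 + norm s) * real n powr (- 2 - Re s)"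
        unfolding norm_mult by (intro mult_mono) auto
    qed (use z in auto)
    also have "norm (of_nat n - z) \<le> 1"
      using segment_bound1[of z "of_nat n" "of_nat (Suc n)"] z by (simp add: norm_minus_commute)
    then have "(1 + norm s) * real n powr (- 2 - Re s) * norm (of_nat n - z) \<le> (1 + norm s) * real n powr (- 2 - Re s)"
      by (intro mult_left_le) auto
    finally have "norm ((of_nat n :: complex) powr (- 1 - s) - z powr (- 1 - s)) \<le> (1 + norm s) * real n powr (- 2 - Re s)" .
    moreover have "f' z = s * (of_nat n powr (- 1 - s) - z powr (- 1 - s))"
      by (simp add: f'_def Suc algebra_simps)
    ultimately show "norm (f' z) \<le> norm s * (1 + norm s) * real n powr (- 2 - Re s)"
      by (simp add: norm_mult mult.assoc mult_left_mono)
  qed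
qed

text \<open>The two bounds are \<open>2 * A\<close> and \<open>A * r\<close>, and either way the
  minimum is at most \<open>2 * A * r powr \<delta>\<close>. This keeps the sum over
  \<open>n\<close> convergent slightly to the left of \<open>Re s = 0\<close> while the growth in
  \<open>|s|\<close> exceeds the first power only by \<open>\<delta>\<close>.\<close>

lemma norm_wterm_le_interpolated:
  assumes n: "n > 0" and \<delta>: "0 < \<delta>" "\<delta> \<le> 1" and s: "Re s \<ge> - \<delta> / 2"
  shows "norm (wterm n s) \<le> 2 * norm s * (1 + norm s) powr \<delta> * real n powr (- 1 - \<delta> / 2)"
proof -
  define r where "r = (1 + norm s) / real n"
  have r: "r > 0" using n by (simp add: r_def add_pos_nonneg)
  have s1: "Re s \<ge> - 1" using s \<delta> by linarith
  define A where "A = norm s * real n powr (- 1 - Re s)"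
  have A: "A \<ge> 0" by (simp add: A_def)
  have "real n powr (- 2 - Re s) = real n powr (- 1 - Re s) / real n"
    using n powr_diff[of "real n" "- 1 - Re s" 1] by simp
  then have 2: "norm (wterm n s) \<le> A * r"
    using norm_wterm_le(2)[OF n s1] by (simp add: A_def r_def mult_ac)
  have 1: "norm (wterm n s) \<le> 2 * A"
    using norm_wterm_le(1)[OF n s1] by (simp add: A_def mult_ac)
  have "norm (wterm n s) \<le> 2 * A * r powr \<delta>"
  proof (cases "r \<le> 1")
    case True
    have "r powr 1 \<le> r powr \<delta>" using True r \<delta> by (intro powr_mono') auto
    then have "A * r \<le> A * r powr \<delta>" using r A by (intro mult_left_mono) auto
    also have "\<dots> \<le> 2 * A * r powr \<delta>" using A by (intro mult_right_mono) auto
    finally show ?thesis using 2 by linarith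
  next
    case False
    then have "r powr \<delta> \<ge> 1" using \<delta> by (intro ge_one_powr_ge_zero) auto
    then have "2 * A * 1 \<le> 2 * A * r powr \<delta>" using A by (intro mult_left_mono) auto
    then show ?thesis using 1 by simp
  qed
  also have "r powr \<delta> = (1 + norm s) powr \<delta> * real n powr (- \<delta>)"
    by (simp add: r_def powr_divide powr_minus field_simps)
  also have "2 * A * ((1 + norm s) powr \<delta> * real n powr (- \<delta>)) =
      2 * norm s * (1 + norm s) powr \<delta> * real n powr (- 1 - Re s - \<delta>)"
    unfolding A_def by (simp add: powr_add[symmetric] mult_ac)
  also have "\<dots> \<le> 2 * norm s * (1 + norm s) powr \<delta> * real n powr (- 1 - \<delta> / 2)"
    using s n by (intro mult_left_mono powr_mono) auto
  finally show ?thesis .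
qed

lemma norm_W_le:
  assumes \<delta>: "0 < \<delta>" "\<delta> \<le> 1" and s: "Re s \<ge> - \<delta> / 2"
  shows "summable (\<lambda>n. wterm (Suc n) s)"
    and "norm (W s) \<le> (3 + 4 / \<delta>) * (1 + norm s) powr (1 + \<delta>)"
proof -
  define B where "B = 2 * norm s * (1 + norm s) powr \<delta>"
  have B: "B \<ge> 0" by (simp add: B_def)
  have bd: "norm (wterm (Suc n) s) \<le> B * real (Suc n) powr (- 1 - \<delta> / 2)" for n
    unfolding B_def by (rule norm_wterm_le_interpolated) (use assms in auto)
  have part: "(\<Sum>n<N. B * real (Suc n) powr (- 1 - \<delta> / 2)) \<le> B * (1 + 2 / \<delta>)" for N
  proof -
    have "(\<Sum>n<N. real (Suc n) powr (- 1 - \<delta> / 2)) = (\<Sum>n=1..N. real n powr (- 1 - \<delta> / 2))"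
      by (rule sum.reindex_bij_witness[of _ "\<lambda>n. n - 1" Suc]) auto
    also have "\<dots> \<le> 1 + 1 / (\<delta> / 2)" using \<delta> by (intro sum_powr_le) auto
    finally show ?thesis unfolding sum_distrib_left[symmetric]
      using B by (intro mult_left_mono) auto
  qed
  have sB: "summable (\<lambda>n. B * real (Suc n) powr (- 1 - \<delta> / 2))"
    by (rule summableI_nonneg_bounded[OF _ part]) (use B in auto)
  show sm: "summable (\<lambda>n. wterm (Suc n) s)"
    by (rule summable_comparison_test'[OF sB bd])
  have "norm (\<Sum>n. wterm (Suc n) s) \<le> (\<Sum>n. B * real (Suc n) powr (- 1 - \<delta> / 2))"
    by (rule norm_suminf_le[OF bd sB])
  also have "\<dots> \<le> B * (1 + 2 / \<delta>)"
    by (rule suminf_le_const[OF sB part])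
  finally have "norm (W s) \<le> 1 + B * (1 + 2 / \<delta>)"
    unfolding W_def using norm_triangle_ineq[of 1 "\<Sum>n. wterm (Suc n) s"] by simp
  also have "B \<le> 2 * (1 + norm s) powr (1 + \<delta>)"
    by (simp add: B_def powr_add add_pos_nonneg mult_right_mono)
  then have "1 + B * (1 + 2 / \<delta>) \<le> (1 + norm s) powr (1 + \<delta>) + 2 * (1 + norm s) powr (1 + \<delta>) * (1 + 2 / \<delta>)"
    using \<delta> by (intro add_mono mult_right_mono ge_one_powr_ge_zero) auto
  also have "\<dots> = (3 + 4 / \<delta>) * (1 + norm s) powr (1 + \<delta>)"
    by (simp add: algebra_simps)
  finally show "norm (W s) \<le> (3 + 4 / \<delta>) * (1 + norm s) powr (1 + \<delta>)" .
qed

lemma W_holomorphic: "W holomorphic_on {s. Re s > - 1 / 2}"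
proof -
  have "(\<lambda>s. \<Sum>n. wterm (Suc n) s) holomorphic_on {s. Re s > - 1 / 2}"
  proof (rule holomorphic_uniform_sequence[OF open_halfspace_Re_gt])
    fix N :: nat
    show "(\<lambda>s. \<Sum>n<N. wterm (Suc n) s) holomorphic_on {s. Re s > - 1 / 2}"
      unfolding wterm_def by (intro holomorphic_intros) 
  next
    fix s :: complex assume "s \<in> {s. Re s > - 1 / 2}"
    then obtain d where d: "d > 0" "cball s d \<subseteq> {s. Re s > - 1 / 2}"
      using open_halfspace_Re_gt[of "- 1 / 2"] open_contains_cball by blast
    define R where "R = norm s + d"
    have "uniform_limit (cball s d) (\<lambda>N s. \<Sum>n<N. wterm (Suc n) s) (\<lambda>s. \<Sum>n. wterm (Suc n) s) sequentially"
    proof (rule Weierstrass_m_test)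
      fix n z assume z: "z \<in> cball s d"
      have zR: "norm z \<le> R" using z norm_triangle_ineq2[of z s] by (auto simp: R_def dist_norm norm_minus_commute)
      have "Re z > - 1 / 2" using z d by auto
      then have "norm (wterm (Suc n) z) \<le> 2 * norm z * (1 + norm z) powr 1 * real (Suc n) powr (- 1 - 1 / 2)"
        by (intro norm_wterm_le_interpolated) auto
      also have "\<dots> \<le> 2 * R * (1 + R) powr 1 * real (Suc n) powr (- 1 - 1 / 2)"
        using zR d by (intro mult_right_mono mult_mono powr_mono2) (auto simp: R_def)
      finally show "norm (wterm (Suc n) z) \<le> 2 * R * (1 + R) powr 1 * real (Suc n) powr (- 1 - 1 / 2)" .
    next
      have "summable (\<lambda>n. real n powr (- 1 - 1 / 2))" by (subst summable_real_powr_iff) auto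
      then have "summable (\<lambda>n. real (Suc n) powr (- 1 - 1 / 2))" by (subst summable_Suc_iff)
      then show "summable (\<lambda>n. 2 * R * (1 + R) powr 1 * real (Suc n) powr (- 1 - 1 / 2))"
        by (rule summable_mult)
    qed
    with d show "\<exists>d. 0 < d \<and> cball s d \<subseteq> {s. Re s > - 1 / 2} \<and>
       uniform_limit (cball s d) (\<lambda>N s. \<Sum>n<N. wterm (Suc n) s) (\<lambda>s. \<Sum>n. wterm (Suc n) s) sequentially"
      by blast
  qed
  then show ?thesis unfolding W_def by (intro holomorphic_intros)
qed

lemma W_0: "W 0 = 1"
proof -
  have "wterm (Suc n) 0 = 0" for n by (simp add: wterm_def del: of_nat_Suc)
  then show ?thesis by (simp add: W_def)
qed

text \<open>The differences in \<open>wterm\<close> telescope to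
  \<open>(N + 1) powr (-s) - 1\<close>, which tends to \<open>-1\<close> and is balanced by the 1 in
  the definition of \<open>W\<close>.\<close>

lemma W_eq:
  assumes s: "Re s > 0"
  shows "W s = s * deval s dZ"
proof -
  have part: "(\<Sum>n<N. wterm (Suc n) s) = s * (\<Sum>n=1..N. dnth dZ n * of_nat n powr (- s)) + (of_nat (Suc N) powr (- s) - 1)" for N
  proof (induction N)
    case (Suc N)
    have "of_nat (Suc N) powr (- 1 - s) = dnth dZ (Suc N) * of_nat (Suc N) powr (- s)"
      using powr_diff[of "of_nat (Suc N) :: complex" "- s" 1] by (simp add: dnth_dZ minus_diff_commute)
    then show ?case unfolding sum.lessThan_Suc Suc
      by (simp add: wterm_def algebra_simps)
  qed simp
  have "(\<lambda>N. norm (of_nat (Suc N) powr (- s) :: complex)) \<longlonglongrightarrow> 0"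
  proof -
    have "(\<lambda>N. real (Suc N) powr (- Re s)) \<longlonglongrightarrow> 0" using s by real_asymp
    moreover have "norm (of_nat (Suc N) powr (- s) :: complex) = real (Suc N) powr (- Re s)" for N
      by (subst norm_nat_powr) auto
    ultimately show ?thesis by (simp only:)
  qed
  then have "(\<lambda>N. of_nat (Suc N) powr (- s) :: complex) \<longlonglongrightarrow> 0"
    by (rule tendsto_norm_zero_cancel)
  then have "(\<lambda>N. s * (\<Sum>n=1..N. dnth dZ n * of_nat n powr (- s)) + (of_nat (Suc N) powr (- s) - 1)) \<longlonglongrightarrow>
      s * deval s dZ + (0 - 1)"
    by (intro tendsto_intros deval_partial_sums dsummable_dZ_dMu s)
  moreover have "(\<lambda>N. \<Sum>n<N. wterm (Suc n) s) \<longlonglongrightarrow> (\<Sum>n. wterm (Suc n) s)"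
    using s by (intro summable_LIMSEQ norm_W_le(1)[of 1]) auto
  ultimately have "(\<Sum>n. wterm (Suc n) s) = s * deval s dZ + (0 - 1)"
    unfolding part by (rule LIMSEQ_unique[rotated])
  then show ?thesis by (simp add: W_def)
qed

lemma norm_W_deriv_le:
  assumes \<delta>: "0 < \<delta>" "\<delta> \<le> 1" and s: "- \<delta> / 4 \<le> Re s" "Re s \<le> 1"
  shows "norm (deriv W s) \<le> (3 + 4 / \<delta>) * 80 / \<delta> * (1 + \<bar>Im s\<bar>) powr (1 + \<delta>)"
proof -
  define T where "T = 1 + \<bar>Im s\<bar>"
  define B where "B = (3 + 4 / \<delta>) * (4 * T) powr (1 + \<delta>)"
  have nz: "norm (W z) \<le> B" if "z \<in> cball s (\<delta> / 4)" for z
  proof -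
    have d: "\<bar>Re (z - s)\<bar> \<le> \<delta> / 4" "\<bar>Im (z - s)\<bar> \<le> \<delta> / 4"
      using abs_Re_le_cmod[of "z - s"] abs_Im_le_cmod[of "z - s"] that
      by (auto simp: dist_norm norm_minus_commute)
    have "norm z \<le> \<bar>Re z\<bar> + \<bar>Im z\<bar>" by (rule cmod_le)
    also have "\<dots> \<le> 2 + (\<bar>Im s\<bar> + 1)" using d s \<delta> unfolding minus_complex.sel by arith
    finally have "1 + norm z \<le> 4 * T" by (simp add: T_def)
    then have "(1 + norm z) powr (1 + \<delta>) \<le> (4 * T) powr (1 + \<delta>)"
      using \<delta> by (intro powr_mono2) auto
    moreover have "norm (W z) \<le> (3 + 4 / \<delta>) * (1 + norm z) powr (1 + \<delta>)"
    proof (rule norm_W_le)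
      show "Re z \<ge> - \<delta> / 2" using d s \<delta> unfolding minus_complex.sel by arith
    qed (use \<delta> in auto)
    ultimately show ?thesis unfolding B_def using \<delta>
      by (smt (verit, best) divide_pos_pos mult_left_mono)
  qed
  have hol: "W holomorphic_on {s. Re s > - 1 / 2}" by (rule W_holomorphic)
  have sub: "cball s (\<delta> / 5) \<subseteq> {s. Re s > - 1 / 2}"
  proof
    fix z assume "z \<in> cball s (\<delta> / 5)"
    then have "\<bar>Re (z - s)\<bar> \<le> \<delta> / 5"
      using abs_Re_le_cmod[of "z - s"] by (auto simp: dist_norm norm_minus_commute)
    then have "Re z > - 1 / 2" using s \<delta> unfolding minus_complex.sel by arith
    then show "z \<in> {s. Re s > - 1 / 2}" by simp
  qed
  \<comment> \<open>Radius \<open>\<delta> / 5\<close> and not \<open>\<delta> / 4\<close>: for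
    \<open>\<delta> = 1\<close> the larger disc could touch \<open>Re z = -1/2\<close>, the edge of
    the domain of holomorphy. The 80 in the result is \<open>5 * 16\<close>, where
    \<open>16 = 4^2\<close> bounds \<open>4 powr (1 + \<delta>)\<close>.\<close>
  have "norm ((deriv ^^ 1) W s) \<le> fact 1 * B / (\<delta> / 5) ^ 1"
  proof (rule Cauchy_inequality)
    show "W holomorphic_on ball s (\<delta> / 5)"
      using hol sub by (meson ball_subset_cball holomorphic_on_subset order_trans)
    show "continuous_on (cball s (\<delta> / 5)) W"
      using holomorphic_on_imp_continuous_on[OF hol] sub continuous_on_subset by blast
    show "norm (W z) \<le> B" if "norm (s - z) = \<delta> / 5" for z
      using that \<delta> by (intro nz) (auto simp: dist_norm)
  qed (use \<delta> in auto)
  then have "norm (deriv W s) \<le> 5 * B / \<delta>" by (simp add: mult.commute)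
  also have "B \<le> (3 + 4 / \<delta>) * (16 * T powr (1 + \<delta>))"
  proof -
    have "4 powr (1 + \<delta>) \<le> 4 powr (2::real)" using \<delta> by (intro powr_mono) auto
    then have "(4 * T) powr (1 + \<delta>) \<le> 16 * T powr (1 + \<delta>)"
      using powr_mult[of 4 T "1 + \<delta>"] by (simp add: mult_right_mono)
    then show ?thesis unfolding B_def using \<delta> by (intro mult_left_mono) (auto simp: add_nonneg_nonneg)
  qed
  then have "5 * B / \<delta> \<le> 5 * ((3 + 4 / \<delta>) * (16 * T powr (1 + \<delta>))) / \<delta>"
    using \<delta> by (intro divide_right_mono mult_left_mono) auto
  also have "\<dots> = (3 + 4 / \<delta>) * 80 / \<delta> * T powr (1 + \<delta>)" by simp
  finally show ?thesis by (simp add: T_def)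
qed

text \<open>Powers of \<open>1 + \<bar>Im s\<bar>\<close> with arbitrarily small exponents replace the usual logarithms: the 3-4-1
  inequality is used at \<open>Re s = \<kappa> (1 + \<bar>Im s\<bar>)\<^sup>-\<^sup>5\<^sup>\<delta>\<close> and the bound on the derivative carries it across the line.\<close>

lemma W_lower_bound:
  assumes \<delta>: "0 < \<delta>" "\<delta> \<le> 1 / 2" and \<tau>: "0 < \<tau>" "\<tau> \<le> 1"
  obtains c \<kappa> where "c > 0" "\<kappa> > 0" "\<kappa> \<le> \<delta> / 4"
    "\<And>s. \<tau> \<le> \<bar>Im s\<bar> \<Longrightarrow> - \<kappa> * (1 + \<bar>Im s\<bar>) powr (- 5 * \<delta>) \<le> Re s \<Longrightarrow> Re s \<le> 1 \<Longrightarrow>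
       c * (1 + \<bar>Im s\<bar>) powr (1 - 4 * \<delta>) \<le> norm (W s)"
proof -
  define C1 where "C1 = 3 + 4 / \<delta>"
  define C3 where "C3 = C1 * 80 / \<delta>"
  \<comment> \<open>\<open>2048 = 2 * 4 * 256\<close>: the halves in \<open>\<sigma> / 2\<close> and
    \<open>\<tau> / 2\<close> multiply to \<open>1 / 256\<close>, the 4 bounds
    \<open>2 powr (1 + \<delta>)\<close>, and the 2 is slack.\<close>
  define c1 where "c1 = \<tau> ^ 5 / (2048 * C1)"
  define c2 where "c2 = c1 powr (1 / 4)"
  \<comment> \<open>The lower bound on the right is proportional to
    \<open>\<kappa> powr (3/4)\<close>, the change of \<open>W\<close> across the line to
    \<open>\<kappa>\<close>. Their ratio is \<open>\<kappa> powr (1/4)\<close>, so the fourth power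
    makes the change at most half of the bound. The cap \<open>\<delta> / 4\<close> stays in the
    range of \<open>norm_W_deriv_le\<close>.\<close>
  define \<kappa> where "\<kappa> = min (\<delta> / 4) ((c2 / (4 * C3)) ^ 4)"
  define c where "c = c2 * \<kappa> powr (3 / 4) / 2"
  have C1: "C1 > 0" using \<delta> by (simp add: C1_def add_pos_pos)
  have C3: "C3 > 0" using C1 \<delta> by (simp add: C3_def)
  have c1: "c1 > 0" using C1 \<tau> by (simp add: c1_def)
  have c2: "c2 > 0" using c1 by (simp add: c2_def)
  have \<kappa>: "\<kappa> > 0" "\<kappa> \<le> \<delta> / 4" using \<delta> c2 C3 by (auto simp: \<kappa>_def)
  have c: "c > 0" using c2 \<kappa> by (simp add: c_def)
  have \<kappa>c: "2 * \<kappa> * C3 \<le> c2 * \<kappa> powr (3 / 4) / 2"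
  proof -
    have "\<kappa> powr (1 / 4) \<le> ((c2 / (4 * C3)) ^ 4) powr (1 / 4)"
      using \<kappa> by (intro powr_mono2) (auto simp: \<kappa>_def)
    also have "\<dots> = c2 / (4 * C3)"
      using c2 C3 powr_powr[of "c2 / (4 * C3)" 4 "1 / 4"] by simp
    finally have "2 * C3 * \<kappa> powr (1 / 4) \<le> c2 / 2" using C3 by (simp add: field_simps)
    then have "2 * C3 * \<kappa> powr (1 / 4) * \<kappa> powr (3 / 4) \<le> c2 / 2 * \<kappa> powr (3 / 4)"
      by (intro mult_right_mono) auto
    moreover have "\<kappa> powr (1 / 4) * \<kappa> powr (3 / 4) = \<kappa>"
      using \<kappa> by (simp add: powr_add[symmetric])
    ultimately show ?thesis by (simp add: mult_ac)
  qed
  \<comment> \<open>To the right of the line,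
    \<open>\<zeta>(1 + \<sigma>) \<le> 2 / \<sigma>\<close> and the upper bound for \<open>W\<close>
    at height \<open>2 * t\<close> leave \<open>|W|^4\<close> at least a constant times
    \<open>\<sigma>^3 * T powr (4 - \<delta>)\<close>.\<close>
  have main: "c2 * (1 + \<bar>t\<bar>) powr (1 - \<delta> / 4) * \<sigma> powr (3 / 4) \<le> norm (W (Complex \<sigma> t))"
    if t: "\<tau> \<le> \<bar>t\<bar>" and \<sigma>: "0 < \<sigma>" "\<sigma> \<le> 1" for \<sigma> t
  proof -
    define T where "T = 1 + \<bar>t\<bar>"
    define s where "s = Complex \<sigma> t"
    define s2 where "s2 = Complex \<sigma> (2 * t)"
    have T: "T \<ge> 1" "T > 0" by (auto simp: T_def)
    have tT: "\<tau> / 2 * T \<le> \<bar>t\<bar>"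
    proof -
      have "\<tau> / 2 * T = \<tau> / 2 + \<tau> / 2 * \<bar>t\<bar>" by (simp add: T_def algebra_simps)
      also have "\<tau> / 2 * \<bar>t\<bar> \<le> 1 / 2 * \<bar>t\<bar>" using \<tau> by (intro mult_right_mono) auto
      finally show ?thesis using t by simp
    qed
    have ns: "\<bar>t\<bar> \<le> norm s" "\<bar>2 * t\<bar> \<le> norm s2"
      using abs_Im_le_cmod[of s] abs_Im_le_cmod[of s2] by (auto simp: s_def s2_def)
    have ns2: "1 + norm s2 \<le> 2 * T"
    proof -
      have "norm s2 \<le> \<sigma> + \<bar>2 * t\<bar>" using cmod_le[of s2] \<sigma> by (simp add: s2_def)
      then show ?thesis using \<sigma> by (simp add: T_def)
    qed
    have W2: "norm (W s2) \<le> C1 * (2 * T) powr (1 + \<delta>)"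
    proof -
      have "norm (W s2) \<le> C1 * (1 + norm s2) powr (1 + \<delta>)"
        unfolding C1_def using \<delta> \<sigma> by (intro norm_W_le) (auto simp: s2_def)
      also have "\<dots> \<le> C1 * (2 * T) powr (1 + \<delta>)"
        using ns2 C1 \<delta> by (intro mult_left_mono powr_mono2) auto
      finally show ?thesis .
    qed
    define Z where "Z = (\<lambda>s. norm (deval s dMu))"
    have WZ: "norm (W w) * Z w = norm w" if "Re w > 0" for w
      using W_eq[OF that] deval_dZ_dMu[OF that] by (simp add: Z_def norm_mult[symmetric] mult.assoc)
    have Z0: "Z (of_real \<sigma>) \<ge> \<sigma> / 2"
    proof -
      have "norm (deval (of_real \<sigma>) dZ) \<le> 1 + 1 / \<sigma>"
        using dbound_zeta[OF \<sigma>(1), of dZ] by (intro norm_deval_le) (simp add: norm_dZ)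
      also have "\<dots> \<le> 2 / \<sigma>" using \<sigma> by (simp add: field_simps)
      finally have "norm (deval (of_real \<sigma>) dZ) \<le> 2 / \<sigma>" .
      moreover have "norm (deval (of_real \<sigma>) dZ) * Z (of_real \<sigma>) = 1"
        using deval_dZ_dMu[of "of_real \<sigma>"] \<sigma> by (simp add: Z_def norm_mult[symmetric])
      moreover have "Z (of_real \<sigma>) \<ge> 0" by (simp add: Z_def)
      ultimately have "1 \<le> 2 / \<sigma> * Z (of_real \<sigma>)"
        by (metis mult_right_mono)
      then show ?thesis using \<sigma> by (simp add: field_simps)
    qed
    have 341: "Z (of_real \<sigma>) ^ 3 * Z s ^ 4 * Z s2 \<le> 1"
      using zeta_341[OF \<sigma>(1), of t] by (simp add: Z_def s_def s2_def)
    have Res: "Re s > 0" "Re s2 > 0" using \<sigma> by (auto simp: s_def s2_def)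
    have "(\<sigma> / 2) ^ 3 * Z s ^ 4 * Z s2 \<le> 1"
    proof -
      have "(\<sigma> / 2) ^ 3 * Z s ^ 4 * Z s2 \<le> Z (of_real \<sigma>) ^ 3 * Z s ^ 4 * Z s2"
        using Z0 \<sigma> by (intro mult_right_mono power_mono) (auto simp: Z_def)
      then show ?thesis using 341 by linarith
    qed
    \<comment> \<open>By \<open>WZ\<close>, multiplying with the matching powers of \<open>W\<close>
      replaces the values of \<open>1 / \<zeta>\<close> by powers of \<open>|s|\<close>.\<close>
    then have "(\<sigma> / 2) ^ 3 * Z s ^ 4 * Z s2 * (norm (W s) ^ 4 * norm (W s2)) \<le> 1 * (norm (W s) ^ 4 * norm (W s2))"
      by (intro mult_right_mono) auto
    moreover have "(\<sigma> / 2) ^ 3 * Z s ^ 4 * Z s2 * (norm (W s) ^ 4 * norm (W s2)) =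
        (\<sigma> / 2) ^ 3 * (norm (W s) * Z s) ^ 4 * (norm (W s2) * Z s2)"
      by (simp add: power_mult_distrib mult_ac)
    ultimately have "(\<sigma> / 2) ^ 3 * norm s ^ 4 * norm s2 \<le> norm (W s) ^ 4 * norm (W s2)"
      using WZ[OF Res(1)] WZ[OF Res(2)] by simp
    also have "\<dots> \<le> norm (W s) ^ 4 * (C1 * (2 * T) powr (1 + \<delta>))"
      using W2 by (intro mult_left_mono) auto
    also have "(2 * T) powr (1 + \<delta>) \<le> 4 * T powr (1 + \<delta>)"
    proof -
      have "2 powr (1 + \<delta>) \<le> 2 powr (2::real)" using \<delta> by (intro powr_mono) auto
      then show ?thesis using T by (simp add: powr_mult)
    qed
    then have "norm (W s) ^ 4 * (C1 * (2 * T) powr (1 + \<delta>)) \<le> norm (W s) ^ 4 * (C1 * (4 * T powr (1 + \<delta>)))"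
      using C1 by (intro mult_left_mono) auto
    finally have A: "(\<sigma> / 2) ^ 3 * norm s ^ 4 * norm s2 \<le> norm (W s) ^ 4 * (C1 * (4 * T powr (1 + \<delta>)))" .
    have "(\<sigma> / 2) ^ 3 * (\<tau> / 2 * T) ^ 4 * (\<tau> / 2 * T) \<le> (\<sigma> / 2) ^ 3 * norm s ^ 4 * norm s2"
      using tT ns \<tau> \<sigma> T by (intro mult_mono power_mono) auto
    with A have "(\<sigma> / 2) ^ 3 * (\<tau> / 2 * T) ^ 4 * (\<tau> / 2 * T) \<le> norm (W s) ^ 4 * (C1 * (4 * T powr (1 + \<delta>)))"
      by linarith
    moreover have "(\<sigma> / 2) ^ 3 * (\<tau> / 2 * T) ^ 4 * (\<tau> / 2 * T) = \<tau> ^ 5 / 256 * \<sigma> ^ 3 * T ^ 5"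
      by (simp add: power_mult_distrib power_divide power_Suc[symmetric] eval_nat_numeral)
    ultimately have X: "\<tau> ^ 5 / 256 * \<sigma> ^ 3 * T ^ 5 \<le> norm (W s) ^ 4 * (C1 * (4 * T powr (1 + \<delta>)))"
      by linarith
    have pos: "C1 * (4 * T powr (1 + \<delta>)) > 0" using C1 T by simp
    have "\<tau> ^ 5 / 256 * \<sigma> ^ 3 * T ^ 5 / (C1 * (4 * T powr (1 + \<delta>))) \<le> norm (W s) ^ 4"
      unfolding pos_divide_le_eq[OF pos] by (rule X)
    moreover have "c1 * \<sigma> ^ 3 * T powr (4 - \<delta>) \<le> \<tau> ^ 5 / 256 * \<sigma> ^ 3 * T ^ 5 / (C1 * (4 * T powr (1 + \<delta>)))"
    proof -
      have "T powr (4 - \<delta>) = T powr 5 / T powr (1 + \<delta>)" using powr_diff[of T 5 "1 + \<delta>"] by simp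
      also have "T powr 5 = T ^ 5" using T by simp
      finally have eq: "T powr (4 - \<delta>) = T ^ 5 / T powr (1 + \<delta>)" .
      have "\<tau> ^ 5 / 256 * \<sigma> ^ 3 * T ^ 5 / (C1 * (4 * T powr (1 + \<delta>))) = 2 * (c1 * \<sigma> ^ 3 * T powr (4 - \<delta>))"
        unfolding c1_def eq by simp
      moreover have "c1 * \<sigma> ^ 3 * T powr (4 - \<delta>) \<ge> 0" using c1 \<sigma> by simp
      ultimately show ?thesis by linarith
    qed
    ultimately have "c1 * \<sigma> ^ 3 * T powr (4 - \<delta>) \<le> norm (W s) ^ 4" by linarith
    then have "(c1 * \<sigma> ^ 3 * T powr (4 - \<delta>)) powr (1 / 4) \<le> (norm (W s) ^ 4) powr (1 / 4)"
      using c1 \<sigma> by (intro powr_mono2) auto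
    moreover have "(norm (W s) ^ 4) powr (1 / 4) = norm (W s)"
      using powr_powr[of "norm (W s)" 4 "1 / 4"] by simp
    moreover have "(c1 * \<sigma> ^ 3 * T powr (4 - \<delta>)) powr (1 / 4) = c2 * T powr (1 - \<delta> / 4) * \<sigma> powr (3 / 4)"
    proof -
      have "(\<sigma> ^ 3) powr (1 / 4) = \<sigma> powr (3 / 4)"
        using powr_powr[of \<sigma> 3 "1 / 4"] \<sigma> by simp
      moreover have "(T powr (4 - \<delta>)) powr (1 / 4) = T powr (1 - \<delta> / 4)"
        by (simp add: powr_powr diff_divide_distrib)
      ultimately show ?thesis by (simp add: powr_mult c2_def)
    qed
    ultimately show ?thesis by (simp add: T_def s_def)
  qed
  show ?thesis
  proof (rule that[OF c \<kappa>])
    fix s assume t: "\<tau> \<le> \<bar>Im s\<bar>" and s: "- \<kappa> * (1 + \<bar>Im s\<bar>) powr (- 5 * \<delta>) \<le> Re s" "Re s \<le> 1"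
    define T where "T = 1 + \<bar>Im s\<bar>"
    \<comment> \<open>The exponent \<open>5 * \<delta>\<close> balances two losses:
      \<open>(1 - \<delta>/4) - 15/4 * \<delta>\<close> from the lower bound at
      \<open>\<sigma>1\<close>, and \<open>(1 + \<delta>) - 5 * \<delta>\<close> from the derivative
      times the distance, both equal \<open>1 - 4 * \<delta>\<close>.\<close>
    define \<sigma>1 where "\<sigma>1 = \<kappa> * T powr (- 5 * \<delta>)"
    have T: "T \<ge> 1" by (simp add: T_def)
    have "T powr (- 5 * \<delta>) \<le> 1"
      using T \<delta> powr_mono[of "- 5 * \<delta>" 0 T] by simp
    then have \<sigma>1: "0 < \<sigma>1" "\<sigma>1 \<le> \<kappa>" using \<kappa> T by (auto simp: \<sigma>1_def)
    have \<sigma>1': "\<sigma>1 \<le> \<delta> / 4" "\<sigma>1 \<le> 1" using \<sigma>1 \<kappa> \<delta> by auto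
    have s1: "- \<sigma>1 \<le> Re s" using s by (simp add: \<sigma>1_def T_def)
    have low: "2 * c * T powr (1 - 4 * \<delta>) \<le> norm (W (Complex \<sigma> (Im s)))" if "\<sigma>1 \<le> \<sigma>" "\<sigma> \<le> 1" for \<sigma>
    proof -
      have "2 * c * T powr (1 - 4 * \<delta>) = c2 * T powr (1 - \<delta> / 4) * \<sigma>1 powr (3 / 4)"
      proof -
        have "\<sigma>1 powr (3 / 4) = \<kappa> powr (3 / 4) * T powr (- 15 / 4 * \<delta>)"
          using \<kappa> T by (simp add: \<sigma>1_def powr_mult powr_powr)
        then have "c2 * T powr (1 - \<delta> / 4) * \<sigma>1 powr (3 / 4) =
            c2 * \<kappa> powr (3 / 4) * (T powr (1 - \<delta> / 4) * T powr (- 15 / 4 * \<delta>))" by simp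
        also have "T powr (1 - \<delta> / 4) * T powr (- 15 / 4 * \<delta>) = T powr (1 - 4 * \<delta>)"
          unfolding powr_add[symmetric] by simp
        finally show ?thesis by (auto simp add: c_def)
      qed
      also have "\<dots> \<le> c2 * T powr (1 - \<delta> / 4) * \<sigma> powr (3 / 4)"
        using c2 \<sigma>1 that by (intro mult_left_mono powr_mono2) auto
      also have "\<dots> \<le> norm (W (Complex \<sigma> (Im s)))"
        unfolding T_def using \<sigma>1 that t by (intro main) auto
      finally show ?thesis .
    qed
    have "c * T powr (1 - 4 * \<delta>) \<le> norm (W s)"
    proof (cases "\<sigma>1 \<le> Re s")
      case True
      have "c * T powr (1 - 4 * \<delta>) \<le> 2 * c * T powr (1 - 4 * \<delta>)" using c by simp
      also have "\<dots> \<le> norm (W s)" using low[OF True s(2)] by simp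
      finally show ?thesis .
    next
      case False
      let ?s1 = "Complex \<sigma>1 (Im s)"
      let ?S = "closed_segment s ?s1"
      have seg: "Im z = Im s \<and> Re z \<in> {- \<sigma>1..\<sigma>1}" if "z \<in> ?S" for z
      proof -
        have "Im s = Im ?s1" by simp
        then have "Im z = Im s" "Re z \<in> closed_segment (Re s) \<sigma>1"
          using that by (auto simp: closed_segment_same_Im)
        then show ?thesis using False s1 by (auto simp: closed_segment_eq_real_ivl)
      qed
      have dW: "(W has_field_derivative deriv W z) (at z within ?S)" if "z \<in> ?S" for z
      proof -
        have "z \<in> {s. Re s > - 1 / 2}" using seg[OF that] \<sigma>1' \<delta> by auto
        then have "(W has_field_derivative deriv W z) (at z)"
          using holomorphic_derivI[OF W_holomorphic open_halfspace_Re_gt] by blast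
        then show ?thesis by (rule has_field_derivative_at_within)
      qed
      have "norm (W ?s1 - W s) \<le> C3 * T powr (1 + \<delta>) * norm (?s1 - s)"
      proof (rule field_differentiable_bound[of ?S W "deriv W"])
        fix z assume z: "z \<in> ?S"
        have "norm (deriv W z) \<le> (3 + 4 / \<delta>) * 80 / \<delta> * (1 + \<bar>Im z\<bar>) powr (1 + \<delta>)"
          using seg[OF z] \<sigma>1' \<delta> by (intro norm_W_deriv_le) auto
        then show "norm (deriv W z) \<le> C3 * T powr (1 + \<delta>)"
          using seg[OF z] by (simp add: C3_def C1_def T_def)
      qed (use dW in auto)
      also have "norm (?s1 - s) \<le> 2 * \<sigma>1"
      proof -
        have "?s1 - s = of_real (\<sigma>1 - Re s)" by (simp add: complex_eq_iff)
        then have "norm (?s1 - s) = \<bar>\<sigma>1 - Re s\<bar>" by (metis norm_of_real)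
        then show ?thesis using s1 False by simp
      qed
      then have "C3 * T powr (1 + \<delta>) * norm (?s1 - s) \<le> C3 * T powr (1 + \<delta>) * (2 * \<sigma>1)"
        using C3 by (intro mult_left_mono) auto
      also have "\<dots> = 2 * \<kappa> * C3 * (T powr (1 + \<delta>) * T powr (- 5 * \<delta>))"
        by (simp add: \<sigma>1_def)
      also have "T powr (1 + \<delta>) * T powr (- 5 * \<delta>) = T powr (1 - 4 * \<delta>)"
        unfolding powr_add[symmetric] by simp
      also have "2 * \<kappa> * C3 * T powr (1 - 4 * \<delta>) \<le> c * T powr (1 - 4 * \<delta>)"
        using \<kappa>c by (intro mult_right_mono) (auto simp: c_def)
      finally have "norm (W ?s1 - W s) \<le> c * T powr (1 - 4 * \<delta>)" .
      moreover have "2 * c * T powr (1 - 4 * \<delta>) \<le> norm (W ?s1)"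
        using low[of \<sigma>1] \<sigma>1' by simp
      moreover have "norm (W ?s1) \<le> norm (W ?s1 - W s) + norm (W s)"
        using norm_triangle_ineq[of "W ?s1 - W s" "W s"] by simp
      ultimately show ?thesis by (simp add: algebra_simps)
    qed
    then show "c * (1 + \<bar>Im s\<bar>) powr (1 - 4 * \<delta>) \<le> norm (W s)" by (simp add: T_def)
  qed
qed

section \<open>Fourier and Laplace transforms\<close>

text \<open>The Fourier transform is only needed through a majorant: averaging \<open>f\<close> against a narrow Gaussian,
  which is its own transform, bounds \<open>f\<close> pointwise by the integral of any majorant of the transform.\<close>

lemma Fourier_pointwise_bound:
  fixes f :: "real \<Rightarrow> complex" and G :: "real \<Rightarrow> real"
  assumes cont: "continuous_on UNIV f" and M: "\<And>x. norm (f x) \<le> M"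
    and f: "integrable lborel f" and G: "integrable lborel G"
    and bound: "\<And>t. norm (LBINT v. f v * exp (- \<i> * of_real (t * v))) \<le> G t"
  shows "norm (f u) \<le> (LBINT t. G t) / (2 * pi)"
proof -
  let ?\<phi> = std_normal_density
  have fm [measurable]: "f \<in> borel_measurable borel"
    using cont by (rule borel_measurable_continuous_onI)
  have G0: "G t \<ge> 0" for t using bound[of t] norm_ge_zero order_trans by blast
  \<comment> \<open>The Gaussian is its own Fourier transform up to normalization.\<close>
  have gauss: "of_real (?\<phi> y) = of_real (1 / sqrt (2 * pi)) * (LBINT t. of_real (?\<phi> t) * iexp (y * t))" for y
  proof -
    have "(LBINT t. of_real (?\<phi> t) * iexp (y * t)) = char std_normal_distribution y"
      unfolding char_def by (subst integral_density) (auto simp: scaleR_conv_of_real)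
    also have "\<dots> = of_real (exp (- (y ^ 2) / 2))"
      by (simp add: char_std_normal_distribution)
    finally show ?thesis by (simp add: std_normal_density_def)
  qed
  have avg: "norm (LBINT y. of_real (?\<phi> y) * f (u + e * y)) \<le> (LBINT t. G t) / (2 * pi)" if e: "e > 0" for e
  proof -
    define h where "h = (\<lambda>y t. of_real (?\<phi> t) * (f (u + e * y) * iexp (y * t)))"
    have hm [measurable]: "case_prod h \<in> borel_measurable (lborel \<Otimes>\<^sub>M lborel)"
      unfolding h_def by measurable
    have intf: "integrable lborel (\<lambda>y. f (u + e * y))"
      using f e by (intro lborel_integrable_real_affine) auto
    have nh: "norm (h y t) = ?\<phi> t * norm (f (u + e * y))" for y t
      by (simp add: h_def norm_mult)
    have int_h: "integrable (lborel \<Otimes>\<^sub>M lborel) (case_prod h)"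
    proof (rule lborel_pair.Fubini_integrable)
      show "integrable lborel (\<lambda>y. LBINT t. norm (case_prod h (y, t)))"
        unfolding prod.case nh using intf by (auto intro!: integrable_mult_right)
      show "AE y in lborel. integrable lborel (\<lambda>t. case_prod h (y, t))"
      proof (intro AE_I2)
        fix y
        have "integrable lborel (\<lambda>t. ?\<phi> t * norm (f (u + e * y)))" by simp
        then show "integrable lborel (\<lambda>t. case_prod h (y, t))"
          by (rule Bochner_Integration.integrable_bound) (auto simp: nh[symmetric] h_def)
      qed
    qed measurable
    \<comment> \<open>Integrating over \<open>y\<close> first gives the transform of
      \<open>f\<close> at \<open>- t / e\<close>, up to a phase of modulus 1 and the factor
      \<open>1 / e\<close> from the substitution.\<close>
    have inner: "norm (LBINT y. h y t) \<le> ?\<phi> t * (G (- t / e) / e)" for t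
    proof -
      have "(LBINT v. f v * exp (- \<i> * of_real ((- t / e) * v))) =
        of_real e * (LBINT y. f (u + e * y) * exp (- \<i> * of_real ((- t / e) * (u + e * y))))"
        using e by (subst lborel_integral_real_affine[where c = e and t = u]) (auto simp: scaleR_conv_of_real)
      also have "(\<lambda>y. f (u + e * y) * exp (- \<i> * of_real ((- t / e) * (u + e * y)))) =
          (\<lambda>y. exp (\<i> * of_real (t * u / e)) * (f (u + e * y) * iexp (y * t)))"
      proof
        fix y
        have "- \<i> * of_real ((- t / e) * (u + e * y)) = \<i> * of_real (t * u / e) + \<i> * of_real (y * t)"
          using e by (simp add: field_simps)
        then show "f (u + e * y) * exp (- \<i> * of_real ((- t / e) * (u + e * y))) =
          exp (\<i> * of_real (t * u / e)) * (f (u + e * y) * iexp (y * t))"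
          by (simp only: exp_add) (simp only: mult_ac)
      qed
      finally have "norm (LBINT v. f v * exp (- \<i> * of_real ((- t / e) * v))) =
          e * norm (LBINT y. f (u + e * y) * iexp (y * t))"
        using e by (simp add: norm_mult del: of_real_mult of_real_divide)
      then have "norm (LBINT y. f (u + e * y) * iexp (y * t)) \<le> G (- t / e) / e"
        using bound[of "- t / e"] e by (simp add: field_simps)
      moreover have "(LBINT y. h y t) = of_real (?\<phi> t) * (LBINT y. f (u + e * y) * iexp (y * t))"
        unfolding h_def by simp
      ultimately have "norm (LBINT y. h y t) = ?\<phi> t * norm (LBINT y. f (u + e * y) * iexp (y * t))"
        by (simp only: norm_mult norm_of_real) simp
      also have "\<dots> \<le> ?\<phi> t * (G (- t / e) / e)"
        by (rule mult_left_mono) (fact, simp)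
      finally show ?thesis .
    qed
    have "(LBINT y. of_real (?\<phi> y) * f (u + e * y)) = of_real (1 / sqrt (2 * pi)) * (LBINT y. LBINT t. h y t)"
    proof -
      have "(LBINT t. h y t) = (LBINT t. of_real (?\<phi> t) * iexp (y * t)) * f (u + e * y)" for y
        unfolding h_def by (subst integral_mult_left_zero[symmetric]) (simp add: mult_ac)
      then have "of_real (?\<phi> y) * f (u + e * y) = of_real (1 / sqrt (2 * pi)) * (LBINT t. h y t)" for y
        using gauss[of y] by (simp only: mult_ac)
      then show ?thesis by (simp only: integral_mult_right_zero)
    qed
    also have "(LBINT y. LBINT t. h y t) = (LBINT t. LBINT y. h y t)"
      using lborel_pair.Fubini_integral[OF int_h] by simp
    finally have "norm (LBINT y. of_real (?\<phi> y) * f (u + e * y)) = 1 / sqrt (2 * pi) * norm (LBINT t. LBINT y. h y t)"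
      by (simp add: norm_mult norm_divide)
    also have "norm (LBINT t. LBINT y. h y t) \<le> (LBINT t. G (0 + (- 1 / e) * t) / e * (1 / sqrt (2 * pi)))"
    proof (rule order_trans[OF integral_norm_bound], rule integral_mono)
      show "integrable lborel (\<lambda>t. norm (LBINT y. h y t))"
        using integrable_norm[OF lborel_pair.integrable_snd[OF int_h]] by simp
      show "integrable lborel (\<lambda>t. G (0 + (- 1 / e) * t) / e * (1 / sqrt (2 * pi)))"
        using e by (intro integrable_mult_left integrable_divide lborel_integrable_real_affine G) auto
      fix t
      have "norm (LBINT y. h y t) \<le> ?\<phi> t * (G (- t / e) / e)" by (rule inner)
      also have "\<dots> \<le> (1 / sqrt (2 * pi)) * (G (- t / e) / e)"
        using G0 e by (intro mult_right_mono) (auto simp: std_normal_density_def divide_right_mono)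
      finally show "norm (LBINT y. h y t) \<le> G (0 + (- 1 / e) * t) / e * (1 / sqrt (2 * pi))"
        by (simp add: mult.commute)
    qed
    \<comment> \<open>Rescaling absorbs the \<open>1 / e\<close>, so the bound does not depend on
      the width of the Gaussian.\<close>
    also have "(LBINT t. G (0 + (- 1 / e) * t) / e * (1 / sqrt (2 * pi))) = (LBINT t. G t) / sqrt (2 * pi)"
      using e by (subst (2) lborel_integral_real_affine[where c = "- 1 / e" and t = 0]) (auto simp: mult_ac)
    also have "1 / sqrt (2 * pi) * ((LBINT t. G t) / sqrt (2 * pi)) = (LBINT t. G t) / (2 * pi)"
      by simp
    finally show ?thesis by (simp add: divide_right_mono)
  qed
  \<comment> \<open>As the width shrinks, the averages tend to \<open>f u\<close> by continuity,
    with the bound \<open>M\<close> for domination.\<close>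
  have "(\<lambda>n. LBINT y. of_real (?\<phi> y) * f (u + 1 / real (Suc n) * y)) \<longlonglongrightarrow> (LBINT y. of_real (?\<phi> y) * f u)"
  proof (rule integral_dominated_convergence[where w = "\<lambda>y. ?\<phi> y * M"])
    show "AE y in lborel. (\<lambda>n. of_real (?\<phi> y) * f (u + 1 / real (Suc n) * y)) \<longlonglongrightarrow> of_real (?\<phi> y) * f u"
    proof (intro AE_I2 tendsto_intros)
      fix y
      have "(\<lambda>n. 1 / real (Suc n)) \<longlonglongrightarrow> 0" by real_asymp
      then have "(\<lambda>n. u + 1 / real (Suc n) * y) \<longlonglongrightarrow> u + 0 * y"
        by (intro tendsto_intros)
      moreover have "isCont f u" using cont continuous_on_eq_continuous_at[OF open_UNIV] by blast
      ultimately show "(\<lambda>n. f (u + 1 / real (Suc n) * y)) \<longlonglongrightarrow> f u"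
        using isCont_tendsto_compose by fastforce
    qed
    show "AE y in lborel. norm (of_real (?\<phi> y) * f (u + 1 / real (Suc n) * y)) \<le> ?\<phi> y * M" for n
      using M by (auto intro!: mult_left_mono simp: norm_mult)
  qed auto
  moreover have "(LBINT y. of_real (?\<phi> y) * f u) = f u"
  proof -
    have "(LBINT y. ?\<phi> y) = 1"
      using real_distribution.axioms(1)[OF real_dist_normal_dist] integral_normal_density[of 1 0] by simp
    then have "(LBINT y. complex_of_real (?\<phi> y)) = 1"
      by (subst integral_complex_of_real) simp
    then show ?thesis by simp
  qed
  ultimately have "(\<lambda>n. norm (LBINT y. of_real (?\<phi> y) * f (u + 1 / real (Suc n) * y))) \<longlonglongrightarrow> norm (f u)"
    by (auto intro: tendsto_norm)
  moreover have "norm (LBINT y. of_real (?\<phi> y) * f (u + 1 / real (Suc n) * y)) \<le> (LBINT t. G t) / (2 * pi)" for n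
    by (rule avg) simp
  ultimately show ?thesis using LIMSEQ_le_const2 by blast
qed

section \<open>Laplace transforms of functions of polynomial growth\<close>

lemma power_le_exp:
  fixes x c :: real
  assumes "x \<ge> 0" "c > 0"
  shows "x ^ d \<le> fact d / c ^ d * exp (c * x)"
proof -
  have "(\<Sum>i\<in>{d}. (c * x) ^ i /\<^sub>R fact i) \<le> exp (c * x)"
    unfolding exp_def using assms by (intro sum_le_suminf summable_exp_generic) auto
  then have "(c * x) ^ d / fact d \<le> exp (c * x)" by (simp add: field_simps)
  then show ?thesis using assms by (simp add: field_simps power_mult_distrib)
qed

lemma integrable_exp_atLeast:
  assumes "\<sigma> > 0"
  shows "integrable lborel (\<lambda>u. indicator {0..} u * exp (- \<sigma> * u) :: real)"
proof -
  have "(\<lambda>u. exp (- \<sigma> * u)) integrable_on {0..}"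
    using has_integral_exp_minus_to_infinity[OF assms, of 0] by blast
  then have "(\<lambda>u. exp (- \<sigma> * u)) absolutely_integrable_on {0..}"
    by (rule nonnegative_absolutely_integrable_1) simp
  then show ?thesis
    unfolding set_integrable_def by (subst (asm) integrable_completion) auto
qed

text \<open>Half of the exponential decay absorbs the polynomial.\<close>

lemma integrable_power_exp:
  assumes "\<sigma> > 0"
  shows "integrable lborel (\<lambda>u. indicator {0..} u * ((1 + u) ^ d * exp (- \<sigma> * u)) :: real)"
proof -
  define C where "C = fact d / (\<sigma> / 2) ^ d * exp (\<sigma> / 2)"
  have "integrable lborel (\<lambda>u. C * (indicator {0..} u * exp (- (\<sigma> / 2) * u)) :: real)"
    using assms by (intro integrable_mult_right integrable_exp_atLeast) auto
  then show ?thesis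
  proof (rule Bochner_Integration.integrable_bound)
    show "AE u in lborel. norm (indicator {0..} u * ((1 + u) ^ d * exp (- \<sigma> * u)) :: real) \<le>
        norm (C * (indicator {0..} u * exp (- (\<sigma> / 2) * u)))"
    proof (intro AE_I2)
      fix u :: real
      show "norm (indicator {0..} u * ((1 + u) ^ d * exp (- \<sigma> * u)) :: real) \<le>
        norm (C * (indicator {0..} u * exp (- (\<sigma> / 2) * u)))"
      proof (cases "u \<ge> 0")
        case True
        have "(1 + u) ^ d \<le> fact d / (\<sigma> / 2) ^ d * exp (\<sigma> / 2 * (1 + u))"
          using True assms by (intro power_le_exp) auto
        then have "(1 + u) ^ d * exp (- \<sigma> * u) \<le> fact d / (\<sigma> / 2) ^ d * exp (\<sigma> / 2 * (1 + u)) * exp (- \<sigma> * u)"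
          by (intro mult_right_mono) auto
        also have "\<dots> = C * exp (- (\<sigma> / 2) * u)"
        proof -
          have "\<sigma> / 2 * (1 + u) + - \<sigma> * u = \<sigma> / 2 + - (\<sigma> / 2) * u" by (simp add: field_simps)
          then have "exp (\<sigma> / 2 * (1 + u)) * exp (- \<sigma> * u) = exp (\<sigma> / 2) * exp (- (\<sigma> / 2) * u)"
            by (simp only: exp_add[symmetric])
          then show ?thesis unfolding C_def by (simp only: mult.assoc)
        qed
        finally show ?thesis using True assms by (simp add: C_def)
      qed auto
    qed
  qed auto
qed

lemma integrable_Laplace:
  fixes \<psi> :: "real \<Rightarrow> complex"
  assumes m: "\<psi> \<in> borel_measurable borel" and b: "\<And>u. u \<ge> 0 \<Longrightarrow> norm (\<psi> u) \<le> C * (1 + u) ^ d"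
    and z: "\<And>u. u < 0 \<Longrightarrow> \<psi> u = 0" and s: "Re s > 0"
  shows "integrable lborel (\<lambda>u. \<psi> u * exp (- s * of_real u))"
proof -
  note [measurable] = m
  have "integrable lborel (\<lambda>u. C * (indicator {0..} u * ((1 + u) ^ d * exp (- Re s * u))) :: real)"
    using s by (intro integrable_mult_right integrable_power_exp)
  then show ?thesis
  proof (rule Bochner_Integration.integrable_bound)
    show "AE u in lborel. norm (\<psi> u * exp (- s * of_real u)) \<le>
       norm (C * (indicator {0..} u * ((1 + u) ^ d * exp (- Re s * u))))"
    proof (intro AE_I2)
      fix u :: real
      show "norm (\<psi> u * exp (- s * of_real u)) \<le> norm (C * (indicator {0..} u * ((1 + u) ^ d * exp (- Re s * u))))"
      proof (cases "u \<ge> 0")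
        case True
        have "norm (\<psi> u * exp (- s * of_real u)) \<le> C * (1 + u) ^ d * exp (- Re s * u)"
          using b[OF True] by (simp add: norm_mult mult_right_mono)
        also have "\<dots> \<le> norm (C * (indicator {0..} u * ((1 + u) ^ d * exp (- Re s * u))))"
          using True by (simp add: mult_ac)
        finally show ?thesis .
      qed (simp add: z)
    qed
  qed auto
qed

text \<open>The derivative of \<open>K\<close> is known to exist, so it can be computed along the
  single sequence \<open>s + 1 / (n + 1)\<close>. There the difference quotients of the exponential
  are at most \<open>u\<close>, and dominated convergence applies.\<close>

lemma Laplace_deriv:
  fixes \<psi> :: "real \<Rightarrow> complex"
  assumes m: "\<psi> \<in> borel_measurable borel" and b: "\<And>u. u \<ge> 0 \<Longrightarrow> norm (\<psi> u) \<le> C * (1 + u) ^ d"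
    and z: "\<And>u. u < 0 \<Longrightarrow> \<psi> u = 0" and s: "Re s > 0"
    and K: "\<And>z. Re z > 0 \<Longrightarrow> K z = (LBINT u. \<psi> u * exp (- z * of_real u))"
    and D: "(K has_field_derivative D) (at s)"
  shows "(LBINT u. (of_real u * \<psi> u) * exp (- s * of_real u)) = - D"
proof -
  note [measurable] = m
  define h where "h = (\<lambda>n::nat. 1 / real (Suc n))"
  have h: "h n > 0" "h n \<le> 1" for n by (auto simp: h_def)
  have h0: "h \<longlonglongrightarrow> 0" unfolding h_def by real_asymp
  have C0: "C \<ge> 0" using order_trans[OF norm_ge_zero b[of 0]] by simp
  have "(\<lambda>n. (K (s + of_real (h n)) - K s) / of_real (h n)) \<longlonglongrightarrow> D"
  proof -
    have "((\<lambda>w. (K (s + w) - K s) / w) \<longlongrightarrow> D) (at 0)"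
      using D by (simp add: DERIV_def)
    moreover have "filterlim (\<lambda>n. complex_of_real (h n)) (at 0) sequentially"
      unfolding filterlim_at using h0 h(1) tendsto_of_real[OF h0, where ?'a = complex]
      by (auto simp: less_imp_neq[symmetric] order_less_imp_not_eq2)
    ultimately show ?thesis by (rule filterlim_compose)
  qed
  moreover have "(K (s + of_real (h n)) - K s) / of_real (h n) =
      (LBINT u. \<psi> u * exp (- s * of_real u) * ((exp (- of_real (h n * u)) - 1) / of_real (h n)))" for n
  proof -
    have "K (s + of_real (h n)) - K s =
       (LBINT u. \<psi> u * exp (- (s + of_real (h n)) * of_real u) - \<psi> u * exp (- s * of_real u))"
    proof -
      have "Re s + h n > 0" using s h[of n] by simp
      then show ?thesis
        using integrable_Laplace[OF m b z, of s] integrable_Laplace[OF m b z, of "s + of_real (h n)"] s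
        by (subst Bochner_Integration.integral_diff) (auto simp: K)
    qed
    also have "\<dots> / of_real (h n) = (LBINT u. (\<psi> u * exp (- (s + of_real (h n)) * of_real u) - \<psi> u * exp (- s * of_real u)) / of_real (h n))"
      by simp
    also have "\<dots> = (LBINT u. \<psi> u * exp (- s * of_real u) * ((exp (- of_real (h n * u)) - 1) / of_real (h n)))"
    proof (rule Bochner_Integration.integral_cong[OF refl])
      fix u :: real
      have "- (s + of_real (h n)) * of_real u = - s * of_real u + - of_real (h n * u)"
        by (simp add: algebra_simps)
      then have "exp (- (s + of_real (h n)) * of_real u) = exp (- s * of_real u) * exp (- of_real (h n * u))"
        by (simp only: exp_add)
      then show "(\<psi> u * exp (- (s + of_real (h n)) * of_real u) - \<psi> u * exp (- s * of_real u)) / of_real (h n) =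
        \<psi> u * exp (- s * of_real u) * ((exp (- of_real (h n * u)) - 1) / of_real (h n))"
        by (simp only:) (simp add: algebra_simps diff_divide_distrib)
    qed
    finally show ?thesis .
  qed
  moreover have "(\<lambda>n. LBINT u. \<psi> u * exp (- s * of_real u) * ((exp (- of_real (h n * u)) - 1) / of_real (h n))) \<longlonglongrightarrow>
     (LBINT u. \<psi> u * exp (- s * of_real u) * (- of_real u))"
  proof (rule integral_dominated_convergence[where w = "\<lambda>u. C * (indicator {0..} u * ((1 + u) ^ Suc d * exp (- Re s * u)))"])
    show "integrable lborel (\<lambda>u. C * (indicator {0..} u * ((1 + u) ^ Suc d * exp (- Re s * u))))"
      using s by (intro integrable_mult_right integrable_power_exp)
    show "AE u in lborel. (\<lambda>n. \<psi> u * exp (- s * of_real u) * ((exp (- of_real (h n * u)) - 1) / of_real (h n)))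
       \<longlonglongrightarrow> \<psi> u * exp (- s * of_real u) * (- of_real u)"
    proof (intro AE_I2 tendsto_intros)
      fix u :: real
      have "(\<lambda>n. (exp (- (h n * u)) - 1) / h n) \<longlonglongrightarrow> - u"
        unfolding h_def by real_asymp
      then have "(\<lambda>n. complex_of_real ((exp (- (h n * u)) - 1) / h n)) \<longlonglongrightarrow> of_real (- u)"
        by (rule tendsto_of_real)
      then show "(\<lambda>n. (exp (- of_real (h n * u)) - 1) / complex_of_real (h n)) \<longlonglongrightarrow> - of_real u"
        by (simp add: exp_of_real[symmetric])
    qed
    show "AE u in lborel. norm (\<psi> u * exp (- s * of_real u) * ((exp (- of_real (h n * u)) - 1) / of_real (h n))) \<le>
       C * (indicator {0..} u * ((1 + u) ^ Suc d * exp (- Re s * u)))" for n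
    proof (intro AE_I2)
      fix u :: real
      show "norm (\<psi> u * exp (- s * of_real u) * ((exp (- of_real (h n * u)) - 1) / of_real (h n))) \<le>
       C * (indicator {0..} u * ((1 + u) ^ Suc d * exp (- Re s * u)))"
      proof (cases "u \<ge> 0")
        case True
        have "complex_of_real ((exp (- (h n * u)) - 1) / h n) = (exp (- of_real (h n * u)) - 1) / of_real (h n)"
          by (simp add: exp_of_real[symmetric])
        then have "norm ((exp (- of_real (h n * u)) - 1) / complex_of_real (h n)) = \<bar>(exp (- (h n * u)) - 1) / h n\<bar>"
          by (metis norm_of_real)
        also have "\<dots> \<le> 1 + u"
        proof -
          have "1 - h n * u \<le> exp (- (h n * u))" using exp_ge_add_one_self[of "- (h n * u)"] by simp
          moreover have "exp (- (h n * u)) \<le> 1" using True h[of n] by simp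
          ultimately have "\<bar>exp (- (h n * u)) - 1\<bar> \<le> h n * u" by simp
          then have "\<bar>(exp (- (h n * u)) - 1) / h n\<bar> \<le> u" using h[of n] by (simp add: abs_divide field_simps)
          then show ?thesis by simp
        qed
        finally have 1: "norm ((exp (- of_real (h n * u)) - 1) / complex_of_real (h n)) \<le> 1 + u" .
        have "norm (\<psi> u * exp (- s * of_real u)) \<le> C * (1 + u) ^ d * exp (- Re s * u)"
          using b[OF True] by (simp add: norm_mult mult_right_mono)
        with 1 have "norm (\<psi> u * exp (- s * of_real u) * ((exp (- of_real (h n * u)) - 1) / of_real (h n))) \<le>
            C * (1 + u) ^ d * exp (- Re s * u) * (1 + u)"
          unfolding norm_mult[of "\<psi> u * exp (- s * of_real u)"] using True C0 by (intro mult_mono) auto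
        then show ?thesis using True by (simp add: mult_ac)
      qed (simp add: z)
    qed
  qed auto
  ultimately have "(LBINT u. \<psi> u * exp (- s * of_real u) * (- of_real u)) = D"
    using LIMSEQ_unique by (simp only:) blast
  moreover have "(LBINT u. \<psi> u * exp (- s * of_real u) * (- of_real u)) =
      - (LBINT u. (of_real u * \<psi> u) * exp (- s * of_real u))"
    by (subst integral_minus[symmetric]) (auto intro!: Bochner_Integration.integral_cong)
  ultimately show ?thesis by simp
qed

lemma Laplace_one:
  assumes s: "Re s > 0"
  shows "(LBINT u. indicator {0..} u * exp (- s * of_real u)) = 1 / s"
proof -
  have s0: "s \<noteq> 0" using s by auto
  have part: "(LBINT u. indicator {0..real n} u *\<^sub>R exp (- s * of_real u)) = (1 - exp (- s * of_real (real n))) / s" for n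
  proof -
    have "(LBINT u. indicator {0..real n} u *\<^sub>R exp (- s * of_real u)) =
        - exp (- s * of_real (real n)) / s - (- exp (- s * of_real 0) / s)"
    proof (rule integral_FTC_atLeastAtMost)
      fix x :: real
      have "((\<lambda>z. - exp (- s * z) / s) has_field_derivative exp (- s * of_real x)) (at (of_real x))"
        using s0 by (auto intro!: derivative_eq_intros)
      then show "((\<lambda>u. - exp (- s * of_real u) / s) has_vector_derivative exp (- s * of_real x)) (at x within {0..real n})"
        by (rule has_vector_derivative_real_field[THEN has_vector_derivative_at_within])
    qed (auto intro!: continuous_intros)
    then show ?thesis by (simp add: diff_divide_distrib)
  qed
  have "(\<lambda>n. LBINT u. indicator {0..real n} u *\<^sub>R exp (- s * of_real u)) \<longlonglongrightarrow>
      (LBINT u. indicator {0..} u * exp (- s * of_real u))"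
  proof (rule integral_dominated_convergence[where w = "\<lambda>u. indicator {0..} u * exp (- Re s * u)"])
    show "integrable lborel (\<lambda>u. indicator {0..} u * exp (- Re s * u) :: real)"
      using s by (rule integrable_exp_atLeast)
    show "AE u in lborel. (\<lambda>n. indicator {0..real n} u *\<^sub>R exp (- s * of_real u)) \<longlonglongrightarrow>
       indicator {0..} u * exp (- s * of_real u)"
    proof (intro AE_I2)
      fix u :: real
      have "eventually (\<lambda>n. real n \<ge> u) sequentially"
        using filterlim_real_sequentially by (simp add: filterlim_at_top)
      then have "eventually (\<lambda>n. indicator {0..real n} u *\<^sub>R exp (- s * of_real u) =
          indicator {0..} u * exp (- s * of_real u)) sequentially"
        by eventually_elim (auto simp: indicator_def)
      then show "(\<lambda>n. indicator {0..real n} u *\<^sub>R exp (- s * of_real u)) \<longlonglongrightarrow>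
         indicator {0..} u * exp (- s * of_real u)"
        by (rule tendsto_eventually)
    qed
    show "AE u in lborel. norm (indicator {0..real n} u *\<^sub>R exp (- s * of_real u)) \<le>
       indicator {0..} u * exp (- Re s * u)" for n
      by (intro AE_I2) (auto simp: indicator_def)
  qed auto
  moreover have "(\<lambda>n. (1 - exp (- s * of_real (real n))) / s) \<longlonglongrightarrow> (1 - 0) / s"
  proof (intro tendsto_intros s0)
    have "(\<lambda>n. exp (- Re s * real n)) \<longlonglongrightarrow> 0" using s by real_asymp
    then have "(\<lambda>n. norm (exp (- s * of_real (real n)))) \<longlonglongrightarrow> 0" by simp
    then show "(\<lambda>n. exp (- s * of_real (real n))) \<longlonglongrightarrow> 0" by (rule tendsto_norm_zero_cancel)
  qed
  ultimately show ?thesis unfolding part using LIMSEQ_unique by fastforce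
qed

lemma Laplace_power:
  assumes "Re s > 0"
  shows "(LBINT u. (indicator {0..} u * of_real u ^ j) * exp (- s * of_real u)) = fact j / s ^ Suc j"
  using assms
proof (induction j arbitrary: s)
  case 0
  then show ?case using Laplace_one[of s] by simp
next
  case (Suc j)
  have "(LBINT u. (of_real u * (indicator {0..} u * of_real u ^ j)) * exp (- s * of_real u)) =
      - (- fact (Suc j) / s ^ Suc (Suc j))"
  proof (rule Laplace_deriv[where K = "\<lambda>s. fact j / s ^ Suc j" and C = 1 and d = j])
    have "s \<noteq> 0" using Suc.prems by auto
    then show "((\<lambda>s. fact j / s ^ Suc j) has_field_derivative - fact (Suc j) / s ^ Suc (Suc j)) (at s)"
      by (auto intro!: derivative_eq_intros simp: divide_simps) (cases j, auto simp: algebra_simps)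
    show "norm (indicator {0..} u * of_real u ^ j :: complex) \<le> 1 * (1 + u) ^ j" if "u \<ge> 0" for u
      using that by (auto simp: norm_mult norm_power intro!: power_mono)
  qed (use Suc in auto)
  then show ?case by (simp add: mult_ac)
qed

section \<open>Sums weighted by powers of logarithms\<close>

text \<open>In the variable \<open>u = log x\<close> the Dirichlet series appears as a Laplace
  transform, and integration raises the exponent \<open>m\<close>.\<close>

definition logsum :: "dser \<Rightarrow> nat \<Rightarrow> real \<Rightarrow> complex" where
  "logsum f m u = (\<Sum>n | 0 < n \<and> real n \<le> exp u. dnth f n * of_real ((u - ln (real n)) ^ m))"

lemma nat_le_real_eq: "{n. 0 < n \<and> real n \<le> x} = {1..nat \<lfloor>x\<rfloor>}"
proof -
  have "real n \<le> x \<longleftrightarrow> n \<le> nat \<lfloor>x\<rfloor>" if "n > 0" for n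
    using that le_floor_iff[of "int n" x] by auto
  then show ?thesis by (auto simp: Suc_le_eq)
qed

lemma finite_nat_le_real: "finite {n. 0 < n \<and> real n \<le> x}"
  by (simp add: nat_le_real_eq)

lemma logsum_neg: "u < 0 \<Longrightarrow> logsum f m u = 0"
proof -
  assume "u < 0"
  then have "exp u < 1" by simp
  have "\<not> real n \<le> exp u" if "0 < n" for n
  proof -
    have "real n \<ge> 1" using that by simp
    then show ?thesis using \<open>exp u < 1\<close> by linarith
  qed
  then have "{n. 0 < n \<and> real n \<le> exp u} = {}" by blast
  then show ?thesis unfolding logsum_def by (simp only: sum.empty)
qed

text \<open>Truncated powers free the range of summation from \<open>u\<close> as long as
  \<open>u\<close> stays bounded, so continuity and derivatives are those of a fixed finite
  sum.\<close>

lemma logsum_eq_max: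
  assumes m: "m \<ge> 1" and N: "exp u \<le> real N"
  shows "logsum f m u = (\<Sum>n=1..N. dnth f n * of_real (max 0 (u - ln (real n)) ^ m))"
  unfolding logsum_def
proof (rule sum.mono_neutral_cong_left)
  show "{n. 0 < n \<and> real n \<le> exp u} \<subseteq> {1..N}" using N by (auto simp: Suc_le_eq) 
  show "\<forall>n\<in>{1..N} - {n. 0 < n \<and> real n \<le> exp u}. dnth f n * of_real (max 0 (u - ln (real n)) ^ m) = 0"
  proof
    fix n assume n: "n \<in> {1..N} - {n. 0 < n \<and> real n \<le> exp u}"
    then have "u < ln (real n)" by (auto simp: not_le exp_less_cancel_iff[symmetric, of u] Suc_le_eq)
    then show "dnth f n * of_real (max 0 (u - ln (real n)) ^ m) = 0" using m by simp
  qed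
next
  fix n assume "n \<in> {n. 0 < n \<and> real n \<le> exp u}"
  then have "ln (real n) \<le> u" by (metis exp_ln exp_le_cancel_iff mem_Collect_eq of_nat_0_less_iff)
  then show "dnth f n * of_real ((u - ln (real n)) ^ m) = dnth f n * of_real (max 0 (u - ln (real n)) ^ m)"
    by simp
qed auto

lemma continuous_logsum:
  assumes m: "m \<ge> 1"
  shows "continuous_on UNIV (logsum f m)"
proof -
  have "continuous_on (\<Union>U\<in>UNIV. {..<U}) (logsum f m)"
  proof (rule continuous_on_open_UN)
    fix U :: real
    define N where "N = nat \<lceil>exp U\<rceil>"
    have "continuous_on {..<U} (\<lambda>u. \<Sum>n=1..N. dnth f n * complex_of_real (max 0 (u - ln (real n)) ^ m))"
      by (intro continuous_intros)
    moreover have "logsum f m u = (\<Sum>n=1..N. dnth f n * of_real (max 0 (u - ln (real n)) ^ m))" if "u \<in> {..<U}" for u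
    proof (rule logsum_eq_max[OF m])
      have "exp u \<le> exp U" using that by simp
      also have "\<dots> \<le> real N" unfolding N_def by linarith
      finally show "exp u \<le> real N" .
    qed
    ultimately show "continuous_on {..<U} (logsum f m)"
      using continuous_on_eq by (metis (no_types, lifting))
  qed auto
  moreover have "(\<Union>U\<in>UNIV. {..<U}) = (UNIV :: real set)" using gt_ex by blast
  ultimately show ?thesis by simp
qed

text \<open>A crude bound, far from the true size when \<open>f = dMu\<close>; it only has to make
  the Laplace transforms converge for \<open>Re s > 0\<close>.\<close>

lemma norm_logsum_power_le:
  assumes f: "\<And>n. n > 0 \<Longrightarrow> norm (dnth f n) \<le> 1 / real n" and u: "u \<ge> 0"
  shows "norm (logsum (f ^ j) m u) \<le> (1 + u) ^ (j + m)"
proof -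
  define N where "N = nat \<lfloor>exp u\<rfloor>"
  have eN: "{n. 0 < n \<and> real n \<le> exp u} = {1..N}" by (simp add: N_def nat_le_real_eq)
  have N: "N \<ge> 1" "real N \<le> exp u" using u unfolding N_def by (auto simp: le_nat_iff le_floor_iff)
  have "norm (logsum (f ^ j) m u) \<le> (\<Sum>n=1..N. norm (dnth (f ^ j) n) * u ^ m)"
    unfolding logsum_def eN
  proof (rule sum_norm_le)
    fix n assume n: "n \<in> {1..N}"
    then have "real n \<le> exp u" using N by (metis atLeastAtMost_iff of_nat_le_iff order_trans)
    then have "0 \<le> u - ln (real n)" using n by (metis atLeastAtMost_iff diff_ge_0_iff_ge exp_le_cancel_iff exp_ln less_le_trans of_nat_0_less_iff zero_less_one)
    moreover have "u - ln (real n) \<le> u" using n by simp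
    ultimately have "\<bar>(u - ln (real n)) ^ m\<bar> \<le> u ^ m" by (simp add: power_mono)
    then show "norm (dnth (f ^ j) n * of_real ((u - ln (real n)) ^ m)) \<le> norm (dnth (f ^ j) n) * u ^ m"
      unfolding norm_mult norm_of_real by (rule mult_left_mono) simp
  qed
  also have "\<dots> = (\<Sum>n=1..N. norm (dnth (f ^ j) n)) * u ^ m"
    by (simp add: sum_distrib_right)
  also have "\<dots> \<le> (1 + u) ^ j * (1 + u) ^ m"
  proof (rule mult_mono)
    have "(\<Sum>n=1..N. norm (dnth (f ^ j) n)) \<le> (1 + ln (real N)) ^ j"
      by (rule sum_norm_power_le[OF f N(1)])
    also have "\<dots> \<le> (1 + u) ^ j"
    proof (rule power_mono)
      have "ln (real N) \<le> ln (exp u)" using N by (subst ln_le_cancel_iff) auto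
      then show "1 + ln (real N) \<le> 1 + u" by simp
    qed (use N in auto)
    finally show "(\<Sum>n=1..N. norm (dnth (f ^ j) n)) \<le> (1 + u) ^ j" .
  qed (use u in \<open>auto intro: power_mono\<close>)
  finally show ?thesis by (simp add: power_add)
qed

lemma Laplace_shifted_power:
  assumes n: "n > 0" and m: "m \<ge> 1" and s: "Re s > 0"
  shows "(LBINT u. of_real (max 0 (u - ln (real n)) ^ m) * exp (- s * of_real u)) =
           of_nat n powr (- s) * (fact m / s ^ Suc m)"
    and "integrable lborel (\<lambda>u. of_real (max 0 (u - ln (real n)) ^ m) * exp (- s * of_real u))"
proof -
  have "(LBINT u. of_real (max 0 (u - ln (real n)) ^ m) * exp (- s * of_real u)) =
     (LBINT v. of_real (max 0 (ln (real n) + 1 * v - ln (real n)) ^ m) * exp (- s * of_real (ln (real n) + 1 * v)))"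
    by (subst lborel_integral_real_affine[where c = 1 and t = "ln (real n)"]) auto
  also have "\<dots> = (LBINT v. of_nat n powr (- s) * ((indicator {0..} v * of_real v ^ m) * exp (- s * of_real v)))"
  proof (rule Bochner_Integration.integral_cong[OF refl])
    fix v :: real
    have a: "complex_of_real (max 0 (ln (real n) + 1 * v - ln (real n)) ^ m) = indicator {0..} v * of_real v ^ m"
      using m by (auto simp: indicator_def max_def)
    have b: "exp (- s * of_real (ln (real n) + 1 * v)) = of_nat n powr (- s) * exp (- s * of_real v)"
    proof -
      have "- s * of_real (ln (real n) + 1 * v) = - s * of_real (ln (real n)) + - s * of_real v"
        by (simp add: algebra_simps)
      moreover have "(of_nat n :: complex) powr (- s) = exp (- s * of_real (ln (real n)))"
        using n Ln_of_real[of "real n"] by (simp add: powr_def)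
      ultimately show ?thesis by (simp only: exp_add)
    qed
    show "of_real (max 0 (ln (real n) + 1 * v - ln (real n)) ^ m) * exp (- s * of_real (ln (real n) + 1 * v)) =
       of_nat n powr (- s) * ((indicator {0..} v * of_real v ^ m) * exp (- s * of_real v))"
      unfolding a b by (rule mult.left_commute)
  qed
  also have "\<dots> = of_nat n powr (- s) * (fact m / s ^ Suc m)"
    using Laplace_power[OF s, of m] by simp
  finally show "(LBINT u. of_real (max 0 (u - ln (real n)) ^ m) * exp (- s * of_real u)) =
           of_nat n powr (- s) * (fact m / s ^ Suc m)" .
  show "integrable lborel (\<lambda>u. of_real (max 0 (u - ln (real n)) ^ m) * exp (- s * of_real u))"
  proof (rule integrable_Laplace[where C = 1 and d = m])
    have "ln (real n) \<ge> 0" using n by simp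
    then show "norm (complex_of_real (max 0 (u - ln (real n)) ^ m)) \<le> 1 * (1 + u) ^ m" if "u \<ge> 0" for u
      unfolding norm_of_real using that by (auto simp: power_abs intro!: power_mono)
    show "complex_of_real (max 0 (u - ln (real n)) ^ m) = 0" if "u < 0" for u
      using that m \<open>ln (real n) \<ge> 0\<close> by simp
  qed (use s in auto)
qed

text \<open>Each \<open>n\<close> contributes the power \<open>u^m\<close> shifted by
  \<open>log n\<close>, whose transform is \<open>n powr (-s) * m! / s^(m+1)\<close>. The same
  computation at the real point \<open>Re s\<close> gives the integrals of the norms and so
  justifies exchanging sum and integral.\<close>

lemma Laplace_logsum:
  assumes f: "dbound (- Re s) f B" and m: "m \<ge> 1" and s: "Re s > 0"
  shows "(LBINT u. logsum f m u * exp (- s * of_real u)) = deval s f * (fact m / s ^ Suc m)"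
proof -
  define \<sigma> where "\<sigma> = Re s"
  define F where "F = (\<lambda>n u. dnth f n * (of_real (max 0 (u - ln (real n)) ^ m) * exp (- s * of_real u)))"
  have supp: "F n u = 0" if "n \<notin> {1..nat \<lceil>exp u\<rceil>}" for n u
  proof (cases "n = 0")
    case False
    then have "n > nat \<lceil>exp u\<rceil>" using that by auto
    then have "real n > exp u" by linarith
    then have "ln (real n) > u" using False by (metis exp_less_cancel_iff exp_ln of_nat_0_less_iff not_gr0)
    then show ?thesis using m by (simp add: F_def)
  qed (simp add: F_def)
  have suminf: "(\<Sum>n. F n u) = logsum f m u * exp (- s * of_real u)" for u
  proof -
    have "(\<Sum>n. F n u) = (\<Sum>n=1..nat \<lceil>exp u\<rceil>. F n u)"
      by (rule suminf_finite) (use supp in auto)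
    also have "\<dots> = logsum f m u * exp (- s * of_real u)"
      unfolding F_def
      by (subst logsum_eq_max[OF m, of u "nat \<lceil>exp u\<rceil>"]) (linarith, simp add: sum_distrib_left mult_ac)
    finally show ?thesis .
  qed
  have int: "integrable lborel (F n)" for n
    unfolding F_def using m s Laplace_shifted_power(2)[of n m s]
    by (cases "n = 0") (auto intro!: integrable_mult_right)
  have norm_int: "(LBINT u. norm (F n u)) = norm (dnth f n) * real n powr (- \<sigma>) * (fact m / \<sigma> ^ Suc m)" for n
  proof (cases "n = 0")
    case False
    have "complex_of_real (LBINT u. norm (F n u)) =
       (LBINT u. of_real (norm (dnth f n)) * (of_real (max 0 (u - ln (real n)) ^ m) * exp (- of_real \<sigma> * of_real u)))"
      unfolding integral_complex_of_real[symmetric]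
    proof (rule Bochner_Integration.integral_cong[OF refl])
      fix u
      have "norm (F n u) = norm (dnth f n) * (max 0 (u - ln (real n)) ^ m * exp (- \<sigma> * u))"
        by (simp add: F_def norm_mult \<sigma>_def norm_power)
      then show "complex_of_real (norm (F n u)) =
          of_real (norm (dnth f n)) * (of_real (max 0 (u - ln (real n)) ^ m) * exp (- of_real \<sigma> * of_real u))"
        by (simp add: exp_of_real[symmetric])
    qed
    also have "\<dots> = of_real (norm (dnth f n)) * (of_nat n powr (- of_real \<sigma>) * (fact m / of_real \<sigma> ^ Suc m))"
      using Laplace_shifted_power(1)[of n m "of_real \<sigma>"] False m s by (simp add: \<sigma>_def)
    also have "of_nat n powr (- complex_of_real \<sigma>) = of_real (real n powr (- \<sigma>))"
      using False by (simp add: powr_of_real[symmetric])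
    finally have "complex_of_real (LBINT u. norm (F n u)) =
        of_real (norm (dnth f n) * real n powr (- \<sigma>) * (fact m / \<sigma> ^ Suc m))"
      by simp
    then show ?thesis using of_real_eq_iff by blast
  qed (simp add: F_def)
  have "(\<lambda>n. integral\<^sup>L lborel (F n)) sums (LBINT u. (\<Sum>n. F n u))"
  proof (rule sums_integral[OF int])
    show "AE u in lborel. summable (\<lambda>n. norm (F n u))"
      by (intro AE_I2 summable_finite[of "{1..nat \<lceil>exp u\<rceil>}" for u]) (use supp in auto)
    have "summable (\<lambda>n. norm (dnth f n) * real n powr (- \<sigma>))"
      using dbound_summable(1)[OF f] by (simp add: \<sigma>_def)
    then show "summable (\<lambda>n. LBINT u. norm (F n u))"
      unfolding norm_int by (rule summable_mult2)
  qed
  then have 1: "(\<lambda>N. \<Sum>n<N. integral\<^sup>L lborel (F n)) \<longlonglongrightarrow> (LBINT u. logsum f m u * exp (- s * of_real u))"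
    by (simp add: suminf sums_def)
  have Fn: "integral\<^sup>L lborel (F n) = dnth f n * of_nat n powr (- s) * (fact m / s ^ Suc m)" for n
  proof (cases "n = 0")
    case False
    then show ?thesis unfolding F_def
      using Laplace_shifted_power(1)[of n m s] m s by simp
  qed (simp add: F_def)
  have "(\<Sum>n<Suc N. integral\<^sup>L lborel (F n)) = (\<Sum>n=1..N. dnth f n * of_nat n powr (- s)) * (fact m / s ^ Suc m)" for N
    unfolding Fn sum_distrib_right by (rule sum.mono_neutral_right) auto
  moreover have "(\<lambda>N. (\<Sum>n=1..N. dnth f n * of_nat n powr (- s)) * (fact m / s ^ Suc m)) \<longlonglongrightarrow>
      deval s f * (fact m / s ^ Suc m)"
    by (intro tendsto_mult_right deval_partial_sums dbound_imp_dsummable[OF f])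
  ultimately have "(\<lambda>N. \<Sum>n<Suc N. integral\<^sup>L lborel (F n)) \<longlonglongrightarrow> deval s f * (fact m / s ^ Suc m)"
    by (simp only:)
  then have "(\<lambda>N. \<Sum>n<N. integral\<^sup>L lborel (F n)) \<longlonglongrightarrow> deval s f * (fact m / s ^ Suc m)"
    by (rule LIMSEQ_imp_Suc)
  with 1 show ?thesis by (rule LIMSEQ_unique)
qed

lemma integrable_decay: "integrable lborel (\<lambda>t::real. (1 + \<bar>t\<bar>) powr (- 3 / 2))"
proof -
  have "(\<lambda>x::real. x powr (- 3 / 2)) integrable_on {1..}"
    using has_integral_powr_to_inf[of "- 3 / 2" 1] by auto
  then have "(\<lambda>x::real. x powr (- 3 / 2)) absolutely_integrable_on {1..}"
    by (rule nonnegative_absolutely_integrable_1) simp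
  then have *: "integrable lborel (\<lambda>x::real. indicator {1..} x * x powr (- 3 / 2))"
    unfolding set_integrable_def by (subst (asm) integrable_completion) auto
  have "integrable lborel (\<lambda>t::real. indicator {1..} (1 + 1 * t) * (1 + 1 * t) powr (- 3 / 2) +
      indicator {1..} (1 + (- 1) * t) * (1 + (- 1) * t) powr (- 3 / 2))"
    by (intro Bochner_Integration.integrable_add lborel_integrable_real_affine[OF *]) auto
  then show ?thesis
    by (rule Bochner_Integration.integrable_bound) (auto simp: indicator_def abs_if)
qed

section \<open>Nonvanishing of \<open>W\<close> and its reciprocal powers\<close>

lemma W_nonzero:
  assumes "Re s \<ge> 0"
  shows "W s \<noteq> 0"
proof (cases "s = 0")
  case True
  then show ?thesis by (simp add: W_0)
next
  case s: False
  show ?thesis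
  proof (cases "Re s > 0")
    case True
    then show ?thesis using W_eq[OF True] deval_dZ_dMu[OF True] s by auto
  next
    case False
    then have Re: "Re s = 0" and Im: "Im s \<noteq> 0" using assms s by (auto simp: complex_eq_iff)
    define \<tau> where "\<tau> = min 1 \<bar>Im s\<bar>"
    have "0 < \<tau>" "\<tau> \<le> 1" using Im by (auto simp: \<tau>_def)
    \<comment> \<open>On the imaginary axis any admissible \<open>\<delta>\<close> gives a positive
      lower bound; 1/2 is the largest.\<close>
    then obtain c \<kappa> where c: "c > 0" "\<kappa> > 0"
      and low: "\<And>z. \<tau> \<le> \<bar>Im z\<bar> \<Longrightarrow> - \<kappa> * (1 + \<bar>Im z\<bar>) powr (- 5 * (1 / 2)) \<le> Re z \<Longrightarrow> Re z \<le> 1 \<Longrightarrow>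
       c * (1 + \<bar>Im z\<bar>) powr (1 - 4 * (1 / 2)) \<le> norm (W z)"
      by (rule W_lower_bound[of "1 / 2" \<tau>, rotated 2]) auto
    have "c * (1 + \<bar>Im s\<bar>) powr (1 - 4 * (1 / 2)) \<le> norm (W s)"
      using Re c by (intro low) (auto simp: \<tau>_def)
    moreover have "c * (1 + \<bar>Im s\<bar>) powr (1 - 4 * (1 / 2)) > 0" using c by (auto simp: add_pos_nonneg)
    ultimately show ?thesis by auto
  qed
qed

definition invW :: "nat \<Rightarrow> complex \<Rightarrow> complex" where
  "invW j s = 1 / W s ^ j"

text \<open>The transform of the overview without its factor \<open>j!\<close>, with the removable
  singularity at 0 filled in. The \<open>s - 0\<close> is the shape of the quotient in
  \<open>pole_lemma_open\<close>.\<close>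

definition invW_quot :: "nat \<Rightarrow> complex \<Rightarrow> complex" where
  "invW_quot j s = (if s = 0 then deriv (invW j) 0 else (invW j s - invW j 0) / (s - 0))"

definition W_dom :: "complex set" where
  "W_dom = {s. Re s > - 1 / 2} \<inter> W -` (- {0})"

lemma open_W_dom: "open W_dom"
  unfolding W_dom_def
  by (rule continuous_open_preimage[OF holomorphic_on_imp_continuous_on[OF W_holomorphic] open_halfspace_Re_gt]) auto

lemma W_dom_nonneg: "Re s \<ge> 0 \<Longrightarrow> s \<in> W_dom"
  using W_nonzero[of s] by (auto simp: W_dom_def)

lemma invW_holomorphic: "invW j holomorphic_on W_dom"
  unfolding invW_def
  by (intro holomorphic_intros holomorphic_on_subset[OF W_holomorphic]) (auto simp: W_dom_def)

lemma invW_quot_holomorphic: "invW_quot j holomorphic_on W_dom"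
  unfolding invW_quot_def[abs_def] by (rule pole_lemma_open[OF invW_holomorphic open_W_dom])

lemma deriv2_inverse:
  assumes "s \<noteq> 0"
  shows "deriv (deriv (\<lambda>z. 1 / z)) s = 2 / (s::complex) ^ 3"
proof -
  have d1: "deriv (\<lambda>z. 1 / z) z = - 1 / z ^ 2" if "z \<noteq> 0" for z :: complex
    using that by (intro DERIV_imp_deriv) (auto intro!: derivative_eq_intros simp: power2_eq_square divide_simps)
  have "deriv (deriv (\<lambda>z. 1 / z)) s = deriv (\<lambda>z. - 1 / z ^ 2) s"
  proof (rule deriv_cong_ev)
    have "eventually (\<lambda>z. z \<in> - {0::complex}) (nhds s)"
      using assms by (intro eventually_nhds_in_open) auto
    then show "eventually (\<lambda>z. deriv (\<lambda>z. 1 / z) z = - 1 / z ^ 2) (nhds s)"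
      by eventually_elim (use d1 in auto)
  qed auto
  also have "\<dots> = 2 / s ^ 3"
    using assms by (intro DERIV_imp_deriv)
      (auto intro!: derivative_eq_intros simp: power2_eq_square power3_eq_cube divide_simps)
  finally show ?thesis .
qed

text \<open>Near the real axis compactness suffices. At height \<open>T\<close> the function
  \<open>1 / (W^j * z)\<close> has size \<open>T powr (-1 - j * (1 - 4 * \<delta>))\<close> on a
  disc of radius about \<open>T powr (-5 * \<delta>)\<close>, so Cauchy's inequality for the second
  derivative loses only \<open>T powr (10 * \<delta>)\<close>. As \<open>j \<ge> 1\<close>, an
  exponent below \<open>-1\<close> remains for small \<open>\<delta>\<close>.\<close>

lemma deriv2_invW_quot_bound:
  assumes j: "j \<ge> 1"
  shows "\<exists>B. \<forall>s. 0 < Re s \<longrightarrow> Re s \<le> 1 / 2 \<longrightarrow>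
    norm (deriv (deriv (invW_quot j)) s) \<le> B * (1 + \<bar>Im s\<bar>) powr (- 3 / 2)"
proof -
  \<comment> \<open>This choice makes the total loss \<open>4 * j * \<delta> + 10 * \<delta>\<close>
    equal to 1/2, which leaves the exponent \<open>- 1/2 - j \<le> - 3/2\<close>.\<close>
  define \<delta> where "\<delta> = 1 / (8 * real j + 20)"
  have \<delta>: "0 < \<delta>" "\<delta> \<le> 1 / 2" and \<delta>j: "4 * real j * \<delta> + 10 * \<delta> = 1 / 2"
  proof -
    have pos: "8 * real j + 20 > 0" by simp
    show "0 < \<delta>" "\<delta> \<le> 1 / 2" using pos by (auto simp: \<delta>_def field_simps)
    have "4 * real j * \<delta> + 10 * \<delta> = (8 * real j + 20) * \<delta> / 2" by (simp add: algebra_simps)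
    also have "(8 * real j + 20) * \<delta> = 1" using pos unfolding \<delta>_def by simp
    finally show "4 * real j * \<delta> + 10 * \<delta> = 1 / 2" .
  qed
  obtain c \<kappa> where c: "c > 0" and \<kappa>: "\<kappa> > 0" "\<kappa> \<le> \<delta> / 4"
    and low: "\<And>s. 1 \<le> \<bar>Im s\<bar> \<Longrightarrow> - \<kappa> * (1 + \<bar>Im s\<bar>) powr (- 5 * \<delta>) \<le> Re s \<Longrightarrow> Re s \<le> 1 \<Longrightarrow>
       c * (1 + \<bar>Im s\<bar>) powr (1 - 4 * \<delta>) \<le> norm (W s)"
    using W_lower_bound[OF \<delta>, of 1] by auto
  define D where "D = deriv (deriv (invW_quot j))"
  have hD: "D holomorphic_on W_dom"
    unfolding D_def by (intro holomorphic_deriv invW_quot_holomorphic open_W_dom)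
  define Q where "Q = cbox (Complex 0 (- 2)) (Complex (1 / 2) 2)"
  have Q: "s \<in> Q \<longleftrightarrow> 0 \<le> Re s \<and> Re s \<le> 1 / 2 \<and> \<bar>Im s\<bar> \<le> 2" for s
    by (auto simp: Q_def in_cbox_complex_iff)
  have "bounded (D ` Q)"
  proof (rule compact_imp_bounded, rule compact_continuous_image)
    show "continuous_on Q D"
      using holomorphic_on_imp_continuous_on[OF hD] W_dom_nonneg Q by (meson continuous_on_subset subsetI)
    show "compact Q" by (simp add: Q_def)
  qed
  then obtain B1 where B1: "B1 > 0" "\<And>s. s \<in> Q \<Longrightarrow> norm (D s) \<le> B1"
    by (auto simp: bounded_pos)
  \<comment> \<open>On the disc \<open>1 + |Im z| \<ge> T / 2\<close> halves the bound for
    \<open>W\<close> at worst, and \<open>|z| \<ge> T / 4\<close>. In \<open>B2\<close>, the 2 is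
    \<open>fact 2\<close> and \<open>32 = 2^5\<close> bounds
    \<open>2 powr (10 * \<delta>)\<close>.\<close>
  define C where "C = (2 / c) ^ j * 4"
  define B2 where "B2 = 2 * C / \<kappa>\<^sup>2 * 32"
  have large: "norm (D s) \<le> (B2 + 16) * (1 + \<bar>Im s\<bar>) powr (- 3 / 2)"
    if s: "0 < Re s" "Re s \<le> 1 / 2" and t: "\<bar>Im s\<bar> \<ge> 2" for s
  proof -
    define T where "T = 1 + \<bar>Im s\<bar>"
    have T: "T \<ge> 3" using t by (simp add: T_def)
    \<comment> \<open>Points of the disc satisfy \<open>1 + |Im z| \<le> 2 * T\<close>, so with
      \<open>2 * T\<close> here the whole disc lies in the region of the lower bound for
      \<open>W\<close>.\<close>
    define r where "r = \<kappa> * (2 * T) powr (- 5 * \<delta>)"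
    have "(2 * T) powr (- 5 * \<delta>) \<le> (2 * T) powr 0" using T \<delta> by (intro powr_mono) auto
    then have r: "0 < r" "r \<le> \<kappa>" using \<kappa> T by (auto simp: r_def mult_le_cancel_left1)
    have r8: "r \<le> 1 / 8" using r \<kappa> \<delta> by linarith
    define P where "P = (\<lambda>z. invW j z / z)"
    have disc: "z \<in> W_dom - {0} \<and> norm (P z) \<le> C * T powr (- 1 - real j * (1 - 4 * \<delta>))" if z: "z \<in> cball s r" for z
    proof -
      have "norm (z - s) \<le> r" using z by (simp add: dist_norm norm_minus_commute)
      then have "\<bar>Re (z - s)\<bar> \<le> r" "\<bar>Im (z - s)\<bar> \<le> r"
        using abs_Re_le_cmod[of "z - s"] abs_Im_le_cmod[of "z - s"] by linarith+
      then have zr: "- r \<le> Re z" "Re z \<le> 1" "\<bar>Im z\<bar> \<ge> \<bar>Im s\<bar> - 1 / 8" "\<bar>Im z\<bar> \<le> \<bar>Im s\<bar> + 1"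
        using s r8 unfolding minus_complex.sel by arith+
      have Tz: "T / 2 \<le> 1 + \<bar>Im z\<bar>" "1 + \<bar>Im z\<bar> \<le> 2 * T" "T / 4 \<le> \<bar>Im z\<bar>" "1 \<le> \<bar>Im z\<bar>"
        using zr(3,4) t by (simp_all add: T_def)
      have "(2 * T) powr (- 5 * \<delta>) \<le> (1 + \<bar>Im z\<bar>) powr (- 5 * \<delta>)"
        using Tz \<delta> by (intro powr_mono2') auto
      then have "r \<le> \<kappa> * (1 + \<bar>Im z\<bar>) powr (- 5 * \<delta>)"
        unfolding r_def using \<kappa> by (intro mult_left_mono) auto
      then have lw: "c * (1 + \<bar>Im z\<bar>) powr (1 - 4 * \<delta>) \<le> norm (W z)"
        using zr Tz by (intro low) auto
      have e: "0 \<le> 1 - 4 * \<delta>" "1 - 4 * \<delta> \<le> 1" using \<delta> j by (auto simp: \<delta>_def field_simps)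
      have "c / 2 * T powr (1 - 4 * \<delta>) \<le> c * (T / 2) powr (1 - 4 * \<delta>)"
      proof -
        have "2 powr (1 - 4 * \<delta>) \<le> 2 powr (1::real)" using e by (intro powr_mono) auto
        then have "T powr (1 - 4 * \<delta>) / 2 \<le> T powr (1 - 4 * \<delta>) / 2 powr (1 - 4 * \<delta>)"
          by (intro divide_left_mono) auto
        then have "c * (T powr (1 - 4 * \<delta>) / 2) \<le> c * (T powr (1 - 4 * \<delta>) / 2 powr (1 - 4 * \<delta>))"
          using c by (intro mult_left_mono) auto
        then show ?thesis unfolding powr_divide by simp
      qed
      also have "\<dots> \<le> c * (1 + \<bar>Im z\<bar>) powr (1 - 4 * \<delta>)"
        using c Tz e T by (intro mult_left_mono powr_mono2) auto
      also note lw
      finally have lW: "c / 2 * T powr (1 - 4 * \<delta>) \<le> norm (W z)" .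
      have cT: "c / 2 * T powr (1 - 4 * \<delta>) > 0" using c T by simp
      have nz: "norm z \<ge> T / 4" using Tz abs_Im_le_cmod[of z] by linarith
      have "norm (P z) = 1 / (norm (W z) ^ j * norm z)"
        by (simp add: P_def invW_def norm_divide norm_mult norm_power)
      also have "\<dots> \<le> 1 / ((c / 2 * T powr (1 - 4 * \<delta>)) ^ j * (T / 4))"
        using lW cT nz T by (intro divide_left_mono mult_mono power_mono) (auto intro!: mult_pos_pos zero_less_power)
      also have "\<dots> = C * T powr (- 1 - real j * (1 - 4 * \<delta>))"
      proof -
        have "(T powr (1 - 4 * \<delta>)) ^ j = T powr (real j * (1 - 4 * \<delta>))"
          using T by (subst powr_power) auto
        moreover have "T powr (- 1 - real j * (1 - 4 * \<delta>)) = 1 / (T * T powr (real j * (1 - 4 * \<delta>)))"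
          using T by (simp add: powr_diff powr_minus divide_simps)
        ultimately show ?thesis unfolding C_def
          by (simp add: power_mult_distrib power_divide)
      qed
      finally have "norm (P z) \<le> C * T powr (- 1 - real j * (1 - 4 * \<delta>))" .
      moreover have "z \<in> W_dom - {0}"
      proof -
        have "W z \<noteq> 0" using lW cT by auto
        moreover have "z \<noteq> 0" using nz T by auto
        ultimately show ?thesis using zr r8 by (auto simp: W_dom_def)
      qed
      ultimately show ?thesis by blast
    qed
    have hP: "P holomorphic_on W_dom - {0}"
      unfolding P_def by (intro holomorphic_intros holomorphic_on_subset[OF invW_holomorphic]) auto
    have op: "open (W_dom - {0})" using open_W_dom by (rule open_delete)
    have sub: "cball s r \<subseteq> W_dom - {0}" using disc by blast
    have "norm ((deriv ^^ 2) P s) \<le> fact 2 * (C * T powr (- 1 - real j * (1 - 4 * \<delta>))) / r ^ 2"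
    proof (rule Cauchy_inequality)
      show "P holomorphic_on ball s r"
        using hP sub ball_subset_cball holomorphic_on_subset by (metis (no_types) order_trans)
      show "continuous_on (cball s r) P"
        using holomorphic_on_imp_continuous_on[OF hP] sub continuous_on_subset by blast
      show "norm (P z) \<le> C * T powr (- 1 - real j * (1 - 4 * \<delta>))" if "norm (s - z) = r" for z
        using disc[of z] that by (simp add: dist_norm)
    qed (use r in auto)
    also have "fact 2 * (C * T powr (- 1 - real j * (1 - 4 * \<delta>))) / r ^ 2 \<le> B2 * T powr (- 3 / 2)"
    proof -
      have r2: "r ^ 2 = \<kappa>\<^sup>2 * (2 * T) powr (- 10 * \<delta>)"
        unfolding r_def power_mult_distrib using T powr_power[where z = "2 * T" and n = 2 and u = "- 5 * \<delta>"] by simp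
      have "fact 2 * (C * T powr (- 1 - real j * (1 - 4 * \<delta>))) / r ^ 2 =
          2 * C / \<kappa>\<^sup>2 * (2 powr (10 * \<delta>) * (T powr (- 1 - real j * (1 - 4 * \<delta>)) * T powr (10 * \<delta>)))"
        unfolding r2 using T \<kappa> by (simp add: powr_mult powr_minus field_simps)
      also have "T powr (- 1 - real j * (1 - 4 * \<delta>)) * T powr (10 * \<delta>) = T powr (- 1 / 2 - real j)"
      proof -
        have "- 1 - real j * (1 - 4 * \<delta>) + 10 * \<delta> = - 1 / 2 - real j" using \<delta>j by (simp add: algebra_simps)
        then show ?thesis by (simp only: powr_add[symmetric])
      qed
      also have "2 * C / \<kappa>\<^sup>2 * (2 powr (10 * \<delta>) * T powr (- 1 / 2 - real j)) \<le> 2 * C / \<kappa>\<^sup>2 * (32 * T powr (- 3 / 2))"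
      proof (intro mult_left_mono mult_mono)
        have "2 powr (10 * \<delta>) \<le> 2 powr (5::real)" using \<delta> by (intro powr_mono) auto
        then show "2 powr (10 * \<delta>) \<le> (32::real)" by simp
        show "T powr (- 1 / 2 - real j) \<le> T powr (- 3 / 2)" using T j by (intro powr_mono) auto
      qed (use c in \<open>auto simp: C_def\<close>)
      also have "\<dots> = B2 * T powr (- 3 / 2)" by (simp add: B2_def)
      finally show ?thesis .
    qed
    finally have P2: "norm (deriv (deriv P) s) \<le> B2 * T powr (- 3 / 2)"
      by (simp add: numeral_2_eq_2)
    \<comment> \<open>Cauchy's inequality on this disc would bound the second derivative of
      \<open>1 / z\<close> only by about \<open>1 / T\<close>, which is not integrable; hence this
      term is split off and differentiated exactly.\<close>
    have D_eq: "D s = deriv (deriv P) s - 2 / s ^ 3"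
    proof -
      have s0: "s \<in> W_dom - {0}" using disc[of s] r by simp
      have i0: "invW j 0 = 1" by (simp add: invW_def W_0)
      have hi: "(\<lambda>z. 1 / z) holomorphic_on W_dom - {0}" by (intro holomorphic_intros) auto
      have "D s = deriv (deriv (\<lambda>z. P z - 1 / z)) s"
        unfolding D_def
      proof (rule deriv_cong_ev)
        have "eventually (\<lambda>z. z \<in> W_dom - {0}) (nhds s)"
          using op s0 by (intro eventually_nhds_in_open)
        then show "eventually (\<lambda>z. deriv (invW_quot j) z = deriv (\<lambda>z. P z - 1 / z) z) (nhds s)"
        proof eventually_elim
          case (elim z)
          show ?case
          proof (rule deriv_cong_ev)
            have "eventually (\<lambda>z. z \<in> W_dom - {0}) (nhds z)"
              using op elim by (intro eventually_nhds_in_open)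
            then show "eventually (\<lambda>z. invW_quot j z = P z - 1 / z) (nhds z)"
              by eventually_elim (auto simp: invW_quot_def P_def i0 diff_divide_distrib)
          qed simp
        qed
      qed simp
      also have "\<dots> = deriv (\<lambda>z. deriv P z - deriv (\<lambda>z. 1 / z) z) s"
      proof (rule deriv_cong_ev)
        have "eventually (\<lambda>z. z \<in> W_dom - {0}) (nhds s)"
          using op s0 by (intro eventually_nhds_in_open)
        then show "eventually (\<lambda>z. deriv (\<lambda>z. P z - 1 / z) z = deriv P z - deriv (\<lambda>z. 1 / z) z) (nhds s)"
          by eventually_elim (intro deriv_diff holomorphic_on_imp_differentiable_at[OF hP op] holomorphic_on_imp_differentiable_at[OF hi op])
      qed simp
      also have "\<dots> = deriv (deriv P) s - deriv (deriv (\<lambda>z. 1 / z)) s"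
        by (intro deriv_diff holomorphic_on_imp_differentiable_at[OF holomorphic_deriv[OF hP op] op s0]
             holomorphic_on_imp_differentiable_at[OF holomorphic_deriv[OF hi op] op s0])
      finally show ?thesis using s0 by (simp add: deriv2_inverse)
    qed
    have "norm (2 / s ^ 3) \<le> 16 * T powr (- 3 / 2)"
    proof -
      have ns: "norm s \<ge> T / 2" using abs_Im_le_cmod[of s] t by (simp add: T_def)
      have "norm (2 / s ^ 3) = 2 / norm s ^ 3" by (simp add: norm_divide norm_power)
      also have "\<dots> \<le> 2 / (T / 2) ^ 3"
        using ns T by (intro divide_left_mono power_mono mult_pos_pos zero_less_power) auto
      also have "\<dots> = 16 * T powr (- 3)"
        using T powr_realpow[of T 3] by (simp add: powr_minus power_divide divide_simps)
      also have "\<dots> \<le> 16 * T powr (- 3 / 2)" using T by (intro mult_left_mono powr_mono) auto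
      finally show ?thesis .
    qed
    then have "norm (D s) \<le> B2 * T powr (- 3 / 2) + 16 * T powr (- 3 / 2)"
      unfolding D_eq using P2 norm_triangle_ineq4[of "deriv (deriv P) s" "2 / s ^ 3"] by linarith
    then show ?thesis by (simp add: T_def algebra_simps)
  qed
  have small: "norm (D s) \<le> (B1 * 3 powr (3 / 2)) * (1 + \<bar>Im s\<bar>) powr (- 3 / 2)"
    if s: "0 < Re s" "Re s \<le> 1 / 2" and t: "\<bar>Im s\<bar> \<le> 2" for s
  proof -
    have "3 powr (- 3 / 2) \<le> (1 + \<bar>Im s\<bar>) powr (- 3 / 2)"
      using t by (intro powr_mono2') auto
    then have "B1 * 3 powr (3 / 2) * 3 powr (- 3 / 2) \<le> (B1 * 3 powr (3 / 2)) * (1 + \<bar>Im s\<bar>) powr (- 3 / 2)"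
      using B1 by (intro mult_left_mono) auto
    moreover have "B1 * 3 powr (3 / 2) * 3 powr (- 3 / 2) = B1"
      by (simp add: mult.assoc powr_add[symmetric])
    moreover have "norm (D s) \<le> B1" using B1(2)[of s] s t by (simp add: Q)
    ultimately show ?thesis by linarith
  qed
  have "norm (D s) \<le> (B2 + 16 + B1 * 3 powr (3 / 2)) * (1 + \<bar>Im s\<bar>) powr (- 3 / 2)"
    if s: "0 < Re s" "Re s \<le> 1 / 2" for s
  proof -
    have "B2 \<ge> 0" using c by (simp add: B2_def C_def)
    then have "B2 + 16 \<le> B2 + 16 + B1 * 3 powr (3 / 2)" "B1 * 3 powr (3 / 2) \<le> B2 + 16 + B1 * 3 powr (3 / 2)"
      using B1 by auto
    then have le: "(B2 + 16) * (1 + \<bar>Im s\<bar>) powr (- 3 / 2) \<le> (B2 + 16 + B1 * 3 powr (3 / 2)) * (1 + \<bar>Im s\<bar>) powr (- 3 / 2)"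
       "(B1 * 3 powr (3 / 2)) * (1 + \<bar>Im s\<bar>) powr (- 3 / 2) \<le> (B2 + 16 + B1 * 3 powr (3 / 2)) * (1 + \<bar>Im s\<bar>) powr (- 3 / 2)"
      by (auto intro: mult_right_mono)
    show ?thesis
    proof (cases "\<bar>Im s\<bar> \<le> 2")
      case True
      then show ?thesis using small[OF s True] le by linarith
    next
      case False
      then show ?thesis using large[OF s] le by linarith
    qed
  qed
  then show ?thesis unfolding D_def by blast
qed

lemma dbound_dMu_power: "\<sigma> > 0 \<Longrightarrow> dbound (- \<sigma>) (dMu ^ j) ((1 + 1 / \<sigma>) ^ j)"
  by (intro dbound_power dbound_zeta norm_dMu)

text \<open>This is where the strength of the prime number theorem enters.\<close>

lemma logsum_dMu_power:
  assumes j: "j \<ge> 1"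
  shows "\<exists>B. \<forall>u\<ge>0. norm (logsum (dMu ^ j) j u - fact j) \<le> B / (1 + u)\<^sup>2"
proof -
  \<comment> \<open>Subtracting the constant on \<open>u \<ge> 0\<close> removes the pole of the
    transform at \<open>s = 0\<close>.\<close>
  define \<psi> where "\<psi> = (\<lambda>u. logsum (dMu ^ j) j u - fact j * indicator {0..} u)"
  define C where "C = 1 + (fact j :: real)"
  have cont: "continuous_on UNIV (logsum (dMu ^ j) j)" by (rule continuous_logsum[OF j])
  have meas [measurable]: "logsum (dMu ^ j) j \<in> borel_measurable borel"
    by (rule borel_measurable_continuous_onI[OF cont])
  have m\<psi> [measurable]: "\<psi> \<in> borel_measurable borel" unfolding \<psi>_def by measurable
  have z\<psi>: "\<psi> u = 0" if "u < 0" for u using that by (simp add: \<psi>_def logsum_neg)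
  have b\<psi>: "norm (\<psi> u) \<le> C * (1 + u) ^ (j + j)" if "u \<ge> 0" for u
  proof -
    have "norm (\<psi> u) \<le> norm (logsum (dMu ^ j) j u) + norm (fact j * indicator {0..} u :: complex)"
      unfolding \<psi>_def by (rule norm_triangle_ineq4)
    also have "\<dots> \<le> (1 + u) ^ (j + j) + fact j * 1"
      using that by (intro add_mono norm_logsum_power_le norm_dMu) auto
    also have "fact j * 1 \<le> fact j * (1 + u) ^ (j + j)"
      using that by (intro mult_left_mono one_le_power) auto
    finally show ?thesis by (simp add: C_def algebra_simps)
  qed
  have L0: "fact j * invW_quot j s = (LBINT u. \<psi> u * exp (- s * of_real u))" if s: "Re s > 0" for s
  proof -
    have s0: "s \<noteq> 0" using s by auto
    have i1: "integrable lborel (\<lambda>u. logsum (dMu ^ j) j u * exp (- s * of_real u))"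
      by (rule integrable_Laplace[where C = 1 and d = "j + j"])
         (use s norm_logsum_power_le[OF norm_dMu] logsum_neg in auto)
    have i2: "integrable lborel (\<lambda>u. indicator {0..} u * exp (- s * of_real u))"
      by (rule integrable_Laplace[where C = 1 and d = 0]) (use s in auto)
    have "(LBINT u. \<psi> u * exp (- s * of_real u)) =
       (LBINT u. logsum (dMu ^ j) j u * exp (- s * of_real u) - fact j * (indicator {0..} u * exp (- s * of_real u)))"
      by (simp add: \<psi>_def algebra_simps)
    also have "\<dots> = (LBINT u. logsum (dMu ^ j) j u * exp (- s * of_real u)) -
        (LBINT u. fact j * (indicator {0..} u * exp (- s * of_real u)))"
      by (intro Bochner_Integration.integral_diff i1 integrable_mult_right i2)
    also have "\<dots> = deval s (dMu ^ j) * (fact j / s ^ Suc j) - fact j * (1 / s)"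
      unfolding Laplace_logsum[OF dbound_dMu_power[OF s] j s] integral_mult_right_zero Laplace_one[OF s] ..
    also have "deval s (dMu ^ j) = (s / W s) ^ j"
    proof -
      have "W s * deval s dMu = s" using W_eq[OF s] deval_dZ_dMu[OF s] by simp
      then have "deval s dMu = s / W s" using W_nonzero[of s] s by (simp add: field_simps)
      then show ?thesis using deval_power[OF dsummable_dZ_dMu(2)[OF s], of j] by simp
    qed
    also have "(s / W s) ^ j * (fact j / s ^ Suc j) - fact j * (1 / s) = fact j * invW_quot j s"
      using s0 by (simp add: invW_quot_def invW_def W_0 power_divide divide_simps)
         (simp add: algebra_simps)
    finally show ?thesis by simp
  qed
  define R1 where "R1 = deriv (invW_quot j)"
  define R2 where "R2 = deriv R1"
  have h1: "R1 holomorphic_on W_dom" unfolding R1_def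
    by (intro holomorphic_deriv invW_quot_holomorphic open_W_dom)
  have L1: "(LBINT u. (of_real u * \<psi> u) * exp (- s * of_real u)) = - (fact j * R1 s)" if s: "Re s > 0" for s
  proof (rule Laplace_deriv[OF m\<psi> b\<psi> z\<psi> s L0])
    have "(invW_quot j has_field_derivative R1 s) (at s)"
      unfolding R1_def using holomorphic_derivI[OF invW_quot_holomorphic open_W_dom W_dom_nonneg] s by simp
    then show "((\<lambda>s. fact j * invW_quot j s) has_field_derivative fact j * R1 s) (at s)"
      by (rule DERIV_cmult)
  qed
  have L2: "(LBINT u. (of_real u * (of_real u * \<psi> u)) * exp (- s * of_real u)) = fact j * R2 s" if s: "Re s > 0" for s
  proof -
    have "(LBINT u. (of_real u * (of_real u * \<psi> u)) * exp (- s * of_real u)) = - (- (fact j * R2 s))"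
    proof (rule Laplace_deriv[where K = "\<lambda>s. - (fact j * R1 s)" and C = C and d = "Suc (j + j)"])
      show "norm (of_real u * \<psi> u) \<le> C * (1 + u) ^ Suc (j + j)" if "u \<ge> 0" for u
      proof -
        have "norm (of_real u * \<psi> u) \<le> (1 + u) * (C * (1 + u) ^ (j + j))"
          unfolding norm_mult norm_of_real using that b\<psi>[OF that] by (intro mult_mono) auto
        then show ?thesis by (simp add: mult_ac)
      qed
      have "(R1 has_field_derivative R2 s) (at s)"
        unfolding R2_def using holomorphic_derivI[OF h1 open_W_dom W_dom_nonneg] s by simp
      then show "((\<lambda>s. - (fact j * R1 s)) has_field_derivative - (fact j * R2 s)) (at s)"
        by (intro DERIV_minus DERIV_cmult)
    qed (use s z\<psi> L1 in auto)
    then show ?thesis by simp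
  qed
  obtain B where B: "\<And>s. 0 < Re s \<Longrightarrow> Re s \<le> 1 / 2 \<Longrightarrow> norm (R2 s) \<le> B * (1 + \<bar>Im s\<bar>) powr (- 3 / 2)"
    using deriv2_invW_quot_bound[OF j] unfolding R2_def R1_def by blast
  define G where "G = (\<lambda>t::real. fact j * B * (1 + \<bar>t\<bar>) powr (- 3 / 2))"
  have G: "integrable lborel G" unfolding G_def by (intro integrable_mult_right integrable_decay)
  define B' where "B' = (LBINT t. G t) / (2 * pi)"
  \<comment> \<open>The damping factor moves the inversion to the line
    \<open>Re s = \<sigma>\<close>, where the transform formula is available. The bound
    \<open>B'\<close> does not depend on \<open>\<sigma>\<close>, so
    \<open>\<sigma> \<rightarrow> 0\<close> afterwards.\<close>
  have main\<sigma>: "norm (of_real u * (of_real u * \<psi> u) * exp (- of_real \<sigma> * of_real u)) \<le> B'"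
    if \<sigma>: "0 < \<sigma>" "\<sigma> \<le> 1 / 2" for \<sigma> u
    unfolding B'_def
  proof (rule Fourier_pointwise_bound[OF _ _ _ G])
    let ?f = "\<lambda>u. of_real u * (of_real u * \<psi> u) * exp (- of_real \<sigma> * of_real u)"
    \<comment> \<open>\<open>\<psi>\<close> itself jumps at 0, by \<open>- j!\<close>; the factor
      \<open>u^2\<close> removes the jump, and \<open>max 0 u ^ 2\<close> makes this
      visible.\<close>
    show "continuous_on UNIV ?f"
    proof -
      have "?f = (\<lambda>u. (of_real u * of_real u * logsum (dMu ^ j) j u - fact j * of_real (max 0 u ^ 2)) * exp (- of_real \<sigma> * of_real u))"
        by (auto simp: fun_eq_iff \<psi>_def indicator_def max_def power2_eq_square algebra_simps)
      moreover have "continuous_on UNIV \<dots>"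
        by (intro continuous_intros cont)
      ultimately show ?thesis by (simp only:)
    qed
    have b2: "norm (of_real u * (of_real u * \<psi> u)) \<le> C * (1 + u) ^ (j + j + 2)" if "u \<ge> 0" for u
    proof -
      have "norm (of_real u * (of_real u * \<psi> u)) \<le> (1 + u) * ((1 + u) * (C * (1 + u) ^ (j + j)))"
        unfolding norm_mult norm_of_real using that b\<psi>[OF that] by (intro mult_mono) auto
      then show ?thesis by (simp add: mult_ac)
    qed
    show "integrable lborel ?f"
      by (rule integrable_Laplace[OF _ b2]) (use \<sigma> z\<psi> in auto)
    show "norm (?f u) \<le> C * (fact (j + j + 2) / \<sigma> ^ (j + j + 2) * exp \<sigma>)" for u
    proof (cases "u \<ge> 0")
      case True
      have "norm (?f u) \<le> C * (1 + u) ^ (j + j + 2) * exp (- \<sigma> * u)"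
        unfolding norm_mult[of "of_real u * (of_real u * \<psi> u)"]
        using b2[OF True] by (intro mult_mono) (use True in \<open>auto simp: C_def\<close>)
      also have "(1 + u) ^ (j + j + 2) \<le> fact (j + j + 2) / \<sigma> ^ (j + j + 2) * exp (\<sigma> * (1 + u))"
        using True \<sigma> by (intro power_le_exp) auto
      then have "C * (1 + u) ^ (j + j + 2) * exp (- \<sigma> * u) \<le>
          C * (fact (j + j + 2) / \<sigma> ^ (j + j + 2) * exp (\<sigma> * (1 + u))) * exp (- \<sigma> * u)"
        by (intro mult_right_mono mult_left_mono) (auto simp: C_def)
      also have "\<dots> = C * (fact (j + j + 2) / \<sigma> ^ (j + j + 2) * (exp (\<sigma> * (1 + u)) * exp (- \<sigma> * u)))"
        by (simp only: mult.assoc)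
      also have "exp (\<sigma> * (1 + u)) * exp (- \<sigma> * u) = exp \<sigma>"
        unfolding exp_add[symmetric] by (simp add: algebra_simps)
      finally show ?thesis .
    next
      case False
      then show ?thesis using \<sigma> by (simp add: z\<psi> C_def)
    qed
    fix t :: real
    have "(LBINT v. ?f v * exp (- \<i> * of_real (t * v))) =
       (LBINT v. (of_real v * (of_real v * \<psi> v)) * exp (- Complex \<sigma> t * of_real v))"
    proof (rule Bochner_Integration.integral_cong[OF refl])
      fix v :: real
      have "- of_real \<sigma> * of_real v + - \<i> * of_real (t * v) = - Complex \<sigma> t * of_real v"
        by (simp add: Complex_eq algebra_simps)
      then show "?f v * exp (- \<i> * of_real (t * v)) = (of_real v * (of_real v * \<psi> v)) * exp (- Complex \<sigma> t * of_real v)"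
        by (simp only: mult.assoc exp_add[symmetric])
    qed
    also have "\<dots> = fact j * R2 (Complex \<sigma> t)" using \<sigma> by (intro L2) simp
    finally show "norm (LBINT v. ?f v * exp (- \<i> * of_real (t * v))) \<le> G t"
      using B[of "Complex \<sigma> t"] \<sigma> by (simp add: G_def norm_mult mult_left_mono mult.assoc)
  qed
  have main: "u\<^sup>2 * norm (\<psi> u) \<le> B'" for u
  proof -
    have "(\<lambda>n. exp (- (1 / real (n + 2)) * u)) \<longlonglongrightarrow> 1" by real_asymp
    then have lim: "(\<lambda>n. u\<^sup>2 * norm (\<psi> u) * exp (- (1 / real (n + 2)) * u)) \<longlonglongrightarrow> u\<^sup>2 * norm (\<psi> u) * 1"
      by (intro tendsto_intros)
    have "u\<^sup>2 * norm (\<psi> u) * exp (- (1 / real (n + 2)) * u) \<le> B'" for n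
      using main\<sigma>[of "1 / real (n + 2)" u]
      by (simp add: norm_mult power2_eq_square mult.assoc flip: abs_mult)
    then show ?thesis using LIMSEQ_le_const2[OF lim] by simp
  qed
  \<comment> \<open>For \<open>u \<ge> 1\<close> the bound for \<open>u^2 * |\<psi>|\<close>
    applies; below 1 it says nothing useful near 0, and the crude growth bound takes over.\<close>
  have "norm (logsum (dMu ^ j) j u - fact j) \<le> (4 * B' + C * 2 ^ (j + j) * 4) / (1 + u)\<^sup>2" if u: "u \<ge> 0" for u
  proof -
    have B'0: "B' \<ge> 0" using main[of 0] by simp
    have \<psi>u: "logsum (dMu ^ j) j u - fact j = \<psi> u" using u by (simp add: \<psi>_def)
    have "(1 + u)\<^sup>2 * norm (\<psi> u) \<le> 4 * B' + C * 2 ^ (j + j) * 4"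
    proof (cases "u \<ge> 1")
      case True
      have "(1 + u)\<^sup>2 \<le> (2 * u)\<^sup>2" using True by (intro power_mono) auto
      then have "(1 + u)\<^sup>2 * norm (\<psi> u) \<le> 4 * (u\<^sup>2 * norm (\<psi> u))"
        using mult_right_mono[of "(1 + u)\<^sup>2" "(2 * u)\<^sup>2" "norm (\<psi> u)"] by (simp add: power_mult_distrib)
      also have "\<dots> \<le> 4 * B'" using main[of u] by simp
      also have "\<dots> \<le> 4 * B' + C * 2 ^ (j + j) * 4" by (simp add: C_def)
      finally show ?thesis .
    next
      case False
      have "(1 + u)\<^sup>2 \<le> 2\<^sup>2" using False u by (intro power_mono) auto
      moreover have "norm (\<psi> u) \<le> C * 2 ^ (j + j)"
      proof -
        have "(1 + u) ^ (j + j) \<le> 2 ^ (j + j)" using False u by (intro power_mono) auto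
        then have "C * (1 + u) ^ (j + j) \<le> C * 2 ^ (j + j)" by (intro mult_left_mono) (auto simp: C_def)
        then show ?thesis using b\<psi>[OF u] by linarith
      qed
      ultimately have "(1 + u)\<^sup>2 * norm (\<psi> u) \<le> 2\<^sup>2 * (C * 2 ^ (j + j))" by (intro mult_mono) auto
      then show ?thesis using B'0 by simp
    qed
    then show ?thesis unfolding \<psi>u using u by (simp add: pos_le_divide_eq mult.commute)
  qed
  then show ?thesis by blast
qed

section \<open>Convolution, and nonnegative powers of zeta\<close>

lemma logsum_mult:
  "logsum (h * f) m u = (\<Sum>d | 0 < d \<and> real d \<le> exp u. dnth h d * logsum f m (u - ln (real d)))"
proof -
  let ?X = "{n. 0 < n \<and> real n \<le> exp u}"
  let ?t = "\<lambda>a b. dnth h a * (dnth f b * of_real ((u - ln (real a) - ln (real b)) ^ m))"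
  have inner: "{b. 0 < b \<and> real b \<le> exp (u - ln (real a))} = {b. 0 < b \<and> real (a * b) \<le> exp u}" if "a > 0" for a
    using that by (auto simp: exp_diff field_simps)
  have "logsum (h * f) m u = (\<Sum>n\<in>?X. \<Sum>r\<in>factor_pairs n. ?t (fst r) (snd r))"
    unfolding logsum_def dnth_times sum_distrib_right case_prod_beta
  proof (intro sum.cong refl)
    fix n r assume n: "n \<in> ?X" and r: "r \<in> factor_pairs n"
    have "fst r * snd r = n" "n > 0" using n r by (auto simp: factor_pairs_def)
    then have "ln (real n) = ln (real (fst r)) + ln (real (snd r))" by (auto simp: ln_mult)
    then have "u - ln (real n) = u - ln (real (fst r)) - ln (real (snd r))" by simp
    then show "dnth h (fst r) * dnth f (snd r) * of_real ((u - ln (real n)) ^ m) = ?t (fst r) (snd r)"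
      by (simp only: mult.assoc)
  qed
  also have "\<dots> = (\<Sum>(n, r)\<in>(SIGMA n:?X. factor_pairs n). ?t (fst r) (snd r))"
    by (subst sum.Sigma) (auto intro: finite_factor_pairs finite_nat_le_real)
  also have "\<dots> = (\<Sum>(a, b)\<in>(SIGMA a:?X. {b. 0 < b \<and> real (a * b) \<le> exp u}). ?t a b)"
  proof (rule sum.reindex_bij_witness[of _ "\<lambda>r. (fst r * snd r, r)" snd])
    fix x assume "x \<in> (SIGMA n:?X. factor_pairs n)"
    then obtain a b where x: "x = (a * b, (a, b))" and n: "0 < a * b" "real (a * b) \<le> exp u"
      by (cases x) (auto simp: factor_pairs_def)
    have "a * 1 \<le> a * b" using n by (intro mult_left_mono) auto
    then have "real a \<le> real (a * b)" by (simp only: of_nat_le_iff)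
    then have "real a \<le> exp u" using n(2) by linarith
    then show "snd x \<in> (SIGMA a:?X. {b. 0 < b \<and> real (a * b) \<le> exp u})" using n x by auto
  qed (auto simp: factor_pairs_def)
  also have "\<dots> = (\<Sum>a\<in>?X. \<Sum>b | 0 < b \<and> real (a * b) \<le> exp u. ?t a b)"
  proof -
    have "finite {b. 0 < b \<and> real (a * b) \<le> exp u}" if "a > 0" for a
      using inner[OF that] finite_nat_le_real by metis
    then show ?thesis by (subst sum.Sigma) (auto intro: finite_nat_le_real)
  qed
  also have "\<dots> = (\<Sum>a\<in>?X. dnth h a * logsum f m (u - ln (real a)))"
    unfolding logsum_def sum_distrib_left by (intro sum.cong) (auto simp: inner)
  finally show ?thesis .
qed

lemma ln_nat_bounds:
  assumes "0 < n" "real n \<le> exp u"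
  shows "0 \<le> ln (real n)" "ln (real n) \<le> u"
proof -
  show "0 \<le> ln (real n)" using assms by simp
  have "ln (real n) \<le> ln (exp u)" using assms by (subst ln_le_cancel_iff) auto
  then show "ln (real n) \<le> u" by simp
qed

text \<open>Comparison of a decreasing summand with its integral through the antiderivative
  \<open>F\<close>. The error is at most the first term, \<open>g 1 = u^r\<close>.\<close>

lemma sum_log_power:
  fixes u :: real
  assumes u: "u \<ge> 0"
  shows "\<bar>(\<Sum>n | 0 < n \<and> real n \<le> exp u. (u - ln (real n)) ^ r / real n) - u ^ Suc r / real (Suc r)\<bar> \<le> u ^ r"
proof -
  define g where "g = (\<lambda>x. (u - ln x) ^ r / x)"
  define F where "F = (\<lambda>x. - ((u - ln x) ^ Suc r / real (Suc r)))"
  have dF: "(F has_real_derivative g x) (at x)" if "x > 0" for x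
  proof -
    have "((\<lambda>x. u - ln x) has_real_derivative (0 - 1 / x)) (at x)"
      using that by (auto intro!: derivative_eq_intros)
    from DERIV_minus[OF DERIV_cdivide[OF DERIV_power_Suc[OF this, of r], of "real (Suc r)"]]
    have "(F has_real_derivative - ((1 + of_nat r) * ((0 - 1 / x) * (u - ln x) ^ r) / real (Suc r))) (at x)"
      unfolding F_def .
    moreover have "- ((1 + of_nat r) * ((0 - 1 / x) * (u - ln x) ^ r) / real (Suc r)) = g x"
      by (simp add: g_def)
    ultimately show ?thesis by (simp only:)
  qed
  have mono: "g y \<le> g x" if "1 \<le> x" "x \<le> y" "y \<le> exp u" for x y
  proof -
    have "ln x \<le> ln y" "ln y \<le> u"
      using that by (auto simp: ln_le_cancel_iff) (metis exp_gt_zero le_less_trans ln_exp ln_le_cancel_iff order_trans not_one_le_zero less_le_trans zero_less_one)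
    then have "(u - ln y) ^ r \<le> (u - ln x) ^ r" "0 \<le> (u - ln y) ^ r" by (auto intro: power_mono)
    then show ?thesis unfolding g_def using that by (intro frac_le) auto
  qed
  have FF: "g y * (y - x) \<le> F y - F x \<and> F y - F x \<le> g x * (y - x)" if "1 \<le> x" "x \<le> y" "y \<le> exp u" for x y
  proof (cases "x = y")
    case False
    then have "x < y" using that by simp
    moreover have "(F has_real_derivative g w) (at w)" if "x \<le> w" "w \<le> y" for w
      using \<open>1 \<le> x\<close> that by (intro dF) auto
    ultimately obtain z where z: "x < z" "z < y" "F y - F x = (y - x) * g z"
      using MVT2[of x y F g] by blast
    have "g y \<le> g z" "g z \<le> g x" using z that by (auto intro!: mono)
    then show ?thesis using z by (auto simp: mult.commute intro!: mult_left_mono)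
  qed auto
  define N where "N = nat \<lfloor>exp u\<rfloor>"
  have eN: "{n. 0 < n \<and> real n \<le> exp u} = {1..N}" by (simp add: N_def nat_le_real_eq)
  have N: "N \<ge> 1" "real N \<le> exp u" "exp u \<le> real N + 1"
  proof -
    have "1 \<in> {n. 0 < n \<and> real n \<le> exp u}" using u by simp
    then show "N \<ge> 1" unfolding eN by simp
    then have "N \<in> {n. 0 < n \<and> real n \<le> exp u}" unfolding eN by simp
    then show "real N \<le> exp u" by simp
    show "exp u \<le> real N + 1" unfolding N_def by linarith
  qed
  have up: "(\<Sum>n=1..M. g (real n)) \<le> g 1 + (F (real M) - F 1)" if "1 \<le> M" "M \<le> N" for M
    using that
  proof (induction M rule: dec_induct)
    case (step M)
    have "real (Suc M) \<le> exp u" using step N by (metis of_nat_le_iff order_trans)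
    then have "g (real (Suc M)) * (real (Suc M) - real M) \<le> F (real (Suc M)) - F (real M)"
      using step FF[of "real M" "real (Suc M)"] by auto
    then show ?case using step by simp
  qed auto
  have lo: "F (real M) - F 1 \<le> (\<Sum>n=1..<M. g (real n))" if "1 \<le> M" "M \<le> N" for M
    using that
  proof (induction M rule: dec_induct)
    case (step M)
    have "real (Suc M) \<le> exp u" using step N by (metis of_nat_le_iff order_trans)
    then have "F (real (Suc M)) - F (real M) \<le> g (real M) * (real (Suc M) - real M)"
      using step FF[of "real M" "real (Suc M)"] by auto
    then show ?case using step by simp
  qed auto
  have g1: "g 1 = u ^ r" and F1: "F 1 = - (u ^ Suc r / real (Suc r))" and Fe: "F (exp u) = 0"
    by (auto simp: g_def F_def)
  have lnN: "ln (real N) \<le> u" using ln_nat_bounds(2)[of N u] N by simp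
  have FN: "F (real N) \<le> 0" unfolding F_def using lnN by simp
  have gN: "g (real N) \<ge> 0" unfolding g_def using lnN by simp
  \<comment> \<open>The leftover interval from \<open>N\<close> to \<open>exp u\<close> has length
    at most 1, so the last term of the sum covers it.\<close>
  have "F (exp u) - F (real N) \<le> g (real N) * (exp u - real N)"
    using FF[of "real N" "exp u"] N by simp
  also have "\<dots> \<le> g (real N) * 1" using gN N by (intro mult_left_mono) auto
  finally have gF: "- F (real N) \<le> g (real N)" using Fe by simp
  have "(\<Sum>n=1..N. g (real n)) = (\<Sum>n=1..<N. g (real n)) + g (real N)"
    using N by (cases N) (auto simp: atLeastLessThanSuc_atLeastAtMost)
  then have "u ^ Suc r / real (Suc r) \<le> (\<Sum>n=1..N. g (real n))"
    using lo[of N] N gF F1 by simp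
  moreover have "(\<Sum>n=1..N. g (real n)) \<le> u ^ r + u ^ Suc r / real (Suc r)"
    using up[of N] N FN F1 g1 by simp
  ultimately show ?thesis unfolding eN g_def by (simp add: abs_le_iff)
qed

lemma harm_sum_le:
  assumes "u \<ge> 0"
  shows "(\<Sum>n | 0 < n \<and> real n \<le> exp u. 1 / real n) \<le> 1 + u"
proof -
  have "(\<Sum>n | 0 < n \<and> real n \<le> exp u. (u - ln (real n)) ^ 0 / real n) \<le> u ^ 0 + u ^ Suc 0 / real (Suc 0)"
    using sum_log_power[OF assms, of 0] by linarith
  then show ?thesis by (simp only: power_0) simp
qed

lemma logsum_1:
  assumes "u \<ge> 0"
  shows "logsum 1 m u = of_real (u ^ m)"
proof -
  have "logsum 1 m u = (\<Sum>n\<in>{1}. of_real ((u - ln (real n)) ^ m))"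
    unfolding logsum_def
    by (rule sum.mono_neutral_cong_right) (use assms in \<open>auto simp: dnth_one finite_nat_le_real\<close>)
  then show ?thesis by simp
qed

text \<open>The factor \<open>real (k + m)\<close> serves the case \<open>k + m = 0\<close>, where
  the exponent \<open>k + m - 1\<close> is truncated to 0: the sum is then exact, and the bound must
  be 0 for the induction step to multiply by \<open>1 + u\<close> correctly.\<close>

lemma logsum_dZ_power:
  "\<exists>B\<ge>0. \<forall>u\<ge>0. norm (logsum (dZ ^ k) m u - of_real (fact m / fact (k + m) * u ^ (k + m)))
     \<le> B * real (k + m) * (1 + u) ^ (k + m - 1)"
proof (induction k)
  case 0
  then show ?case by (intro exI[of _ 0]) (auto simp: logsum_1)
next
  case (Suc k)
  define r where "r = k + m"
  define a where "a = (fact m / fact r :: real)"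
  have a: "a \<ge> 0" by (simp add: a_def)
  from Suc obtain B where B: "B \<ge> 0" and
    IH: "\<And>u. u \<ge> 0 \<Longrightarrow> norm (logsum (dZ ^ k) m u - of_real (a * u ^ r)) \<le> B * real r * (1 + u) ^ (r - 1)"
    by (auto simp: r_def a_def)
  have "norm (logsum (dZ ^ Suc k) m u - of_real (fact m / fact (Suc k + m) * u ^ (Suc k + m)))
     \<le> (B + a) * real (Suc k + m) * (1 + u) ^ (Suc k + m - 1)" if u: "u \<ge> 0" for u
  proof -
    let ?X = "{n. 0 < n \<and> real n \<le> exp u}"
    have fin: "finite ?X" by (rule finite_nat_le_real)
    have a': "fact m / fact (Suc k + m) * u ^ (Suc k + m) = a * (u ^ Suc r / real (Suc r))"
      by (simp add: a_def r_def divide_simps)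
    have e1: "logsum (dZ ^ Suc k) m u = (\<Sum>n\<in>?X. 1 / of_nat n * logsum (dZ ^ k) m (u - ln (real n)))"
      unfolding power_Suc logsum_mult dnth_dZ ..
    have e2: "complex_of_real (a * (\<Sum>n\<in>?X. (u - ln (real n)) ^ r / real n)) =
        (\<Sum>n\<in>?X. 1 / of_nat n * of_real (a * (u - ln (real n)) ^ r))"
      by (simp add: sum_distrib_left)
    have "norm (logsum (dZ ^ Suc k) m u - of_real (a * (\<Sum>n\<in>?X. (u - ln (real n)) ^ r / real n)))
      \<le> (\<Sum>n\<in>?X. 1 / real n * (B * real r * (1 + u) ^ (r - 1)))"
      unfolding e1 e2 sum_subtractf[symmetric] right_diff_distrib[symmetric]
    proof (rule sum_norm_le)
      fix n assume n: "n \<in> ?X"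
      have ln: "0 \<le> ln (real n)" "ln (real n) \<le> u" using ln_nat_bounds[of n u] n by auto
      have "norm (logsum (dZ ^ k) m (u - ln (real n)) - of_real (a * (u - ln (real n)) ^ r)) \<le>
         B * real r * (1 + (u - ln (real n))) ^ (r - 1)"
        using ln by (intro IH) auto
      also have "\<dots> \<le> B * real r * (1 + u) ^ (r - 1)"
        using ln B by (intro mult_left_mono power_mono) auto
      finally have "norm (logsum (dZ ^ k) m (u - ln (real n)) - of_real (a * (u - ln (real n)) ^ r)) \<le> B * real r * (1 + u) ^ (r - 1)" .
      then show "norm (1 / of_nat n * (logsum (dZ ^ k) m (u - ln (real n)) - of_real (a * (u - ln (real n)) ^ r))) \<le>
         1 / real n * (B * real r * (1 + u) ^ (r - 1))"
        unfolding norm_mult norm_divide norm_one norm_of_nat by (rule mult_left_mono) simp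
    qed
    also have "\<dots> = (\<Sum>n\<in>?X. 1 / real n) * (B * real r * (1 + u) ^ (r - 1))"
      by (simp add: sum_distrib_right)
    also have "\<dots> \<le> (1 + u) * (B * real r * (1 + u) ^ (r - 1))"
      using harm_sum_le[OF u] B u by (intro mult_right_mono) auto
    also have "\<dots> = B * real r * (1 + u) ^ r"
      by (cases r) auto
    finally have 1: "norm (logsum (dZ ^ Suc k) m u - of_real (a * (\<Sum>n\<in>?X. (u - ln (real n)) ^ r / real n))) \<le> B * real r * (1 + u) ^ r" .
    have "norm (complex_of_real (a * (\<Sum>n\<in>?X. (u - ln (real n)) ^ r / real n)) - of_real (a * (u ^ Suc r / real (Suc r)))) =
       a * \<bar>(\<Sum>n\<in>?X. (u - ln (real n)) ^ r / real n) - u ^ Suc r / real (Suc r)\<bar>"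
      unfolding of_real_diff[symmetric] right_diff_distrib[symmetric] norm_of_real abs_mult using a by simp
    also have "\<dots> \<le> a * u ^ r" using a sum_log_power[OF u, of r] by (intro mult_left_mono)
    also have "\<dots> \<le> a * (1 + u) ^ r" using a u by (intro mult_left_mono power_mono) auto
    finally have 2: "norm (complex_of_real (a * (\<Sum>n\<in>?X. (u - ln (real n)) ^ r / real n)) - of_real (a * (u ^ Suc r / real (Suc r)))) \<le> a * (1 + u) ^ r" .
    have "norm (logsum (dZ ^ Suc k) m u - of_real (a * (u ^ Suc r / real (Suc r)))) \<le> B * real r * (1 + u) ^ r + a * (1 + u) ^ r"
      using norm_triangle_mono[OF 1 2] by simp
    also have "\<dots> = (B * real r + a) * (1 + u) ^ r" by (simp add: algebra_simps)
    also have "\<dots> \<le> (B + a) * real (Suc k + m) * (1 + u) ^ r"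
    proof (rule mult_right_mono)
      have "(B + a) * real (Suc k + m) = B * real r + a + (B + a * real r)" by (simp add: r_def algebra_simps)
      then show "B * real r + a \<le> (B + a) * real (Suc k + m)" using a B by simp
    qed (use u in auto)
    finally show ?thesis unfolding a' by (simp add: r_def)
  qed
  then show ?case using B a by (intro exI[of _ "B + a"]) auto
qed

section \<open>Raising the power of the logarithm by integration\<close>

lemma DERIV_Suc_power_shift:
  fixes c v :: real
  shows "((\<lambda>v. (v + c) ^ Suc n) has_real_derivative real (Suc n) * (v + c) ^ n) (at v)"
proof -
  have "((\<lambda>v. v + c) has_real_derivative 1) (at v)" by (auto intro!: derivative_eq_intros)
  from DERIV_power_Suc[OF this, of n] show ?thesis by (simp del: power_Suc)
qed

text \<open>The only delicate point is the corner \<open>v = L\<close>, which the exponent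
  \<open>Suc m \<ge> 2\<close> flattens.\<close>

lemma DERIV_max_power:
  fixes L v :: real
  assumes m: "m \<ge> 1"
  shows "((\<lambda>v. max 0 (v - L) ^ Suc m) has_real_derivative real (Suc m) * max 0 (v - L) ^ m) (at v)"
proof -
  consider "v < L" | "v > L" | "v = L" by linarith
  then show ?thesis
  proof cases
    case 1
    have "((\<lambda>v. 0) has_real_derivative 0) (at v)" by simp
    then have "((\<lambda>v. max 0 (v - L) ^ Suc m) has_real_derivative 0) (at v)"
      by (rule has_field_derivative_transform_within_open[of _ _ _ "{..<L}"]) (use 1 in auto)
    then show ?thesis using 1 m by (cases m) auto
  next
    case 2
    have "((\<lambda>v. (v - L) ^ Suc m) has_real_derivative real (Suc m) * (v - L) ^ m) (at v)"
      using DERIV_Suc_power_shift[of "- L" m v] by (simp del: power_Suc of_nat_Suc)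
    then have "((\<lambda>v. max 0 (v - L) ^ Suc m) has_real_derivative real (Suc m) * (v - L) ^ m) (at v)"
      by (rule has_field_derivative_transform_within_open[of _ _ _ "{L<..}"]) (use 2 in auto)
    then show ?thesis using 2 by simp
  next
    case 3
    have "((\<lambda>h. max 0 h ^ Suc m / h) \<longlongrightarrow> 0) (at (0::real))"
    proof (rule Lim_null_comparison)
      show "eventually (\<lambda>h. norm (max 0 h ^ Suc m / h) \<le> \<bar>h\<bar> ^ m) (at (0::real))"
        by (intro always_eventually) (auto simp: max_def power_abs)
      have "((\<lambda>h::real. \<bar>h\<bar> ^ m) \<longlongrightarrow> \<bar>0\<bar> ^ m) (at 0)" by (intro tendsto_intros)
      then show "((\<lambda>h::real. \<bar>h\<bar> ^ m) \<longlongrightarrow> 0) (at 0)" using m by (cases m) auto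
    qed
    then show ?thesis using 3 m by (cases m) (auto simp: DERIV_def)
  qed
qed

lemma logsum_has_vector_derivative:
  assumes m: "m \<ge> 1"
  shows "(logsum f (Suc m) has_vector_derivative of_nat (Suc m) * logsum f m v) (at v)"
proof -
  define N where "N = nat \<lceil>exp (v + 1)\<rceil>"
  have N: "exp w \<le> real N" if "w \<in> {..<v + 1}" for w
  proof -
    have "exp w \<le> exp (v + 1)" using that by simp
    also have "\<dots> \<le> real N" unfolding N_def by linarith
    finally show ?thesis .
  qed
  have "((\<lambda>w. \<Sum>n=1..N. dnth f n * of_real (max 0 (w - ln (real n)) ^ Suc m)) has_vector_derivative
      (\<Sum>n=1..N. dnth f n * of_real (real (Suc m) * max 0 (v - ln (real n)) ^ m))) (at v)"
    by (intro has_vector_derivative_sum has_vector_derivative_mult_right has_vector_derivative_of_real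
          DERIV_max_power[OF m])
  moreover have "(\<Sum>n=1..N. dnth f n * of_real (real (Suc m) * max 0 (v - ln (real n)) ^ m)) = of_nat (Suc m) * logsum f m v"
    using logsum_eq_max[OF m N, of v f] by (simp add: sum_distrib_left mult_ac del: of_nat_Suc)
  ultimately have "((\<lambda>w. \<Sum>n=1..N. dnth f n * of_real (max 0 (w - ln (real n)) ^ Suc m)) has_vector_derivative
      of_nat (Suc m) * logsum f m v) (at v)" by (simp only:)
  then show ?thesis
  proof (rule has_vector_derivative_transform_within_open[of _ _ _ "{..<v + 1}"])
    show "(\<Sum>n=1..N. dnth f n * of_real (max 0 (w - ln (real n)) ^ Suc m)) = logsum f (Suc m) w" if "w \<in> {..<v + 1}" for w
      using logsum_eq_max[OF _ N[OF that], of "Suc m" f] by simp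
  qed auto
qed

text \<open>Sum and main term both vanish at \<open>u = 0\<close>, the sum because only
  \<open>n = 1\<close> occurs there with \<open>log 1 = 0\<close>. Their derivatives are
  \<open>Suc m\<close> times those for \<open>m\<close>, so an error \<open>\<Phi>'\<close>
  integrates to \<open>\<Phi>\<close>.\<close>

lemma logsum_integrate:
  fixes a :: real and \<Phi> \<Phi>' :: "real \<Rightarrow> real"
  assumes m: "m \<ge> 1" and b: "\<And>v. v \<ge> 0 \<Longrightarrow> norm (logsum f m v - of_real (a * v ^ d)) \<le> \<Phi>' v"
    and \<Phi>: "\<And>v. v \<ge> 0 \<Longrightarrow> (\<Phi> has_real_derivative \<Phi>' v) (at v)" and u: "u \<ge> 0"
  shows "norm (logsum f (Suc m) u - of_real (real (Suc m) * a / real (Suc d) * u ^ Suc d)) \<le> real (Suc m) * (\<Phi> u - \<Phi> 0)"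
proof (cases "u = 0")
  case True
  have "logsum f (Suc m) 0 = 0"
    unfolding logsum_def by (intro sum.neutral) (auto dest: ln_nat_bounds)
  then show ?thesis using True by simp
next
  case False
  define H where "H = (\<lambda>v. logsum f (Suc m) v - of_real (real (Suc m) * a / real (Suc d) * v ^ Suc d))"
  define H' where "H' = (\<lambda>v. of_nat (Suc m) * logsum f m v - of_real (real (Suc m) * a * v ^ d))"
  have dH: "(H has_vector_derivative H' v) (at v)" for v
  proof -
    have "((\<lambda>v. real (Suc m) * a / real (Suc d) * v ^ Suc d) has_real_derivative
        real (Suc m) * a / real (Suc d) * (real (Suc d) * v ^ d)) (at v)"
      using DERIV_pow[of "Suc d" v] by (intro DERIV_cmult) simp
    moreover have "real (Suc m) * a / real (Suc d) * (real (Suc d) * v ^ d) = real (Suc m) * a * v ^ d" by simp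
    ultimately have "((\<lambda>v. real (Suc m) * a / real (Suc d) * v ^ Suc d) has_real_derivative real (Suc m) * a * v ^ d) (at v)"
      by (simp only:)
    then show ?thesis unfolding H_def H'_def
      by (intro has_vector_derivative_diff logsum_has_vector_derivative[OF m] has_vector_derivative_of_real)
         (simp only: has_real_derivative_iff_has_vector_derivative)
  qed
  have "norm (H u - H 0) \<le> real (Suc m) * \<Phi> u - real (Suc m) * \<Phi> 0"
  proof (rule differentiable_bound_general[where f' = H' and \<phi>' = "\<lambda>v. real (Suc m) * \<Phi>' v"])
    show "0 < u" using False u by simp
    show "continuous_on {0..u} H"
      using dH by (meson continuous_at_imp_continuous_on has_vector_derivative_continuous)
    have "continuous_on {0..u} \<Phi>"
      using DERIV_isCont[OF \<Phi>] by (intro continuous_at_imp_continuous_on) simp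
    then show "continuous_on {0..u} (\<lambda>v. real (Suc m) * \<Phi> v)" by (intro continuous_intros)
    fix v assume v: "0 < v" "v < u"
    show "(H has_vector_derivative H' v) (at v)" by (rule dH)
    show "((\<lambda>v. real (Suc m) * \<Phi> v) has_vector_derivative real (Suc m) * \<Phi>' v) (at v)"
      using DERIV_cmult[OF \<Phi>[of v], of "real (Suc m)"] v
      by (simp only: has_real_derivative_iff_has_vector_derivative)
    have "H' v = of_nat (Suc m) * (logsum f m v - of_real (a * v ^ d))"
      by (simp add: H'_def algebra_simps)
    then have "norm (H' v) = real (Suc m) * norm (logsum f m v - of_real (a * v ^ d))"
      by (simp only: norm_mult norm_of_nat)
    then show "norm (H' v) \<le> real (Suc m) * \<Phi>' v" using b[of v] v by (simp add: mult_left_mono)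
  qed
  moreover have "H 0 = 0"
  proof -
    have "logsum f (Suc m) 0 = 0"
      unfolding logsum_def by (intro sum.neutral) (auto dest: ln_nat_bounds)
    then show ?thesis by (simp add: H_def)
  qed
  ultimately show ?thesis by (simp add: H_def right_diff_distrib)
qed

text \<open>The base case integrates \<open>B / (1 + v)^2\<close> and stays bounded, which is what
  the quadratic decay was proved for. From then on each integration raises the degrees of the main
  term and of the error by one.\<close>

lemma logsum_dMu_power_Suc:
  assumes j: "j \<ge> 1"
  shows "\<exists>B\<ge>0. \<forall>u\<ge>0. norm (logsum (dMu ^ j) (j + Suc d) u - of_real (fact (j + Suc d) / fact (Suc d) * u ^ Suc d))
     \<le> B * (1 + u) ^ d"
proof (induction d)
  case 0
  obtain B where B: "\<And>u. u \<ge> 0 \<Longrightarrow> norm (logsum (dMu ^ j) j u - fact j) \<le> B / (1 + u)\<^sup>2"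
    using logsum_dMu_power[OF j] by blast
  have B0: "B \<ge> 0" using order_trans[OF norm_ge_zero B[of 0]] by simp
  have "norm (logsum (dMu ^ j) (Suc j) u - of_real (real (Suc j) * fact j / real (Suc 0) * u ^ Suc 0))
      \<le> real (Suc j) * (- B / (1 + u) - (- B / (1 + 0)))" if u: "u \<ge> 0" for u
  proof (rule logsum_integrate[OF j _ _ u])
    fix v :: real assume v: "v \<ge> 0"
    show "norm (logsum (dMu ^ j) j v - of_real (fact j * v ^ 0)) \<le> B / (1 + v)\<^sup>2"
      using B[OF v] by simp
    show "((\<lambda>v. - B / (1 + v)) has_real_derivative B / (1 + v)\<^sup>2) (at v)"
      using v by (auto intro!: derivative_eq_intros simp: power2_eq_square)
  qed
  moreover have "real (Suc j) * (- B / (1 + u) - (- B / (1 + 0))) \<le> real (Suc j) * B" if "u \<ge> 0" for u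
    using that B0 by (intro mult_left_mono) auto
  ultimately have "norm (logsum (dMu ^ j) (j + Suc 0) u - of_real (fact (j + Suc 0) / fact (Suc 0) * u ^ Suc 0))
     \<le> real (Suc j) * B * (1 + u) ^ 0" if "u \<ge> 0" for u
    using that by (fastforce simp: algebra_simps)
  then show ?case using B0 by (intro exI[of _ "real (Suc j) * B"]) auto
next
  case (Suc d)
  define m where "m = j + Suc d"
  from Suc obtain B where B0: "B \<ge> 0" and
    B: "\<And>u. u \<ge> 0 \<Longrightarrow> norm (logsum (dMu ^ j) m u - of_real (fact m / fact (Suc d) * u ^ Suc d)) \<le> B * (1 + u) ^ d"
    by (auto simp: m_def)
  have I: "norm (logsum (dMu ^ j) (Suc m) u - of_real (real (Suc m) * (fact m / fact (Suc d)) / real (Suc (Suc d)) * u ^ Suc (Suc d)))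
      \<le> real (Suc m) * (B * (1 + u) ^ Suc d / real (Suc d) - B * (1 + 0) ^ Suc d / real (Suc d))" if u: "u \<ge> 0" for u
  proof (rule logsum_integrate[OF _ B _ u])
    fix v :: real assume v: "v \<ge> 0"
    have "((\<lambda>v. B * (1 + v) ^ Suc d / real (Suc d)) has_real_derivative B * (real (Suc d) * (1 + v) ^ d) / real (Suc d)) (at v)"
      using DERIV_Suc_power_shift[of 1 d v]
      by (intro DERIV_cdivide DERIV_cmult) (simp del: power_Suc of_nat_Suc add: add.commute)
    then show "((\<lambda>v. B * (1 + v) ^ Suc d / real (Suc d)) has_real_derivative B * (1 + v) ^ d) (at v)" by simp
  qed (use j in \<open>auto simp: m_def\<close>)
  have J: "real (Suc m) * (B * (1 + u) ^ Suc d / real (Suc d) - B * (1 + 0) ^ Suc d / real (Suc d)) \<le> real (Suc m) * B * (1 + u) ^ Suc d" if u: "u \<ge> 0" for u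
  proof -
    have "B * (1 + u) ^ Suc d / real (Suc d) \<le> B * (1 + u) ^ Suc d"
      using B0 u divide_left_mono[of 1 "real (Suc d)" "B * (1 + u) ^ Suc d"] by simp
    moreover have "B * (1 + 0) ^ Suc d / real (Suc d) \<ge> 0" using B0 by simp
    ultimately have "B * (1 + u) ^ Suc d / real (Suc d) - B * (1 + 0) ^ Suc d / real (Suc d) \<le> B * (1 + u) ^ Suc d" by linarith
    then have "real (Suc m) * (B * (1 + u) ^ Suc d / real (Suc d) - B * (1 + 0) ^ Suc d / real (Suc d)) \<le> real (Suc m) * (B * (1 + u) ^ Suc d)"
      by (rule mult_left_mono) simp
    then show ?thesis by (simp only: mult.assoc)
  qed
  have K: "real (Suc m) * (fact m / fact (Suc d)) / real (Suc (Suc d)) = fact (Suc m) / (fact (Suc (Suc d)) :: real)"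
    by (simp add: divide_simps)
  have "norm (logsum (dMu ^ j) (Suc m) u - of_real (fact (Suc m) / fact (Suc (Suc d)) * u ^ Suc (Suc d)))
      \<le> real (Suc m) * B * (1 + u) ^ Suc d" if "u \<ge> 0" for u
    using order_trans[OF I[OF that] J[OF that]] unfolding K .
  then show ?case using B0 by (intro exI[of _ "real (Suc m) * B"]) (auto simp: m_def)
qed

definition dtau :: "int \<Rightarrow> dser" where
  "dtau k = (if k \<ge> 0 then dZ ^ nat k else dMu ^ nat (- k))"

text \<open>Writing the error as a quotient lets \<open>k + m = 0\<close> mean
  \<open>1 / (1 + u)\<close>, where a natural exponent \<open>k + m - 1\<close> would be
  truncated.\<close>

lemma logsum_dtau:
  assumes m: "int m \<ge> - k"
  shows "\<exists>B\<ge>0. \<forall>u\<ge>0. norm (logsum (dtau k) m u - of_real (fact m / fact (nat (k + int m)) * u ^ nat (k + int m)))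
     \<le> B * ((1 + u) ^ nat (k + int m) / (1 + u))"
proof (cases "k \<ge> 0")
  case True
  define k' where "k' = nat k"
  have k: "k = int k'" using True by (simp add: k'_def)
  have r: "nat (k + int m) = k' + m" by (simp add: k)
  obtain B where B: "B \<ge> 0" "\<And>u. u \<ge> 0 \<Longrightarrow> norm (logsum (dZ ^ k') m u - of_real (fact m / fact (k' + m) * u ^ (k' + m)))
     \<le> B * real (k' + m) * (1 + u) ^ (k' + m - 1)"
    using logsum_dZ_power[of k' m] by blast
  have "B * real (k' + m) * (1 + u) ^ (k' + m - 1) \<le> B * real (k' + m) * ((1 + u) ^ (k' + m) / (1 + u))" if "u \<ge> 0" for u
    using that by (cases "k' + m") auto
  then have "norm (logsum (dZ ^ k') m u - of_real (fact m / fact (k' + m) * u ^ (k' + m)))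
     \<le> B * real (k' + m) * ((1 + u) ^ (k' + m) / (1 + u))" if "u \<ge> 0" for u
    using B(2) that order_trans by blast
  moreover have "dtau k = dZ ^ k'" by (simp add: dtau_def k)
  ultimately show ?thesis using B(1) unfolding r
    by (intro exI[of _ "B * real (k' + m)"]) (simp only:, simp)
next
  case False
  define j where "j = nat (- k)"
  have k: "k = - int j" and j: "j \<ge> 1" using False by (auto simp: j_def)
  have "m \<ge> j" using m by (simp add: k)
  then obtain d where d: "m = j + d" using le_Suc_ex by blast
  have r: "nat (k + int m) = d" by (simp add: k d)
  have tau: "dtau k = dMu ^ j" using False by (simp add: dtau_def j_def)
  show ?thesis
  proof (cases d)
    case 0
    obtain B where B: "\<And>u. u \<ge> 0 \<Longrightarrow> norm (logsum (dMu ^ j) j u - fact j) \<le> B / (1 + u)\<^sup>2"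
      using logsum_dMu_power[OF j] by blast
    have B0: "B \<ge> 0" using order_trans[OF norm_ge_zero B[of 0]] by simp
    have "norm (logsum (dMu ^ j) j u - fact j) \<le> B * (1 / (1 + u))" if "u \<ge> 0" for u
    proof -
      have "B / (1 + u)\<^sup>2 \<le> B / (1 + u)"
        using that B0 by (intro divide_left_mono) (auto simp: power2_eq_square)
      then show ?thesis using B[OF that] by simp
    qed
    then show ?thesis using B0 unfolding r tau by (intro exI[of _ B]) (simp add: d 0)
  next
    case (Suc d')
    obtain B where B: "B \<ge> 0" "\<And>u. u \<ge> 0 \<Longrightarrow> norm (logsum (dMu ^ j) (j + Suc d') u - of_real (fact (j + Suc d') / fact (Suc d') * u ^ Suc d'))
     \<le> B * (1 + u) ^ d'"
      using logsum_dMu_power_Suc[OF j, of d'] by blast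
    have key: "norm (logsum (dMu ^ j) (j + Suc d') u - of_real (fact (j + Suc d') / fact (Suc d') * u ^ Suc d'))
       \<le> B * ((1 + u) ^ Suc d' / (1 + u))" if "u \<ge> 0" for u
    proof -
      have "B * (1 + u) ^ d' = B * ((1 + u) ^ Suc d' / (1 + u))" using that by simp
      then show ?thesis using B(2)[OF that] by (simp only:)
    qed
    have r': "nat (k + int (j + Suc d')) = Suc d'" by (simp add: k)
    show ?thesis unfolding tau d Suc r'
      by (intro exI[of _ B] conjI allI impI) (fact B(1), rule key)
  qed
qed

section \<open>Factoring out a power of zeta\<close>

text \<open>The Euler factor at \<open>p\<close> of the \<open>-k\<close>-th power of zeta.\<close>

definition local_factor :: "int \<Rightarrow> nat \<Rightarrow> dser" where
  "local_factor k p = (if k \<ge> 0 then (1 + dmonom (- 1 / of_nat p) p) ^ nat k else dG p ^ nat (- k))"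

definition euler_part :: "(nat \<Rightarrow> complex) \<Rightarrow> nat set \<Rightarrow> dser" where
  "euler_part a S = (\<Prod>p\<in>S. 1 + dmonom (a p) p)"

text \<open>The Dirichlet series of \<open>g\<close> divided by the \<open>k\<close>-th power of zeta, restricted to the primes in \<open>S\<close>:
  on \<open>n \<le> P\<close> the convolution of \<open>dtau k\<close> with it gives back \<open>g\<close> as soon as \<open>S\<close> contains all primes up to \<open>P\<close>.\<close>

definition quotient_part :: "int \<Rightarrow> (nat \<Rightarrow> complex) \<Rightarrow> nat set \<Rightarrow> dser" where
  "quotient_part k a S = (\<Prod>p\<in>S. (1 + dmonom (a p) p) * local_factor k p)"

lemma dtau_quotient_part:
  "eq_upto P (dtau k * quotient_part k a (primes_upto P)) (euler_part a (primes_upto P))"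
proof -
  let ?S = "primes_upto P"
  have q: "quotient_part k a ?S = euler_part a ?S * (\<Prod>p\<in>?S. local_factor k p)"
    by (simp add: quotient_part_def euler_part_def prod.distrib)
  have "eq_upto P (dtau k * (\<Prod>p\<in>?S. local_factor k p)) 1"
  proof (cases "k \<ge> 0")
    case True
    have "dtau k * (\<Prod>p\<in>?S. local_factor k p) = (dZ * mu_part ?S) ^ nat k"
      using True by (simp add: dtau_def local_factor_def mu_part_def prod_power_distrib power_mult_distrib)
    then show ?thesis using eq_upto_power[OF dZ_mu_part_eq_upto[of P], of "nat k"] by simp
  next
    case False
    have inv: "mu_part ?S * (\<Prod>p\<in>?S. dG p) = 1"
      unfolding mu_part_def prod.distrib[symmetric]
    proof (rule prod.neutral, safe)
      fix p :: nat assume p: "prime p"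
      show "(1 + dmonom (- 1 / of_nat p) p) * dG p = 1"
        using dG_inverse[OF p] by (simp only: mult.commute)
    qed
    have "eq_upto P (dMu * (\<Prod>p\<in>?S. dG p)) (mu_part ?S * (\<Prod>p\<in>?S. dG p))"
      by (intro eq_upto_mult dMu_eq_upto eq_upto_refl)
    then have "eq_upto P ((dMu * (\<Prod>p\<in>?S. dG p)) ^ nat (- k)) (1 ^ nat (- k))"
      unfolding inv by (rule eq_upto_power)
    then show ?thesis using False
      by (simp add: dtau_def local_factor_def prod_power_distrib power_mult_distrib)
  qed
  then have "eq_upto P (euler_part a ?S * (dtau k * (\<Prod>p\<in>?S. local_factor k p))) (euler_part a ?S * 1)"
    by (intro eq_upto_mult eq_upto_refl)
  then show ?thesis unfolding q by (simp add: mult_ac)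
qed

lemma multiplicative_prod_primes:
  assumes g: "multiplicative g" and "finite A" "\<And>p. p \<in> A \<Longrightarrow> prime p"
  shows "g (\<Prod>p\<in>A. p) = (\<Prod>p\<in>A. g p)"
  using assms(2,3)
proof (induction A rule: finite_induct)
  case empty
  then show ?case using g by (simp add: multiplicative_def)
next
  case (insert p A)
  have "p > 0" "(\<Prod>p\<in>A. p) > 0" using insert.prems by (auto intro!: prod_pos simp: prime_gt_0_nat)
  moreover have "coprime p (\<Prod>p\<in>A. p)"
    using insert by (intro prod_coprime_right primes_coprime) auto
  ultimately have "g (p * (\<Prod>p\<in>A. p)) = g p * g (\<Prod>p\<in>A. p)"
    using g by (simp add: multiplicative_def)
  then show ?case using insert by simp
qed

text \<open>Putting 0 at the primes dividing \<open>q\<close> encodes coprimality with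
  \<open>q\<close>, and the squarefree support is what makes the Euler factors linear.\<close>

lemma dnth_euler_part:
  assumes g: "multiplicative g" "supported_on_squarefree g" and n: "0 < n" "n \<le> P"
  shows "dnth (euler_part (\<lambda>p. if p dvd q then 0 else g p) (primes_upto P)) n = (if coprime n q then g n else 0)"
proof -
  let ?a = "\<lambda>p. if p dvd q then 0 else g p"
  have eq: "dnth (euler_part ?a (primes_upto P)) n = (if squarefree n then \<Prod>p\<in>prime_factors n. ?a p else 0)"
    unfolding euler_part_def using prime_factors_le[OF n(2)]
    by (subst dnth_prod_linear) auto
  show ?thesis
  proof (cases "squarefree n")
    case False
    then show ?thesis using g n by (simp add: eq supported_on_squarefree_def)
  next
    case True
    show ?thesis
    proof (cases "coprime n q")
      case cop: True
      have "(\<Prod>p\<in>prime_factors n. ?a p) = (\<Prod>p\<in>prime_factors n. g p)"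
      proof (rule prod.cong[OF refl])
        fix p assume "p \<in> prime_factors n"
        then have "p dvd n" "prime p" by auto
        then have "\<not> p dvd q" using cop by (meson coprime_common_divisor not_prime_unit)
        then show "?a p = g p" by simp
      qed
      also have "\<dots> = g (\<Prod>p\<in>prime_factors n. p)"
        by (rule multiplicative_prod_primes[OF g(1), symmetric]) auto
      finally show ?thesis using True cop by (simp add: eq squarefree_prod_prime_factors)
    next
      case False
      then obtain p where "prime p" "p dvd n" "p dvd q"
        using coprime_iff_gcd_eq_1 prime_factor_nat[of "gcd n q"] by (metis gcd_greatest_iff)
      then have "p \<in> prime_factors n" "?a p = 0" using n by (auto simp: prime_factors_dvd)
      then have "(\<Prod>p\<in>prime_factors n. ?a p) = 0" by (intro prod_zero bexI[of _ p]) auto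
      then show ?thesis using True False by (simp add: eq)
    qed
  qed
qed

text \<open>Only \<open>n \<le> x \<le> P\<close> enter, so the truncated factorization of the
  series is exact here.\<close>

lemma log_sum_eq:
  assumes g: "multiplicative g" "supported_on_squarefree g" and x: "x \<ge> 1" "x \<le> real P"
  shows "log_sum g x m q = (\<Sum>d | 0 < d \<and> real d \<le> x.
     dnth (quotient_part k (\<lambda>p. if p dvd q then 0 else g p) (primes_upto P)) d * logsum (dtau k) m (ln x - ln (real d)))"
proof -
  let ?h = "quotient_part k (\<lambda>p. if p dvd q then 0 else g p) (primes_upto P)"
  have ex: "exp (ln x) = x" using x by simp
  have le: "n \<le> P" if "real n \<le> x" for n using that x by (metis of_nat_le_iff order_trans)
  have "logsum (?h * dtau k) m (ln x) = (\<Sum>n | 0 < n \<and> real n \<le> x. (if coprime n q then g n else 0) * of_real ((ln x - ln (real n)) ^ m))"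
    unfolding logsum_def ex
  proof (intro sum.cong refl)
    fix n assume n: "n \<in> {n. 0 < n \<and> real n \<le> x}"
    then have "dnth (?h * dtau k) n = dnth (euler_part (\<lambda>p. if p dvd q then 0 else g p) (primes_upto P)) n"
      using dtau_quotient_part[of P k "\<lambda>p. if p dvd q then 0 else g p"] le
      by (simp add: eq_upto_def mult.commute)
    also have "\<dots> = (if coprime n q then g n else 0)"
      using n le by (intro dnth_euler_part g) auto
    finally show "dnth (?h * dtau k) n * of_real ((ln x - ln (real n)) ^ m) =
      (if coprime n q then g n else 0) * of_real ((ln x - ln (real n)) ^ m)" by simp
  qed
  also have "\<dots> = log_sum g x m q"
    unfolding log_sum_def
  proof (rule sum.mono_neutral_cong_right)
    fix n assume "n \<in> {n. 0 < n \<and> real n \<le> x \<and> coprime n q}"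
    then show "(if coprime n q then g n else 0) * of_real ((ln x - ln (real n)) ^ m) = g n * of_real (ln (x / real n) ^ m)"
      using x by (simp add: ln_div)
  qed (auto simp: finite_nat_le_real)
  finally show ?thesis using logsum_mult[of ?h "dtau k" m "ln x"] by (simp add: ex)
qed

section \<open>Size of the local factors\<close>

lemma dmonom_add: "dmonom c p + dmonom d p = dmonom (c + d) p"
  by (rule dser_eqI) (simp add: dnth_dmonom)

lemma dbound_of_nat: "dbound w (of_nat j) (real j)"
proof (induction j)
  case 0
  show ?case by (simp add: dbound_def)
next
  case (Suc j)
  then show ?case using dbound_add[OF dbound_1 Suc] by simp
qed

lemma dbound_uminus: "dbound w f B \<Longrightarrow> dbound w (- f) B"
  by (simp add: dbound_def)

text \<open>A rational bound for \<open>1 / sqrt 2\<close>; the geometric series with ratio 3/4 has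
  the sum 4 of \<open>dbound_dG\<close>.\<close>

lemma powr_le_three_quarters:
  assumes "p \<ge> 2" "w \<le> 1 / 2"
  shows "real p powr (w - 1) \<le> 3 / 4"
proof -
  have "real p powr (w - 1) \<le> 2 powr (w - 1)" using assms by (intro powr_mono2') auto
  also have "\<dots> \<le> 2 powr (- 1 / 2)" using assms by (intro powr_mono) auto
  also have "\<dots> = 1 / sqrt 2" by (simp add: powr_minus_divide powr_half_sqrt)
  also have "\<dots> \<le> 3 / 4"
  proof -
    have "4 / 3 \<le> sqrt (2::real)" by (intro real_le_rsqrt) (simp add: power2_eq_square)
    then show ?thesis by (simp add: field_simps)
  qed
  finally show ?thesis .
qed

lemma dbound_dG:
  assumes p: "prime p" and w: "w \<le> 1 / 2"
  shows "dbound w (dG p) 4"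
  unfolding dbound_def
proof
  fix N
  define v where "v = real p powr (w - 1)"
  have p2: "p \<ge> 2" using p by (rule prime_ge_2_nat)
  have v: "0 \<le> v" "v \<le> 3 / 4" using powr_le_three_quarters[OF p2 w] by (auto simp: v_def)
  let ?X = "{n\<in>{1..N}. \<exists>i. n = p ^ i}"
  have pw: "1 / real (p ^ i) * real (p ^ i) powr w = v ^ i" for i
  proof -
    have "1 / real (p ^ i) * real (p ^ i) powr w = real (p ^ i) powr (w - 1)"
      using p2 by (simp add: powr_diff)
    also have "\<dots> = v ^ i" using p2 by (simp add: v_def powr_power powr_powr powr_realpow[symmetric] mult.commute)
    finally show ?thesis .
  qed
  have "(\<Sum>n=1..N. norm (dnth (dG p) n) * real n powr w) = (\<Sum>n\<in>?X. 1 / real n * real n powr w)"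
    by (rule sum.mono_neutral_cong_right) (auto simp: dnth_dG norm_divide)
  also have "\<dots> \<le> (\<Sum>n\<in>(\<lambda>i. p ^ i) ` {..N}. 1 / real n * real n powr w)"
  proof (rule sum_mono2)
    show "?X \<subseteq> (\<lambda>i. p ^ i) ` {..N}"
    proof
      fix n assume "n \<in> ?X"
      then obtain i where i: "n = p ^ i" "n \<le> N" by auto
      have "i < 2 ^ i" by (rule less_exp)
      also have "\<dots> \<le> p ^ i" using p2 by (intro power_mono) auto
      finally show "n \<in> (\<lambda>i. p ^ i) ` {..N}" using i by auto
    qed
  qed auto
  also have "\<dots> = (\<Sum>i\<le>N. v ^ i)"
  proof (subst sum.reindex)
    show "inj_on (\<lambda>i. p ^ i) {..N}" using p2 by (auto simp: inj_on_def)
  qed (simp only: o_def pw)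
  also have "\<dots> \<le> (\<Sum>i. v ^ i)"
    using v by (intro sum_le_suminf summable_geometric) auto
  also have "\<dots> = 1 / (1 - v)" using v by (intro suminf_geometric) auto
  also have "\<dots> \<le> 4" using v by (simp add: divide_le_eq)
  finally show "(\<Sum>n=1..N. norm (dnth (dG p) n) * real n powr w) \<le> 4" .
qed

text \<open>A Taylor expansion to second order with a remainder bounded in terms of \<open>j\<close>
  alone. The sign \<open>\<epsilon> = -1\<close> is for the powers of \<open>1 - 1 / p\<close>, and
  \<open>\<epsilon> = 1\<close> for those of the geometric series, so both signs of \<open>k\<close>
  are covered; the 4 is the bound for \<open>dG\<close>.\<close>

lemma power_expansion:
  "\<exists>c\<ge>0. \<forall>w u V E \<epsilon>. dbound w u 1 \<longrightarrow> dbound w V 4 \<longrightarrow> \<epsilon> \<in> {1, - 1} \<longrightarrow> E = 1 + \<epsilon> * u + u * u * V \<longrightarrow>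
     (\<exists>V'. E ^ j = 1 + of_nat j * \<epsilon> * u + u * u * V' \<and> dbound w V' c)"
proof (induction j)
  case 0
  have "dbound w 0 0" for w by (simp add: dbound_def)
  then show ?case by (intro exI[of _ 0]) (auto intro!: exI[of _ 0])
next
  case (Suc j)
  then obtain c where c: "c \<ge> 0" and IH: "\<And>w u V E \<epsilon>. dbound w u 1 \<Longrightarrow> dbound w V 4 \<Longrightarrow> \<epsilon> \<in> {1, - 1} \<Longrightarrow>
     E = 1 + \<epsilon> * u + u * u * V \<Longrightarrow> \<exists>V'. E ^ j = 1 + of_nat j * \<epsilon> * u + u * u * V' \<and> dbound w V' c"
    by blast
  \<comment> \<open>The shape copies that of \<open>V''\<close> below, with each piece replaced by
    its bound: 1 for \<open>u\<close> and \<open>\<epsilon>\<close>, 4 for \<open>V\<close> and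
    \<open>c\<close> for \<open>V'\<close>.\<close>
  define c' where "c' = real j + 4 * (1 + real j * 1 * 1) + c * (1 + 1 * 1 + 1 * 1 * 4)"
  have "\<exists>V'. E ^ Suc j = 1 + of_nat (Suc j) * \<epsilon> * u + u * u * V' \<and> dbound w V' c'"
    if h: "dbound w u 1" "dbound w V 4" "\<epsilon> \<in> {1, - 1}" and E: "E = 1 + \<epsilon> * u + u * u * V" for w u V E \<epsilon>
  proof -
    obtain V' where V': "E ^ j = 1 + of_nat j * \<epsilon> * u + u * u * V'" "dbound w V' c"
      using IH[OF h E] by blast
    have \<epsilon>: "dbound w \<epsilon> 1" using h(3) dbound_1[of w] dbound_uminus[OF dbound_1[of w]] by auto
    have \<epsilon>\<epsilon>: "\<epsilon> * \<epsilon> = 1" using h(3) by auto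
    define V'' where "V'' = of_nat j + V * (1 + of_nat j * \<epsilon> * u) + V' * (1 + \<epsilon> * u + u * u * V)"
    have "E ^ Suc j = (1 + \<epsilon> * u + u * u * V) * (1 + of_nat j * \<epsilon> * u + u * u * V')"
      using V'(1) E by simp
    also have "\<dots> = 1 + of_nat (Suc j) * \<epsilon> * u + u * u * (of_nat j * (\<epsilon> * \<epsilon>) + V * (1 + of_nat j * \<epsilon> * u) + V' * (1 + \<epsilon> * u + u * u * V))"
      by (simp add: algebra_simps)
    finally have "E ^ Suc j = 1 + of_nat (Suc j) * \<epsilon> * u + u * u * V''"
      by (simp add: \<epsilon>\<epsilon> V''_def)
    moreover have "dbound w V'' c'"
      unfolding V''_def c'_def
      by (intro dbound_add dbound_mult dbound_of_nat dbound_1 h \<epsilon> V')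
    ultimately show ?thesis by blast
  qed
  moreover have "c' \<ge> 0" using c by (simp add: c'_def)
  ultimately show ?case by blast
qed

text \<open>The linear coefficient \<open>- k / p\<close> is there to cancel the main part
  \<open>k / p\<close> of \<open>g p\<close>. The constant is uniform in \<open>p\<close> and in the
  weight \<open>w\<close>, as Rankin's trick demands.\<close>

lemma local_factor_expansion:
  "\<exists>c\<ge>0. \<forall>p w. prime p \<longrightarrow> w \<le> 1 / 2 \<longrightarrow>
     (\<exists>V. local_factor k p = 1 + dmonom (- of_int k / of_nat p) p + dmonom (1 / of_nat p) p * dmonom (1 / of_nat p) p * V \<and> dbound w V c)"
proof -
  obtain c where c: "c \<ge> 0" and ex: "\<And>w u V E \<epsilon>. dbound w u 1 \<Longrightarrow> dbound w V 4 \<Longrightarrow> \<epsilon> \<in> {1, - 1} \<Longrightarrow>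
     E = 1 + \<epsilon> * u + u * u * V \<Longrightarrow> \<exists>V'. E ^ nat \<bar>k\<bar> = 1 + of_nat (nat \<bar>k\<bar>) * \<epsilon> * u + u * u * V' \<and> dbound w V' c"
    using power_expansion[of "nat \<bar>k\<bar>"] by blast
  have "\<exists>V. local_factor k p = 1 + dmonom (- of_int k / of_nat p) p + dmonom (1 / of_nat p) p * dmonom (1 / of_nat p) p * V \<and> dbound w V c"
    if p: "prime p" and w: "w \<le> 1 / 2" for p w
  proof -
    let ?u = "dmonom (1 / of_nat p) p"
    have p0: "p > 0" using p prime_gt_0_nat by blast
    have mu: "dmonom (- 1 / of_nat p) p = - ?u" by (rule dser_eqI) (simp add: dnth_dmonom)
    have nat_mult: "of_nat j * dmonom x p = dmonom (of_nat j * x) p" for j x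
    proof (induction j)
      case 0
      show ?case by (rule dser_eqI) (simp add: dnth_dmonom)
    next
      case (Suc j)
      then show ?case by (simp add: ring_distribs dmonom_add)
    qed
    have u: "dbound w ?u 1"
    proof (rule dbound_mono[OF dbound_dmonom[OF p0]])
      have "norm (1 / of_nat p :: complex) * real p powr w = real p powr (w - 1)"
        using p0 by (simp add: norm_divide powr_diff)
      also have "\<dots> \<le> 1" using powr_le_three_quarters[OF prime_ge_2_nat[OF p] w] by simp
      finally show "norm (1 / of_nat p :: complex) * real p powr w \<le> 1" .
    qed
    show ?thesis
    proof (cases "k \<ge> 0")
      case True
      have "dbound w 0 4" by (simp add: dbound_def)
      from ex[OF u this, of "- 1" "1 + dmonom (- 1 / of_nat p) p"]
      obtain V where "(1 + dmonom (- 1 / of_nat p) p) ^ nat \<bar>k\<bar> = 1 + of_nat (nat \<bar>k\<bar>) * (- 1) * ?u + ?u * ?u * V" "dbound w V c"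
        unfolding mu by auto
      moreover have "of_nat (nat \<bar>k\<bar>) * (- 1) * ?u = dmonom (- of_int k / of_nat p) p"
        using True nat_mult[of "nat \<bar>k\<bar>" "- 1 / of_nat p"] unfolding mu by simp
      ultimately show ?thesis using True by (auto simp: local_factor_def)
    next
      case False
      \<comment> \<open>The recursion \<open>dG = 1 + u * dG\<close> of the geometric series,
        unrolled twice.\<close>
      have G: "dG p = 1 + 1 * ?u + ?u * ?u * dG p"
      proof -
        have "dG p - ?u * dG p = 1" using dG_inverse[OF p] unfolding mu by (simp add: algebra_simps)
        then have 1: "dG p = 1 + ?u * dG p" by (simp add: algebra_simps)
        have "dG p = 1 + ?u * (1 + ?u * dG p)" using 1 by simp
        then show ?thesis by (simp add: algebra_simps)
      qed
      from ex[OF u dbound_dG[OF p w] _ G]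
      obtain V where "dG p ^ nat \<bar>k\<bar> = 1 + of_nat (nat \<bar>k\<bar>) * 1 * ?u + ?u * ?u * V" "dbound w V c"
        by auto
      moreover have "of_nat (nat \<bar>k\<bar>) * 1 * ?u = dmonom (- of_int k / of_nat p) p"
        using False nat_mult[of "nat \<bar>k\<bar>" "1 / of_nat p"] by simp
      ultimately show ?thesis using False by (auto simp: local_factor_def)
    qed
  qed
  then show ?thesis using c by blast
qed

text \<open>The linear terms merge into the single monomial with coefficient
  \<open>a - k / p\<close>. Every other product contains at least two factors of size
  \<open>v = p powr (w - 1)\<close>, and further ones are absorbed by
  \<open>v \<le> 1\<close>.\<close>

lemma dbound_local:
  fixes A' :: real
  assumes "A' \<ge> 0"
  shows "\<exists>C\<ge>0. \<forall>p w a. prime p \<longrightarrow> w \<le> 1 / 2 \<longrightarrow> norm a \<le> A' / real p \<longrightarrow>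
     dbound w ((1 + dmonom a p) * local_factor k p)
       (1 + norm (a - of_int k / of_nat p) * real p powr w + C * real p powr (2 * w - 2))"
proof -
  obtain c where c: "c \<ge> 0" and ex: "\<And>p w. prime p \<Longrightarrow> w \<le> 1 / 2 \<Longrightarrow>
     \<exists>V. local_factor k p = 1 + dmonom (- of_int k / of_nat p) p + dmonom (1 / of_nat p) p * dmonom (1 / of_nat p) p * V \<and> dbound w V c"
    using local_factor_expansion[of k] by blast
  define K where "K = \<bar>real_of_int k\<bar>"
  define C where "C = A' * K + c + A' * c"
  have "dbound w ((1 + dmonom a p) * local_factor k p)
       (1 + norm (a - of_int k / of_nat p) * real p powr w + C * real p powr (2 * w - 2))"
    if p: "prime p" and w: "w \<le> 1 / 2" and a: "norm a \<le> A' / real p" for p w a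
  proof -
    obtain V where V: "local_factor k p = 1 + dmonom (- of_int k / of_nat p) p + dmonom (1 / of_nat p) p * dmonom (1 / of_nat p) p * V"
      and Vc: "dbound w V c" using ex[OF p w] by blast
    let ?X = "dmonom a p" and ?u = "dmonom (1 / of_nat p) p" and ?k = "dmonom (- of_int k / of_nat p) p"
    have p0: "p > 0" using p prime_gt_0_nat by blast
    define v where "v = real p powr (w - 1)"
    have v: "0 \<le> v" "v \<le> 1" using powr_le_three_quarters[OF prime_ge_2_nat[OF p] w] by (auto simp: v_def)
    have vp: "x / real p * real p powr w = x * v" for x
      using p0 by (simp add: v_def powr_diff)
    have u: "dbound w ?u v"
      by (rule dbound_mono[OF dbound_dmonom[OF p0]]) (use vp[of 1] in \<open>simp add: norm_divide\<close>)
    have k: "dbound w ?k (K * v)"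
      by (rule dbound_mono[OF dbound_dmonom[OF p0]]) (use vp[of K] in \<open>simp add: norm_divide K_def\<close>)
    have X: "dbound w ?X (A' * v)"
    proof (rule dbound_mono[OF dbound_dmonom[OF p0]])
      have "norm a * real p powr w \<le> A' / real p * real p powr w" using a by (intro mult_right_mono) auto
      then show "norm a * real p powr w \<le> A' * v" using vp[of A'] by simp
    qed
    have "(1 + ?X) * local_factor k p = (1 + (?X + ?k)) + (?X * ?k + ?u * ?u * V + ?X * (?u * ?u * V))"
      unfolding V by (simp add: algebra_simps)
    also have "?X + ?k = dmonom (a - of_int k / of_nat p) p" by (simp add: dmonom_add)
    finally have eq: "(1 + ?X) * local_factor k p =
      (1 + dmonom (a - of_int k / of_nat p) p) + (?X * ?k + ?u * ?u * V + ?X * (?u * ?u * V))" .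
    have "dbound w ((1 + dmonom (a - of_int k / of_nat p) p) + (?X * ?k + ?u * ?u * V + ?X * (?u * ?u * V)))
      ((1 + norm (a - of_int k / of_nat p) * real p powr w) + (A' * v * (K * v) + v * v * c + A' * v * (v * v * c)))"
      by (intro dbound_add dbound_mult dbound_1 dbound_dmonom p0 u k X Vc)
    moreover have "A' * v * (K * v) + v * v * c + A' * v * (v * v * c) \<le> C * (v * v)"
    proof -
      have "A' * v * (v * v * c) = (A' * c * (v * v)) * v" by simp
      also have "\<dots> \<le> (A' * c * (v * v)) * 1" using v assms c by (intro mult_left_mono) auto
      finally show ?thesis by (simp add: C_def algebra_simps)
    qed
    moreover have "v * v = real p powr (2 * w - 2)"
      unfolding v_def powr_add[symmetric] by simp
    ultimately show ?thesis unfolding eq by (auto elim!: dbound_mono)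
  qed
  moreover have "C \<ge> 0" using assms c by (simp add: C_def K_def)
  ultimately show ?thesis by blast
qed

section \<open>The value of the quotient at 0\<close>

lemma deval_quotient_part:
  assumes "\<And>p. p \<in> S \<Longrightarrow> prime p"
  shows "dsummable 0 (quotient_part k a S)"
    and "deval 0 (quotient_part k a S) = (\<Prod>p\<in>S. (1 + a p) * of_real ((1 - 1 / real p) powi k))"
proof -
  have lin: "dsummable 0 (1 + dmonom c p)" "deval 0 (1 + dmonom c p) = 1 + c" if "p > 0" for c p
    using deval_add[OF deval_one(2) deval_dmonom(2)[OF that], of 0 c] that
    by (simp_all add: deval_one deval_dmonom)
  have loc: "dsummable 0 (local_factor k p) \<and> deval 0 (local_factor k p) = of_real ((1 - 1 / real p) powi k)" if p: "prime p" for p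
  proof (cases "k \<ge> 0")
    case True
    then show ?thesis
      using deval_power[OF lin(1)[of p "- 1 / of_nat p"], of "nat k"] lin(2)[of p "- 1 / of_nat p"] prime_gt_0_nat[OF p]
      by (simp add: local_factor_def power_int_def)
  next
    case False
    have p1: "real p > 1" "p > 0" using prime_gt_1_nat[OF p] by auto
    have sG: "dsummable 0 (dG p)" using dbound_dG[OF p, of 0] by (intro dbound_imp_dsummable) simp
    have "deval 0 (dG p) * deval 0 (1 + dmonom (- 1 / of_nat p) p) = 1"
      using deval_mult(2)[OF sG lin(1)[OF p1(2), of "- 1 / of_nat p"]]
      by (simp add: dG_inverse[OF p, simplified] deval_one)
    then have "deval 0 (dG p) * of_real (1 - 1 / real p) = 1"
      using lin(2)[OF p1(2), of "- 1 / of_nat p"] by simp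
    moreover have "complex_of_real (1 - 1 / real p) \<noteq> 0" using p1 by simp
    ultimately have "deval 0 (dG p) = inverse (of_real (1 - 1 / real p))"
      by (metis inverse_unique mult.commute)
    then show ?thesis
      using deval_power[OF sG, of "nat (- k)"] False
      by (simp add: local_factor_def power_int_def power_inverse)
  qed
  have each: "dsummable 0 ((1 + dmonom (a p) p) * local_factor k p)"
    "deval 0 ((1 + dmonom (a p) p) * local_factor k p) = (1 + a p) * of_real ((1 - 1 / real p) powi k)" if "p \<in> S" for p
    using deval_mult[OF lin(1)[of p "a p"], of "local_factor k p"] loc[OF assms[OF that]] lin(2)[of p "a p"]
      prime_gt_0_nat[OF assms[OF that]] by auto
  show "dsummable 0 (quotient_part k a S)"
    unfolding quotient_part_def by (rule deval_prod[THEN conjunct1, OF each(1)])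
  show "deval 0 (quotient_part k a S) = (\<Prod>p\<in>S. (1 + a p) * of_real ((1 - 1 / real p) powi k))"
    unfolding quotient_part_def
    by (rule trans[OF deval_prod[THEN conjunct2, OF each(1)] prod.cong[OF refl each(2)]])
qed

section \<open>Uniformity in the modulus\<close>

text \<open>The sieved series \<open>dZ * mu_part S\<close> at \<open>\<sigma>\<close> has
  nonnegative terms and still contains \<open>n = 1\<close>, so its value is at least 1. It factors
  into zeta, at most \<open>1 + 1 / \<sigma>\<close>, and the product.\<close>

lemma prod_one_minus_prime_powr_ge:
  assumes S: "finite S" "\<And>p. p \<in> S \<Longrightarrow> prime p" and \<sigma>: "\<sigma> > 0"
  shows "1 \<le> (1 + 1 / \<sigma>) * (\<Prod>p\<in>S. 1 - real p powr (- 1 - \<sigma>))"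
proof -
  let ?s = "complex_of_real \<sigma>"
  have sm: "dsummable ?s (mu_part S)" and ev: "deval ?s (mu_part S) = (\<Prod>p\<in>S. 1 - of_nat p powr (- 1 - ?s))"
    using deval_mu_part[OF S(2), of S ?s] by auto
  have sZ: "dsummable ?s dZ" using dsummable_dZ_dMu[of ?s] \<sigma> by simp
  note prod = deval_mult[OF sZ sm]
  have "1 \<le> Re (deval ?s (dZ * mu_part S))"
  proof (rule LIMSEQ_le_const[OF tendsto_Re[OF deval_partial_sums[OF prod(1)]]], intro exI[of _ 1] allI impI)
    fix N :: nat assume N: "N \<ge> 1"
    have nth: "Re (dnth (dZ * mu_part S) n * of_nat n powr - ?s) = (if \<forall>p\<in>S. \<not> p dvd n then real n powr (- 1 - \<sigma>) else 0)" if n: "n > 0" for n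
    proof -
      have "(of_nat n :: complex) powr - ?s = of_real (real n powr (- \<sigma>))"
        by (simp add: powr_of_real[symmetric])
      moreover have "real n powr (- \<sigma>) / real n = real n powr (- 1 - \<sigma>)"
        using n by (simp add: powr_diff powr_minus field_simps)
      ultimately show ?thesis
        using dnth_dZ_mu_part[OF S, of n] by (auto simp: Re_divide_of_nat)
    qed
    have "\<forall>p\<in>S. \<not> p dvd 1" using S(2) by (metis not_prime_1 nat_dvd_1_iff_1)
    then have "(1::real) \<le> (\<Sum>n\<in>{1}. Re (dnth (dZ * mu_part S) n * of_nat n powr - ?s))"
      using nth[of 1] by simp
    also have "\<dots> \<le> (\<Sum>n=1..N. Re (dnth (dZ * mu_part S) n * of_nat n powr - ?s))"
      using N nth by (intro sum_mono2) auto
    finally show "1 \<le> Re (\<Sum>n=1..N. dnth (dZ * mu_part S) n * of_nat n powr - ?s)" by simp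
  qed
  also have "\<dots> \<le> norm (deval ?s (dZ * mu_part S))" by (rule complex_Re_le_cmod)
  also have "\<dots> = norm (deval ?s dZ) * norm (deval ?s (mu_part S))" by (simp add: prod norm_mult)
  also have "norm (deval ?s (mu_part S)) = (\<Prod>p\<in>S. 1 - real p powr (- 1 - \<sigma>))"
  proof -
    have "deval ?s (mu_part S) = of_real (\<Prod>p\<in>S. 1 - real p powr (- 1 - \<sigma>))"
      unfolding ev by (simp add: powr_of_real[symmetric])
    moreover have "(\<Prod>p\<in>S. 1 - real p powr (- 1 - \<sigma>)) \<ge> 0"
    proof (rule prod_nonneg)
      fix p assume "p \<in> S"
      then have "real p \<ge> 1" using S(2) prime_ge_1_nat by (metis of_nat_1 of_nat_le_iff)
      then have "real p powr (- 1 - \<sigma>) \<le> real p powr 0" using \<sigma> by (intro powr_mono) auto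
      then show "0 \<le> 1 - real p powr (- 1 - \<sigma>)" using \<open>real p \<ge> 1\<close> by simp
    qed
    ultimately show ?thesis by (simp only: norm_of_real abs_of_nonneg)
  qed
  finally have 1: "1 \<le> norm (deval ?s dZ) * (\<Prod>p\<in>S. 1 - real p powr (- 1 - \<sigma>))" .
  have "norm (deval ?s dZ) \<le> 1 + 1 / \<sigma>"
    using dbound_zeta[OF \<sigma>, of dZ] by (intro norm_deval_le) (simp add: norm_dZ)
  moreover have "0 \<le> (\<Prod>p\<in>S. 1 - real p powr (- 1 - \<sigma>))"
    using 1 by (smt (verit) mult_nonneg_nonpos norm_ge_zero)
  ultimately show ?thesis using 1 mult_right_mono order_trans by blast
qed

text \<open>A weighted form of Mertens' bound, from \<open>1 - y \<le> exp (- y)\<close>. With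
  \<open>1 / \<sigma>\<close> of size \<open>log log q\<close>, exponentiating the sum costs only
  powers of \<open>log log q\<close>.\<close>

lemma sum_prime_powr_le:
  assumes S: "finite S" "\<And>p. p \<in> S \<Longrightarrow> prime p" and \<sigma>: "\<sigma> > 0"
  shows "(\<Sum>p\<in>S. real p powr (- 1 - \<sigma>)) \<le> ln (1 + 1 / \<sigma>)"
proof -
  have "(\<Prod>p\<in>S. 1 - real p powr (- 1 - \<sigma>)) \<le> (\<Prod>p\<in>S. exp (- (real p powr (- 1 - \<sigma>))))"
  proof (rule prod_mono, safe)
    fix p assume "p \<in> S"
    then have "real p \<ge> 1" using S(2) prime_ge_1_nat by (metis of_nat_1 of_nat_le_iff)
    then have "real p powr (- 1 - \<sigma>) \<le> real p powr 0" using \<sigma> by (intro powr_mono) auto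
    then show "0 \<le> 1 - real p powr (- 1 - \<sigma>)" using \<open>real p \<ge> 1\<close> by simp
    show "1 - real p powr (- 1 - \<sigma>) \<le> exp (- (real p powr (- 1 - \<sigma>)))"
      using exp_ge_add_one_self[of "- (real p powr (- 1 - \<sigma>))"] by simp
  qed
  also have "\<dots> = exp (- (\<Sum>p\<in>S. real p powr (- 1 - \<sigma>)))"
    using S(1) by (simp add: exp_sum sum_negf[symmetric])
  finally have "(1 + 1 / \<sigma>) * (\<Prod>p\<in>S. 1 - real p powr (- 1 - \<sigma>)) \<le> (1 + 1 / \<sigma>) * exp (- (\<Sum>p\<in>S. real p powr (- 1 - \<sigma>)))"
    using \<sigma> by (intro mult_left_mono) auto
  with prod_one_minus_prime_powr_ge[OF S \<sigma>]
  have "1 \<le> (1 + 1 / \<sigma>) * exp (- (\<Sum>p\<in>S. real p powr (- 1 - \<sigma>)))" by linarith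
  then have "exp (\<Sum>p\<in>S. real p powr (- 1 - \<sigma>)) \<le> 1 + 1 / \<sigma>"
    by (simp add: exp_minus field_simps)
  moreover have "1 + 1 / \<sigma> > 0" using \<sigma> by (simp add: add_pos_pos)
  ultimately show ?thesis by (simp add: ln_ge_iff)
qed

lemma card_prime_factors_le:
  assumes "q > 0"
  shows "real (card (prime_factors q)) * ln 2 \<le> ln (real q)"
proof -
  have "(2::nat) ^ card (prime_factors q) = (\<Prod>p\<in>prime_factors q. 2)" by simp
  also have "\<dots> \<le> (\<Prod>p\<in>prime_factors q. p ^ multiplicity p q)"
  proof (rule prod_mono, safe)
    fix p assume p: "p \<in> prime_factors q"
    then have "p \<ge> 2" "multiplicity p q \<noteq> 0" by (auto simp: prime_factors_multiplicity prime_ge_2_nat)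
    then have "2 ^ 1 \<le> p ^ multiplicity p q"
      using power_mono[of 2 p 1] power_increasing[of 1 "multiplicity p q" p] by simp
    then show "2 \<le> p ^ multiplicity p q" by simp
  qed
  also have "\<dots> = q" using assms by (simp add: prod_prime_factors)
  finally have "real (2 ^ card (prime_factors q)) \<le> real q" by (simp only: of_nat_le_iff)
  then have "ln (2 ^ card (prime_factors q)) \<le> ln (real q)"
    using assms by (subst ln_le_cancel_iff) auto
  then show ?thesis by (simp add: ln_realpow)
qed

text \<open>At least 1, unlike the iterated logarithm itself, so that its powers increase with the exponent.\<close>

definition LL :: "nat \<Rightarrow> real" where
  "LL q = max 1 (loglog q)"

text \<open>Split at \<open>Y = log q\<close>. For \<open>p \<le> Y\<close> both
  \<open>p powr \<eta>\<close> and \<open>p powr (1 / L)\<close> are at most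
  \<open>exp 1 \<le> 3\<close>, so the summand is at most \<open>9 * p powr (-1 - 1 / L)\<close>.
  For \<open>p > Y\<close> each summand is at most \<open>3 / Y\<close>, and \<open>q\<close> has at
  most \<open>2 * Y\<close> prime divisors, whence the 6.\<close>

lemma sum_prime_divisors_le:
  assumes q: "q > 0" and \<eta>: "0 < \<eta>" "\<eta> \<le> 1 / LL q"
    and S: "finite S" "\<And>p. p \<in> S \<Longrightarrow> prime p \<and> p dvd q"
  shows "(\<Sum>p\<in>S. real p powr (\<eta> - 1)) \<le> 9 * ln (1 + LL q) + 6"
proof -
  define L where "L = LL q"
  have L: "L \<ge> 1" by (simp add: L_def LL_def)
  have \<eta>1: "\<eta> \<le> 1" using \<eta> L unfolding L_def[symmetric] by (smt (verit) divide_le_eq_1)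
  have lnL: "ln (1 + L) \<ge> 0" using L by simp
  show ?thesis
  proof (cases "q \<ge> 3")
    case False
    have "S \<subseteq> {2}"
    proof
      fix p assume "p \<in> S"
      then have "p \<ge> 2" "p \<le> q" using S(2) q by (auto simp: prime_ge_2_nat intro: dvd_imp_le)
      then show "p \<in> {2}" using False by auto
    qed
    then have "(\<Sum>p\<in>S. real p powr (\<eta> - 1)) \<le> (\<Sum>p\<in>{2::nat}. real p powr (\<eta> - 1))"
      by (intro sum_mono2) auto
    also have "\<dots> = 2 powr (\<eta> - 1)" by simp
    also have "\<dots> \<le> 2 powr 0" using \<eta>1 by (intro powr_mono) auto
    finally show ?thesis using lnL by (simp add: L_def)
  next
    case True
    define Y where "Y = ln (real q)"
    have Y: "Y \<ge> 1"
    proof -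
      have "exp 1 \<le> (3::real)" by (rule exp_le)
      also have "\<dots> \<le> real q" using True by simp
      finally show ?thesis unfolding Y_def using q by (simp add: ln_ge_iff)
    qed
    have lnY: "ln Y \<le> L" using True by (simp add: L_def LL_def loglog_def Y_def)
    have pe: "y powr e \<le> 3" if y: "1 \<le> y" "y \<le> Y" and e: "0 \<le> e" "e \<le> 1 / L" for y e
    proof -
      have "ln y \<le> ln Y" using y Y by (subst ln_le_cancel_iff) auto
      then have "ln y \<le> L" using lnY by linarith
      then have "e * ln y \<le> 1 / L * L" using e y L by (intro mult_mono) auto
      then have "e * ln y \<le> 1" using L by simp
      then have "y powr e \<le> exp 1" using y by (simp add: powr_def)
      also have "\<dots> \<le> 3" by (rule exp_le)
      finally show ?thesis .
    qed
    define S1 where "S1 = {p\<in>S. real p \<le> Y}"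
    define S2 where "S2 = {p\<in>S. real p > Y}"
    have p1: "real p \<ge> 1" if "p \<in> S" for p using S(2)[OF that] prime_ge_1_nat by (metis of_nat_1 of_nat_le_iff)
    have "(\<Sum>p\<in>S. real p powr (\<eta> - 1)) = (\<Sum>p\<in>S1. real p powr (\<eta> - 1)) + (\<Sum>p\<in>S2. real p powr (\<eta> - 1))"
      unfolding S1_def S2_def using S(1)
      by (subst sum.union_disjoint[symmetric]) (auto intro!: sum.cong)
    also have "(\<Sum>p\<in>S1. real p powr (\<eta> - 1)) \<le> (\<Sum>p\<in>S1. 9 * real p powr (- 1 - 1 / L))"
    proof (rule sum_mono)
      fix p assume p: "p \<in> S1"
      then have py: "1 \<le> real p" "real p \<le> Y" using p1 by (auto simp: S1_def)
      have "real p powr \<eta> * real p powr (1 / L) \<le> 3 * 3"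
        using py \<eta> L by (intro mult_mono pe) (auto simp: L_def)
      then have "real p powr \<eta> * real p powr (1 / L) * real p powr (- 1 - 1 / L) \<le> 9 * real p powr (- 1 - 1 / L)"
        by (intro mult_right_mono) auto
      moreover have "real p powr \<eta> * real p powr (1 / L) * real p powr (- 1 - 1 / L) = real p powr (\<eta> - 1)"
        unfolding powr_add[symmetric] by simp
      ultimately show "real p powr (\<eta> - 1) \<le> 9 * real p powr (- 1 - 1 / L)" by simp
    qed
    also have "\<dots> = 9 * (\<Sum>p\<in>S1. real p powr (- 1 - 1 / L))" by (simp add: sum_distrib_left)
    also have "\<dots> \<le> 9 * ln (1 + 1 / (1 / L))"
      using S L by (intro mult_left_mono sum_prime_powr_le) (auto simp: S1_def)
    also have "(\<Sum>p\<in>S2. real p powr (\<eta> - 1)) \<le> (\<Sum>p\<in>S2. 3 / Y)"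
    proof (rule sum_mono)
      fix p assume p: "p \<in> S2"
      have "real p powr (\<eta> - 1) \<le> Y powr (\<eta> - 1)" using p Y \<eta>1 by (intro powr_mono2') (auto simp: S2_def)
      also have "\<dots> = Y powr \<eta> / Y" using Y by (simp add: powr_diff)
      also have "\<dots> \<le> 3 / Y" using Y \<eta> by (intro divide_right_mono pe) (auto simp: L_def)
      finally show "real p powr (\<eta> - 1) \<le> 3 / Y" .
    qed
    also have "\<dots> = real (card S2) * (3 / Y)" by simp
    also have "\<dots> \<le> 2 * Y * (3 / Y)"
    proof (rule mult_right_mono)
      have "S2 \<subseteq> prime_factors q" using S(2) q by (auto simp: S2_def prime_factors_dvd)
      then have "real (card S2) \<le> real (card (prime_factors q))" by (simp add: card_mono)
      moreover have "real (card (prime_factors q)) * (1 / 2) \<le> real (card (prime_factors q)) * ln 2"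
        using ln2_ge_two_thirds by (intro mult_left_mono) auto
      ultimately show "real (card S2) \<le> 2 * Y" using card_prime_factors_le[OF q] by (simp add: Y_def)
    qed (use Y in auto)
    also have "2 * Y * (3 / Y) = 6" using Y by simp
    finally show ?thesis by (simp add: L_def)
  qed
qed

text \<open>Rankin's trick: the logarithmic weight costs a factor \<open>1 / \<eta>\<close> against \<open>n\<^sup>\<eta>\<close>, and \<open>\<eta>\<close> of size
  \<open>1 / log log q\<close> keeps \<open>p\<^sup>\<eta>\<close> bounded for \<open>p \<le> log q\<close>, while the larger prime divisors of \<open>q\<close> are too few
  to matter.\<close>

lemma quotient_part_moment:
  fixes \<theta> A :: real
  assumes \<theta>: "\<theta> > 0"
  shows "\<exists>Q\<ge>0. \<forall>q g S N. q > 0 \<longrightarrow> finite S \<longrightarrow> (\<forall>p\<in>S. prime p) \<longrightarrow>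
    (\<forall>p. prime p \<longrightarrow> \<not> p dvd q \<longrightarrow> norm (g p - of_int k / of_nat p) \<le> A / real p powr (1 + \<theta>)) \<longrightarrow>
    (\<Sum>n=1..N. norm (dnth (quotient_part k (\<lambda>p. if p dvd q then 0 else g p) S) n) * (1 + ln (real n)))
       \<le> Q * LL q ^ (9 * nat \<bar>k\<bar> + 1)"
proof -
  define K where "K = real (nat \<bar>k\<bar>)"
  have K: "K = \<bar>real_of_int k\<bar>" by (simp add: K_def)
  define A' where "A' = K + \<bar>A\<bar>"
  have A': "A' \<ge> 0" by (simp add: A'_def K_def)
  obtain C where C: "C \<ge> 0" and loc: "\<And>p w a. prime p \<Longrightarrow> w \<le> 1 / 2 \<Longrightarrow> norm a \<le> A' / real p \<Longrightarrow>
     dbound w ((1 + dmonom a p) * local_factor k p)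
       (1 + norm (a - of_int k / of_nat p) * real p powr w + C * real p powr (2 * w - 2))"
    using dbound_local[OF A', of k] by blast
  \<comment> \<open>The cap 1/4 keeps the weight below 1/2 and \<open>2 * \<eta> - 2\<close> below
    \<open>- 3/2\<close>. The cap \<open>\<theta> / 2\<close> leaves the exponent
    \<open>- 1 - \<theta> / 2\<close> for the primes not dividing \<open>q\<close>.\<close>
  define \<eta>0 where "\<eta>0 = min (1 / 4) (\<theta> / 2)"
  have \<eta>0: "\<eta>0 > 0" "\<eta>0 \<le> 1 / 4" "\<eta>0 \<le> \<theta> / 2" using \<theta> by (auto simp: \<eta>0_def)
  \<comment> \<open>The 6 comes from the prime divisors of \<open>q\<close>;
    \<open>1 + 2 / \<theta>\<close> and 3 are \<open>sum_powr_le\<close> at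
    \<open>\<theta> / 2\<close> and \<open>1 / 2\<close>.\<close>
  define C0 where "C0 = K * 6 + \<bar>A\<bar> * (1 + 2 / \<theta>) + C * 3"
  \<comment> \<open>\<open>exp 1 / \<eta>0\<close> is Rankin's loss after splitting off one factor
    \<open>L\<close>, and the power of 2 comes from \<open>1 + L \<le> 2 * L\<close>.\<close>
  define Q where "Q = exp 1 / \<eta>0 * (exp C0 * 2 ^ (9 * nat \<bar>k\<bar>))"
  have Q: "Q \<ge> 0" using \<eta>0 by (simp add: Q_def)
  have "(\<Sum>n=1..N. norm (dnth (quotient_part k (\<lambda>p. if p dvd q then 0 else g p) S) n) * (1 + ln (real n)))
       \<le> Q * LL q ^ (9 * nat \<bar>k\<bar> + 1)"
    if q: "q > 0" and S: "finite S" "\<forall>p\<in>S. prime p"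
      and g: "\<forall>p. prime p \<longrightarrow> \<not> p dvd q \<longrightarrow> norm (g p - of_int k / of_nat p) \<le> A / real p powr (1 + \<theta>)"
    for q g S N
  proof -
    define a where "a = (\<lambda>p. if p dvd q then 0 else g p)"
    define L where "L = LL q"
    have L: "L \<ge> 1" by (simp add: L_def LL_def)
    define \<eta> where "\<eta> = \<eta>0 / L"
    have \<eta>: "0 < \<eta>" "\<eta> \<le> \<eta>0" "\<eta> \<le> 1 / L"
      using \<eta>0 L by (auto simp: \<eta>_def divide_le_eq mult_le_cancel_left1 intro!: divide_right_mono)
    have gb: "norm (g p - of_int k / of_nat p) \<le> \<bar>A\<bar> * real p powr (- 1 - \<theta>)" if "prime p" "\<not> p dvd q" for p
    proof -
      have "norm (g p - of_int k / of_nat p) \<le> A / real p powr (1 + \<theta>)" using g that by blast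
      also have "\<dots> \<le> \<bar>A\<bar> / real p powr (1 + \<theta>)" by (intro divide_right_mono) auto
      also have "\<dots> = \<bar>A\<bar> * real p powr (- 1 - \<theta>)"
        using powr_minus_divide[of "real p" "1 + \<theta>"] by (simp add: algebra_simps)
      finally show ?thesis .
    qed
    have ab: "norm (a p) \<le> A' / real p" if p: "prime p" for p
    proof (cases "p dvd q")
      case False
      have p1: "real p \<ge> 1" using prime_ge_1_nat[OF p] by simp
      have "norm (g p) \<le> norm (g p - of_int k / of_nat p) + norm (of_int k / of_nat p :: complex)"
        using norm_triangle_ineq[of "g p - of_int k / of_nat p" "of_int k / of_nat p"] by simp
      also have "\<dots> \<le> \<bar>A\<bar> * real p powr (- 1 - \<theta>) + K / real p"
        using gb[OF p False] by (simp add: norm_divide K)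
      also have "real p powr (- 1 - \<theta>) \<le> real p powr (- 1)" using p1 \<theta> by (intro powr_mono) auto
      then have "\<bar>A\<bar> * real p powr (- 1 - \<theta>) \<le> \<bar>A\<bar> / real p"
        using p1 mult_left_mono[of "real p powr (- 1 - \<theta>)" "real p powr (- 1)" "\<bar>A\<bar>"] by (simp add: powr_minus_divide)
      finally show ?thesis using False by (simp add: a_def A'_def add_divide_distrib)
    qed (simp add: a_def A')
    define b where "b = (\<lambda>p. norm (a p - of_int k / of_nat p) * real p powr \<eta> + C * real p powr (2 * \<eta> - 2))"
    have b0: "b p \<ge> 0" for p using C by (simp add: b_def)
    have "dbound \<eta> (quotient_part k a S) (\<Prod>p\<in>S. 1 + b p)"
      unfolding quotient_part_def
    proof (rule dbound_prod)
      fix p assume "p \<in> S"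
      then have "prime p" using S by blast
      then show "dbound \<eta> ((1 + dmonom (a p) p) * local_factor k p) (1 + b p)"
        using loc[of p \<eta> "a p"] ab[of p] \<eta> \<eta>0 by (simp add: b_def add.assoc)
    qed
    moreover have "(\<Prod>p\<in>S. 1 + b p) \<le> exp (\<Sum>p\<in>S. b p)"
    proof -
      have "(\<Prod>p\<in>S. 1 + b p) \<le> (\<Prod>p\<in>S. exp (b p))"
        using b0 by (intro prod_mono) (auto simp: exp_ge_add_one_self add_nonneg_nonneg)
      then show ?thesis using S by (simp add: exp_sum)
    qed
    moreover have "(\<Sum>p\<in>S. b p) \<le> 9 * K * ln (1 + L) + C0"
    proof -
      define S1 where "S1 = {p\<in>S. p dvd q}"
      define S2 where "S2 = {p\<in>S. \<not> p dvd q}"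
      obtain N0 where N0: "S \<subseteq> {1..N0}"
      proof
        show "S \<subseteq> {1..Max (insert 0 S)}" using S prime_ge_1_nat by auto
      qed
      have "(\<Sum>p\<in>S. b p) = (\<Sum>p\<in>S. norm (a p - of_int k / of_nat p) * real p powr \<eta>) + C * (\<Sum>p\<in>S. real p powr (2 * \<eta> - 2))"
        by (simp add: b_def sum.distrib sum_distrib_left)
      also have "(\<Sum>p\<in>S. norm (a p - of_int k / of_nat p) * real p powr \<eta>) =
          (\<Sum>p\<in>S1. norm (a p - of_int k / of_nat p) * real p powr \<eta>) + (\<Sum>p\<in>S2. norm (a p - of_int k / of_nat p) * real p powr \<eta>)"
        unfolding S1_def S2_def using S(1) by (subst sum.union_disjoint[symmetric]) (auto intro!: sum.cong)
      \<comment> \<open>Here \<open>a p = 0\<close>, so all of \<open>k / p\<close> remains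
        uncancelled. These primes alone make the bound for the product grow with
        \<open>q\<close>.\<close>
      also have "(\<Sum>p\<in>S1. norm (a p - of_int k / of_nat p) * real p powr \<eta>) = K * (\<Sum>p\<in>S1. real p powr (\<eta> - 1))"
        unfolding sum_distrib_left
      proof (rule sum.cong[OF refl])
        fix p assume p: "p \<in> S1"
        then have "p > 0" using S prime_gt_0_nat by (auto simp: S1_def)
        then show "norm (a p - of_int k / of_nat p) * real p powr \<eta> = K * real p powr (\<eta> - 1)"
          using p by (simp add: a_def S1_def norm_divide K powr_diff)
      qed
      also have "\<dots> \<le> K * (9 * ln (1 + L) + 6)"
        unfolding L_def using S \<eta> q
        by (intro mult_left_mono sum_prime_divisors_le) (auto simp: S1_def K_def L_def)
      also have "(\<Sum>p\<in>S2. norm (a p - of_int k / of_nat p) * real p powr \<eta>) \<le> (\<Sum>p\<in>S2. \<bar>A\<bar> * real p powr (- 1 - \<theta> / 2))"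
      proof (rule sum_mono)
        fix p assume p: "p \<in> S2"
        then have pp: "prime p" "\<not> p dvd q" using S by (auto simp: S2_def)
        have p1: "real p \<ge> 1" using prime_ge_1_nat[OF pp(1)] by simp
        have "norm (a p - of_int k / of_nat p) * real p powr \<eta> \<le> \<bar>A\<bar> * real p powr (- 1 - \<theta>) * real p powr \<eta>"
          using gb[OF pp] pp by (intro mult_right_mono) (auto simp: a_def)
        also have "\<dots> = \<bar>A\<bar> * real p powr (- 1 - \<theta> + \<eta>)" by (simp add: powr_add[symmetric])
        also have "\<dots> \<le> \<bar>A\<bar> * real p powr (- 1 - \<theta> / 2)"
          using p1 \<eta> \<eta>0 by (intro mult_left_mono powr_mono) auto
        finally show "norm (a p - of_int k / of_nat p) * real p powr \<eta> \<le> \<bar>A\<bar> * real p powr (- 1 - \<theta> / 2)" .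
      qed
      also have "\<dots> \<le> (\<Sum>n=1..N0. \<bar>A\<bar> * real n powr (- 1 - \<theta> / 2))"
        using N0 by (intro sum_mono2) (auto simp: S2_def)
      also have "\<dots> = \<bar>A\<bar> * (\<Sum>n=1..N0. real n powr (- 1 - \<theta> / 2))" by (simp add: sum_distrib_left)
      also have "\<dots> \<le> \<bar>A\<bar> * (1 + 1 / (\<theta> / 2))" using \<theta> by (intro mult_left_mono sum_powr_le) auto
      also have "(\<Sum>p\<in>S. real p powr (2 * \<eta> - 2)) \<le> (\<Sum>p\<in>S. real p powr (- 1 - 1 / 2))"
        using S \<eta> \<eta>0 N0 by (intro sum_mono powr_mono) auto
      then have "C * (\<Sum>p\<in>S. real p powr (2 * \<eta> - 2)) \<le> C * (\<Sum>p\<in>S. real p powr (- 1 - 1 / 2))"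
        using C by (rule mult_left_mono)
      also have "\<dots> \<le> C * (\<Sum>n=1..N0. real n powr (- 1 - 1 / 2))"
        using C N0 by (intro mult_left_mono sum_mono2) auto
      also have "\<dots> \<le> C * (1 + 1 / (1 / 2))" using C by (intro mult_left_mono sum_powr_le) auto
      finally show ?thesis by (simp add: C0_def algebra_simps)
    qed
    ultimately have db: "dbound \<eta> (quotient_part k a S) (exp (9 * K * ln (1 + L) + C0))"
      by (smt (verit, best) dbound_mono exp_le_cancel_iff)
    have ex: "exp (9 * K * ln (1 + L) + C0) = exp C0 * (1 + L) ^ (9 * nat \<bar>k\<bar>)"
    proof -
      have "9 * K * ln (1 + L) = real (9 * nat \<bar>k\<bar>) * ln (1 + L)" by (simp add: K_def)
      also have "exp \<dots> = (1 + L) ^ (9 * nat \<bar>k\<bar>)" using L by (subst exp_of_nat_mult) simp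
      finally show ?thesis by (simp add: exp_add)
    qed
    \<comment> \<open>From \<open>y \<le> exp y\<close> at \<open>y = \<eta> * (1 + log n)\<close>.
      The factor \<open>1 / \<eta> = L / \<eta>0\<close> is the extra 1 in the exponent of
      \<open>LL q\<close>.\<close>
    have "(\<Sum>n=1..N. norm (dnth (quotient_part k a S) n) * (1 + ln (real n))) \<le>
        (\<Sum>n=1..N. norm (dnth (quotient_part k a S) n) * (exp 1 / \<eta> * real n powr \<eta>))"
    proof (intro sum_mono mult_left_mono)
      fix n assume n: "n \<in> {1..N}"
      have "\<eta> * (1 + ln (real n)) \<le> exp (\<eta> * (1 + ln (real n)))"
        using exp_ge_add_one_self[of "\<eta> * (1 + ln (real n))"] by linarith
      also have "\<dots> = exp \<eta> * real n powr \<eta>" using n by (simp add: powr_def exp_add ring_distribs)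
      also have "\<dots> \<le> exp 1 * real n powr \<eta>" using \<eta> \<eta>0 by (intro mult_right_mono) auto
      finally show "1 + ln (real n) \<le> exp 1 / \<eta> * real n powr \<eta>" using \<eta> by (simp add: field_simps)
    qed auto
    also have "\<dots> = exp 1 / \<eta> * (\<Sum>n=1..N. norm (dnth (quotient_part k a S) n) * real n powr \<eta>)"
      by (simp add: sum_distrib_left mult_ac)
    also have "\<dots> \<le> exp 1 / \<eta> * (exp C0 * (1 + L) ^ (9 * nat \<bar>k\<bar>))"
      using dboundD[OF db, of N] \<eta> unfolding ex by (intro mult_left_mono) auto
    also have "\<dots> \<le> exp 1 / \<eta> * (exp C0 * (2 * L) ^ (9 * nat \<bar>k\<bar>))"
      using L \<eta> by (intro mult_left_mono power_mono) auto
    also have "\<dots> = Q * L ^ (9 * nat \<bar>k\<bar> + 1)"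
      by (simp add: Q_def \<eta>_def power_mult_distrib mult_ac)
    finally show ?thesis by (simp add: a_def L_def)
  qed
  then show ?thesis using Q by blast
qed

text \<open>Once \<open>P \<ge> q\<close>, all primes dividing \<open>q\<close> are present, and the
  finite product splits exactly into a partial product of the Euler factors and the full finite
  product over the divisors.\<close>

lemma singular_series_limit:
  assumes \<theta>: "\<theta> > 0" and q: "q > 0"
    and g: "\<And>p. prime p \<Longrightarrow> \<not> p dvd q \<Longrightarrow> norm (g p - of_int k / of_nat p) \<le> A / real p powr (1 + \<theta>)"
  shows "(\<lambda>P. deval 0 (quotient_part k (\<lambda>p. if p dvd q then 0 else g p) (primes_upto P))) \<longlonglongrightarrow> singular_series g k q"
proof -
  let ?e = "euler_factor g k q" and ?f = "\<lambda>p. complex_of_real ((1 - 1 / real p) powi k)"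
  have "(\<lambda>P. (\<Prod>i\<le>P. ?e i) * of_real (\<Prod>p | prime p \<and> p dvd q. (1 - 1 / real p) powi k)) \<longlonglongrightarrow> singular_series g k q"
    unfolding singular_series_def
    using convergent_prod_LIMSEQ[OF convergent_euler_factor[OF \<theta> g]] by (intro tendsto_mult_right)
  moreover have "eventually (\<lambda>P. deval 0 (quotient_part k (\<lambda>p. if p dvd q then 0 else g p) (primes_upto P)) =
      (\<Prod>i\<le>P. ?e i) * of_real (\<Prod>p | prime p \<and> p dvd q. (1 - 1 / real p) powi k)) sequentially"
    using eventually_ge_at_top[of q]
  proof eventually_elim
    case (elim P)
    have S: "primes_upto P = {p. prime p \<and> p \<le> P \<and> \<not> p dvd q} \<union> {p. prime p \<and> p dvd q}"
      using elim q by (auto dest: dvd_imp_le)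
    have fin: "finite {p. prime p \<and> p \<le> P \<and> \<not> p dvd q}" "finite {p. prime p \<and> p dvd q}"
      using q by (auto intro: finite_subset[of _ "{..P}"] finite_subset[of _ "{..q}"] dest: dvd_imp_le)
    have "deval 0 (quotient_part k (\<lambda>p. if p dvd q then 0 else g p) (primes_upto P)) =
      (\<Prod>p\<in>primes_upto P. (1 + (if p dvd q then 0 else g p)) * ?f p)"
      by (rule deval_quotient_part) simp
    also have "\<dots> = (\<Prod>p | prime p \<and> p \<le> P \<and> \<not> p dvd q. (1 + (if p dvd q then 0 else g p)) * ?f p) *
       (\<Prod>p | prime p \<and> p dvd q. (1 + (if p dvd q then 0 else g p)) * ?f p)"
      unfolding S using fin by (intro prod.union_disjoint) auto
    also have "(\<Prod>p | prime p \<and> p \<le> P \<and> \<not> p dvd q. (1 + (if p dvd q then 0 else g p)) * ?f p) = (\<Prod>i\<le>P. ?e i)"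
      by (rule prod.mono_neutral_cong_left) (auto simp: euler_factor_def)
    also have "(\<Prod>p | prime p \<and> p dvd q. (1 + (if p dvd q then 0 else g p)) * ?f p) = of_real (\<Prod>p | prime p \<and> p dvd q. (1 - 1 / real p) powi k)"
      unfolding of_real_prod by (rule prod.cong) auto
    finally show ?case .
  qed
  ultimately show ?thesis by (rule tendsto_cong[THEN iffD2, rotated])
qed

section \<open>Assembly of the asymptotic formula\<close>

lemma power_diff_le:
  fixes u v :: real
  assumes "0 \<le> v" "v \<le> u"
  shows "u ^ r - v ^ r \<le> real r * (u - v) * ((1 + u) ^ r / (1 + u))"
proof (induction r)
  case (Suc r)
  have u: "u \<ge> 0" "1 + u > 0" using assms by auto
  have "u ^ Suc r - v ^ Suc r = u * (u ^ r - v ^ r) + v ^ r * (u - v)" by (simp add: algebra_simps)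
  also have "\<dots> \<le> u * (real r * (u - v) * ((1 + u) ^ r / (1 + u))) + (1 + u) ^ r * (u - v)"
    using assms Suc by (intro add_mono mult_left_mono mult_right_mono power_mono) auto
  also have "u * (real r * (u - v) * ((1 + u) ^ r / (1 + u))) \<le> (1 + u) * (real r * (u - v) * ((1 + u) ^ r / (1 + u)))"
    using assms by (intro mult_right_mono) auto
  also have "(1 + u) * (real r * (u - v) * ((1 + u) ^ r / (1 + u))) + (1 + u) ^ r * (u - v) =
      real (Suc r) * (u - v) * ((1 + u) ^ Suc r / (1 + u))"
    using u by (simp add: field_simps)
  finally show ?case by simp
qed simp

text \<open>The total error is a sum over \<open>d\<close> of a coefficient of the quotient times an
  individual error of size \<open>E * (1 + log d)\<close>. The first logarithmic moment of the
  quotient is therefore exactly what is needed.\<close>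

lemma log_sum_approx:
  assumes m: "int m \<ge> - k" and \<theta>: "\<theta> > 0"
  shows "\<exists>D\<ge>0. \<forall>q g x. q > 0 \<longrightarrow> multiplicative g \<longrightarrow> supported_on_squarefree g \<longrightarrow>
    (\<forall>p. prime p \<longrightarrow> \<not> p dvd q \<longrightarrow> norm (g p - of_int k / of_nat p) \<le> A / real p powr (1 + \<theta>)) \<longrightarrow>
    x \<ge> 1 \<longrightarrow>
    norm (log_sum g x m q - singular_series g k q * of_real (fact m / fact (nat (k + int m)) * ln x ^ nat (k + int m)))
     \<le> D * ((1 + ln x) ^ nat (k + int m) / (1 + ln x)) * LL q ^ (9 * nat \<bar>k\<bar> + 1)"
proof -
  define r where "r = nat (k + int m)"
  define c where "c = (fact m / fact r :: real)"
  have c: "c \<ge> 0" by (simp add: c_def)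
  obtain B where B: "B \<ge> 0" "\<And>u. u \<ge> 0 \<Longrightarrow> norm (logsum (dtau k) m u - of_real (c * u ^ r)) \<le> B * ((1 + u) ^ r / (1 + u))"
    using logsum_dtau[OF m] by (auto simp: r_def c_def)
  obtain Q where Q: "Q \<ge> 0" "\<And>q g S N. q > 0 \<Longrightarrow> finite S \<Longrightarrow> \<forall>p\<in>S. prime p \<Longrightarrow>
    \<forall>p. prime p \<longrightarrow> \<not> p dvd q \<longrightarrow> norm (g p - of_int k / of_nat p) \<le> A / real p powr (1 + \<theta>) \<Longrightarrow>
    (\<Sum>n=1..N. norm (dnth (quotient_part k (\<lambda>p. if p dvd q then 0 else g p) S) n) * (1 + ln (real n)))
       \<le> Q * LL q ^ (9 * nat \<bar>k\<bar> + 1)"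
    using quotient_part_moment[OF \<theta>, of k A] by blast
  define D where "D = (B + c * (real r + 1)) * Q"
  have "norm (log_sum g x m q - singular_series g k q * of_real (c * ln x ^ r))
     \<le> D * ((1 + ln x) ^ r / (1 + ln x)) * LL q ^ (9 * nat \<bar>k\<bar> + 1)"
    if q: "q > 0" and g: "multiplicative g" "supported_on_squarefree g"
      and gp: "\<forall>p. prime p \<longrightarrow> \<not> p dvd q \<longrightarrow> norm (g p - of_int k / of_nat p) \<le> A / real p powr (1 + \<theta>)"
      and x: "x \<ge> 1" for q g x
  proof -
    define u where "u = ln x"
    define h where "h = (\<lambda>P. quotient_part k (\<lambda>p. if p dvd q then 0 else g p) (primes_upto P))"
    define E where "E = (1 + u) ^ r / (1 + u)"
    have u: "u \<ge> 0" using x by (simp add: u_def)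
    have E: "E \<ge> 0" using u by (simp add: E_def)
    \<comment> \<open>The error of replacing the sum at \<open>x / d\<close> by the main term at
      \<open>x\<close>. For \<open>d > x\<close> the sum is empty and the main term itself is the
      error.\<close>
    define t where "t = (\<lambda>d. (if real d \<le> x then logsum (dtau k) m (u - ln (real d)) else 0) - complex_of_real (c * u ^ r))"
    have t: "norm (t d) \<le> (B + c * (real r + 1)) * E * (1 + ln (real d))" if d: "d > 0" for d
    proof (cases "real d \<le> x")
      case True
      define v where "v = u - ln (real d)"
      have "ln (real d) \<le> u" using True d x unfolding u_def by (subst ln_le_cancel_iff) auto
      then have v: "0 \<le> v" "v \<le> u" using d by (auto simp: v_def)
      have ld: "ln (real d) = u - v" by (simp add: v_def)
      have "norm (t d) \<le> norm (logsum (dtau k) m v - of_real (c * v ^ r)) + norm (complex_of_real (c * v ^ r) - of_real (c * u ^ r))"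
        using True norm_triangle_ineq[of "logsum (dtau k) m v - of_real (c * v ^ r)" "complex_of_real (c * v ^ r) - of_real (c * u ^ r)"]
        by (simp add: t_def v_def)
      also have "norm (complex_of_real (c * v ^ r) - of_real (c * u ^ r)) = c * (u ^ r - v ^ r)"
      proof -
        have "complex_of_real (c * v ^ r) - of_real (c * u ^ r) = of_real (- (c * (u ^ r - v ^ r)))" by (simp add: algebra_simps)
        moreover have "u ^ r - v ^ r \<ge> 0" using v by (simp add: power_mono)
        ultimately show ?thesis using c by (simp only: norm_of_real) simp
      qed
      also have "\<dots> \<le> c * (real r * (u - v) * E)"
        unfolding E_def using c v by (intro mult_left_mono power_diff_le)
      also have "norm (logsum (dtau k) m v - of_real (c * v ^ r)) \<le> B * ((1 + v) ^ r * (1 / (1 + v)))"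
        using B(2)[OF v(1)] by simp
      also have "\<dots> \<le> B * ((1 + u) ^ r * ((1 + (u - v)) / (1 + u)))"
      proof -
        \<comment> \<open>Moving the saving \<open>1 / (1 + v)\<close> from
          \<open>v = log (x / d)\<close> to \<open>u = log x\<close> costs a factor
          \<open>1 + log d\<close>.\<close>
        have "(1 + u) * 1 \<le> (1 + (u - v)) * (1 + v)" using v mult_right_mono[of v u v] by (simp add: algebra_simps)
        then have "1 / (1 + v) \<le> (1 + (u - v)) / (1 + u)" using v u by (simp add: divide_simps)
        then show ?thesis using B v u by (intro mult_left_mono mult_mono power_mono) auto
      qed
      also have "\<dots> = B * E * (1 + (u - v))" by (simp add: E_def)
      finally have "norm (t d) \<le> B * E * (1 + (u - v)) + c * (real r * (u - v) * E)" by simp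
      moreover have "c * (real r * (u - v) * E) \<le> c * (real r + 1) * E * (1 + (u - v))"
      proof -
        have "real r * (u - v) \<le> (real r + 1) * (1 + (u - v))" using v by (intro mult_mono) auto
        then have "c * E * (real r * (u - v)) \<le> c * E * ((real r + 1) * (1 + (u - v)))"
          using c E by (intro mult_left_mono) auto
        then show ?thesis by (simp add: mult_ac)
      qed
      ultimately show ?thesis unfolding ld by (simp add: algebra_simps)
    next
      case False
      \<comment> \<open>Beyond \<open>x\<close> the weight \<open>1 + log d\<close> exceeds
        \<open>1 + u\<close>, which supplies the missing saving.\<close>
      have "u \<le> ln (real d)" using False x unfolding u_def by (subst ln_le_cancel_iff) auto
      then have "1 \<le> (1 + ln (real d)) / (1 + u)" using u by (simp add: divide_simps)
      moreover have "u ^ r \<le> (1 + u) ^ r" using u by (intro power_mono) auto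
      ultimately have "u ^ r * 1 \<le> (1 + u) ^ r * ((1 + ln (real d)) / (1 + u))"
        using u by (intro mult_mono) auto
      then have "c * u ^ r \<le> c * (E * (1 + ln (real d)))" using c by (intro mult_left_mono) (auto simp: E_def)
      also have "\<dots> \<le> (B + c * (real r + 1)) * (E * (1 + ln (real d)))"
        using B c E d by (intro mult_right_mono) (auto simp: algebra_simps)
      finally show ?thesis using False c u by (simp add: t_def norm_mult norm_power mult.assoc)
    qed
    \<comment> \<open>The bound depends on neither \<open>N\<close> nor \<open>P\<close>:
      \<open>N \<rightarrow> \<infinity>\<close> turns partial sums into the value at 0, and
      \<open>P \<rightarrow> \<infinity>\<close> turns that value into the singular series.\<close>
    have finite_bound: "norm (log_sum g x m q - deval 0 (h P) * of_real (c * u ^ r)) \<le>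
        (B + c * (real r + 1)) * E * (Q * LL q ^ (9 * nat \<bar>k\<bar> + 1))" if P: "x \<le> real P" for P
    proof -
      have sh: "dsummable 0 (h P)" unfolding h_def by (rule deval_quotient_part) simp
      have "(\<lambda>N. \<Sum>n=1..N. dnth (h P) n) \<longlonglongrightarrow> deval 0 (h P)"
      proof -
        have "(\<Sum>n=1..N. dnth (h P) n * of_nat n powr (- 0)) = (\<Sum>n=1..N. dnth (h P) n)" for N
          by (rule sum.cong) auto
        then show ?thesis using deval_partial_sums[OF sh] by (simp only:)
      qed
      then have lim: "(\<lambda>N. log_sum g x m q - (\<Sum>n=1..N. dnth (h P) n) * of_real (c * u ^ r)) \<longlonglongrightarrow>
          log_sum g x m q - deval 0 (h P) * of_real (c * u ^ r)"
        by (intro tendsto_intros)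
      have "norm (log_sum g x m q - (\<Sum>n=1..N. dnth (h P) n) * of_real (c * u ^ r)) \<le>
         (B + c * (real r + 1)) * E * (Q * LL q ^ (9 * nat \<bar>k\<bar> + 1))" if N: "N \<ge> P" for N
      proof -
        have "log_sum g x m q = (\<Sum>d | 0 < d \<and> real d \<le> x. dnth (h P) d * logsum (dtau k) m (u - ln (real d)))"
          unfolding h_def u_def by (rule log_sum_eq[OF g x P])
        also have "\<dots> = (\<Sum>d=1..N. dnth (h P) d * (if real d \<le> x then logsum (dtau k) m (u - ln (real d)) else 0))"
        proof (rule sum.mono_neutral_cong_left)
          have "d \<le> N" if "real d \<le> x" for d
          proof -
            have "real d \<le> real N" using that P N by linarith
            then show ?thesis by simp
          qed
          then show "{d. 0 < d \<and> real d \<le> x} \<subseteq> {1..N}" by auto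
        qed auto
        finally have "log_sum g x m q - (\<Sum>n=1..N. dnth (h P) n) * of_real (c * u ^ r) = (\<Sum>d=1..N. dnth (h P) d * t d)"
          by (simp add: t_def sum_distrib_right sum_subtractf[symmetric] right_diff_distrib)
        also have "norm \<dots> \<le> (\<Sum>d=1..N. norm (dnth (h P) d) * ((B + c * (real r + 1)) * E * (1 + ln (real d))))"
          by (rule sum_norm_le) (auto simp: norm_mult intro!: mult_left_mono t)
        also have "\<dots> = (B + c * (real r + 1)) * E * (\<Sum>d=1..N. norm (dnth (h P) d) * (1 + ln (real d)))"
          by (simp add: sum_distrib_left mult_ac)
        also have "\<dots> \<le> (B + c * (real r + 1)) * E * (Q * LL q ^ (9 * nat \<bar>k\<bar> + 1))"
          unfolding h_def using B c E q gp by (intro mult_left_mono Q(2)) auto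
        finally show ?thesis .
      qed
      then show ?thesis using LIMSEQ_le_const2[OF tendsto_norm[OF lim]] by blast
    qed
    have "(\<lambda>P. deval 0 (h P)) \<longlonglongrightarrow> singular_series g k q"
      unfolding h_def using gp by (intro singular_series_limit[OF \<theta> q]) auto
    then have "(\<lambda>P. norm (log_sum g x m q - deval 0 (h P) * of_real (c * u ^ r))) \<longlonglongrightarrow>
        norm (log_sum g x m q - singular_series g k q * of_real (c * u ^ r))"
      by (intro tendsto_intros)
    moreover have "\<exists>P0. \<forall>P\<ge>P0. norm (log_sum g x m q - deval 0 (h P) * of_real (c * u ^ r)) \<le>
       (B + c * (real r + 1)) * E * (Q * LL q ^ (9 * nat \<bar>k\<bar> + 1))"
    proof (intro exI[of _ "nat \<lceil>x\<rceil>"] allI impI finite_bound)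
      fix P assume "nat \<lceil>x\<rceil> \<le> P"
      then show "x \<le> real P" by linarith
    qed
    ultimately have "norm (log_sum g x m q - singular_series g k q * of_real (c * u ^ r)) \<le>
       (B + c * (real r + 1)) * E * (Q * LL q ^ (9 * nat \<bar>k\<bar> + 1))"
      by (rule LIMSEQ_le_const2)
    also have "\<dots> = D * E * LL q ^ (9 * nat \<bar>k\<bar> + 1)" by (simp add: D_def)
    finally show ?thesis by (simp only: E_def u_def)
  qed
  moreover have "D \<ge> 0" using B c Q by (simp add: D_def)
  ultimately show ?thesis unfolding r_def[symmetric] c_def[symmetric] by blast
qed

section \<open>The iterated logarithm at small moduli\<close>

lemma ln_ln_3_pos: "ln (ln (3::real)) > 0"
proof -
  \<comment> \<open>The claim amounts to \<open>exp 1 < 3\<close> strictly; the quadratic bound at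
    1/4 gives \<open>exp 1 \<le> (21 / 16)^4 < 3\<close>.\<close>
  have "exp (1 / 4 :: real) \<le> 1 + 1 / 4 + (1 / 4)\<^sup>2" by (intro exp_bound) auto
  then have "exp (1 / 4 :: real) ^ 4 \<le> (21 / 16) ^ 4" by (intro power_mono) (auto simp: power2_eq_square)
  moreover have "exp (1 / 4 :: real) ^ 4 = exp 1" by (simp add: exp_of_nat_mult[symmetric])
  moreover have "(21 / 16 :: real) ^ 4 < 3" by (simp add: power_divide)
  ultimately have "exp 1 < (3::real)" by linarith
  then have "ln (exp 1) < ln (3::real)" by (subst ln_less_cancel_iff) auto
  then show ?thesis by simp
qed

text \<open>\<open>loglog q\<close> is well below 1 for the first few \<open>q \<ge> 3\<close> but
  stays above a positive constant, so passing from \<open>LL\<close> to \<open>loglog\<close> costs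
  a factor that the implied constant absorbs.\<close>

lemma LL_le_loglog:
  obtains \<Lambda> where "\<Lambda> \<ge> 1" "\<And>q. q > 0 \<Longrightarrow> LL q \<le> \<Lambda> * loglog q"
proof -
  define l where "l = min 1 (ln (ln (3::real)))"
  have l: "0 < l" "l \<le> 1" using ln_ln_3_pos by (auto simp: l_def)
  have low: "loglog q \<ge> l" for q
  proof (cases "q \<ge> 3")
    case True
    have "ln 3 > (0::real)" by simp
    moreover have "ln 3 \<le> ln (real q)" using True by (subst ln_le_cancel_iff) auto
    ultimately have "ln (ln 3) \<le> ln (ln (real q))" by (subst ln_le_cancel_iff) linarith+
    moreover have "l \<le> ln (ln 3)" by (simp add: l_def)
    ultimately have "l \<le> ln (ln (real q))" by linarith
    then show ?thesis using True by (simp add: loglog_def)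
  qed (auto simp: loglog_def l_def)
  show ?thesis
  proof (rule that[of "1 / l"])
    show "1 / l \<ge> 1" using l by simp
    show "LL q \<le> 1 / l * loglog q" for q
    proof -
      have "1 \<le> 1 / l * loglog q" using low[of q] l by (simp add: field_simps)
      moreover have "1 * loglog q \<le> 1 / l * loglog q" using low[of q] l by (intro mult_right_mono) auto
      ultimately show ?thesis by (simp add: LL_def)
    qed
  qed
qed

section \<open>A recursive term for the exponent\<close>

fun rec_add :: "nat \<Rightarrow> recf" where
  "rec_add 0 = Proj 1"
| "rec_add (Suc c) = Comp Succ [rec_add c]"

text \<open>In the step of a primitive recursion the argument list is counter, previous value,
  parameters; index 1 picks the previous value \<open>y\<close>, and the constant \<open>c\<close>
  is built into the term.\<close>

lemma rec_eval_rec_add: "rec_eval (rec_add c) (n # y # xs) (y + c)"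
proof (induction c)
  case 0
  have "rec_eval (Proj 1) (n # y # xs) ((n # y # xs) ! 1)" by (intro rec_eval.intros) simp
  then show ?case by simp
next
  case (Suc c)
  have "rec_eval (Comp Succ [rec_add c]) (n # y # xs) (Suc (y + c))"
    using Suc by (intro rec_eval.intros(4)[where ys = "[y + c]"] rec_eval.intros(2)) auto
  then show ?case by simp
qed

text \<open>The recursive term receives the code of \<open>k\<close>, and this code is at least
  \<open>|k|\<close>. Using it in place of \<open>|k|\<close> only enlarges the exponent and leaves
  a single primitive recursion that adds \<open>c\<close> at each step, starting from 1.\<close>

lemma effectively_computable_affine: "effectively_computable (\<lambda>k m. c * int_encode k + 1)"
proof -
  have one: "rec_eval (Comp Succ [Zero]) xs 1" for xs
    using rec_eval.intros(4)[of xs "[Zero]" "[0]" Succ 1] rec_eval.intros(1)[of xs] rec_eval.intros(2)[of 0] by simp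
  have "rec_eval (Prec (Comp Succ [Zero]) (rec_add c)) (n # xs) (c * n + 1)" for n xs
  proof (induction n)
    case 0
    then show ?case using rec_eval.intros(5)[OF one] by simp
  next
    case (Suc n)
    then show ?case using rec_eval.intros(6)[OF Suc rec_eval_rec_add] by (simp add: algebra_simps)
  qed
  then show ?thesis unfolding effectively_computable_def by blast
qed

lemma abs_le_int_encode: "nat \<bar>k\<bar> \<le> int_encode k"
  by (auto simp: int_encode_def sum_encode_def)

theorem theorem1:
  "\<exists>M :: int \<Rightarrow> nat \<Rightarrow> nat. effectively_computable M \<and>
    (\<forall>(\<theta>::real) A::real. \<theta> > 0 \<longrightarrow>
      (\<exists>C :: int \<Rightarrow> nat \<Rightarrow> real.
        \<forall>(k::int) (m::nat) (q::nat) (g :: nat \<Rightarrow> complex) (x::real).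
          int m \<ge> max 0 (- k) \<longrightarrow>
          q > 0 \<longrightarrow>
          multiplicative g \<longrightarrow>
          supported_on_squarefree g \<longrightarrow>
          (\<forall>p. prime p \<longrightarrow> \<not> p dvd q \<longrightarrow>
             norm (g p - of_int k / of_nat p) \<le> A / real p powr (1 + \<theta>)) \<longrightarrow>
          x \<ge> 2 \<longrightarrow>
          norm (log_sum g x m q
                - singular_series g k q * of_real (fact m / fact (nat (k + int m))
                    * ln x powi (k + int m)))
            \<le> C k m * (ln x powi (k + int m - 1) * loglog q ^ M k m)))"
proof (intro exI[of _ "\<lambda>k m. 9 * int_encode k + 1"] conjI allI impI)
  show "effectively_computable (\<lambda>k m. 9 * int_encode k + 1)" by (rule effectively_computable_affine)
next
  fix \<theta> A :: real assume \<theta>: "\<theta> > 0"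
  obtain \<Lambda> where \<Lambda>: "\<Lambda> \<ge> 1" "\<And>q. q > 0 \<Longrightarrow> LL q \<le> \<Lambda> * loglog q"
    using LL_le_loglog by blast
  \<comment> \<open>The constant is found for each pair \<open>k\<close>, \<open>m\<close>
    separately, vacuously when \<open>m\<close> is too small, and the function \<open>C\<close> is
    then chosen.\<close>
  define R where "R = (\<lambda>k m C. \<forall>q g x. int m \<ge> max 0 (- k) \<longrightarrow> q > 0 \<longrightarrow> multiplicative g \<longrightarrow> supported_on_squarefree g \<longrightarrow>
          (\<forall>p. prime p \<longrightarrow> \<not> p dvd q \<longrightarrow>
             norm (g p - of_int k / of_nat p) \<le> A / real p powr (1 + \<theta>)) \<longrightarrow>
          x \<ge> 2 \<longrightarrow>
          norm (log_sum g x m q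
                - singular_series g k q * of_real (fact m / fact (nat (k + int m)) * ln x powi (k + int m)))
            \<le> C * (ln x powi (k + int m - 1) * loglog q ^ (9 * int_encode k + 1)))"
  have "\<exists>C. R k m C" for k m
  proof (cases "int m \<ge> max 0 (- k)")
    case True
    define r where "r = nat (k + int m)"
    define M where "M = 9 * int_encode k + 1"
    have r: "k + int m = int r" using True by (simp add: r_def)
    have mk: "int m \<ge> - k" using True by simp
    obtain D where D: "D \<ge> 0" "\<And>q g x. q > 0 \<Longrightarrow> multiplicative g \<Longrightarrow> supported_on_squarefree g \<Longrightarrow>
      \<forall>p. prime p \<longrightarrow> \<not> p dvd q \<longrightarrow> norm (g p - of_int k / of_nat p) \<le> A / real p powr (1 + \<theta>) \<Longrightarrow> x \<ge> 1 \<Longrightarrow>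
      norm (log_sum g x m q - singular_series g k q * of_real (fact m / fact r * ln x ^ r))
        \<le> D * ((1 + ln x) ^ r / (1 + ln x)) * LL q ^ (9 * nat \<bar>k\<bar> + 1)"
      using log_sum_approx[OF mk \<theta>, of A] unfolding r_def by blast
    have main: "norm (log_sum g x m q - singular_series g k q * of_real (fact m / fact r * ln x powi int r))
        \<le> D * 3 ^ r * \<Lambda> ^ M * (ln x powi (int r - 1) * loglog q ^ M)"
      if q: "q > 0" and g: "multiplicative g" "supported_on_squarefree g"
       and gp: "\<forall>p. prime p \<longrightarrow> \<not> p dvd q \<longrightarrow> norm (g p - of_int k / of_nat p) \<le> A / real p powr (1 + \<theta>)"
       and x: "x \<ge> 2" for q g x
    proof -
      have u: "ln x \<ge> 1 / 2"
      proof -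
        have "ln 2 \<le> ln x" using x by (subst ln_le_cancel_iff) auto
        then show ?thesis using ln2_ge_two_thirds by linarith
      qed
      \<comment> \<open>From \<open>x \<ge> 2\<close>, \<open>1 + ln x \<le> 3 * ln x\<close>. The
        integer power also covers \<open>r = 0\<close>, where the bound is
        \<open>1 / ln x\<close>.\<close>
      have E: "(1 + ln x) ^ r / (1 + ln x) \<le> 3 ^ r * ln x powi (int r - 1)"
      proof -
        have "(1 + ln x) ^ r / (1 + ln x) \<le> (3 * ln x) ^ r / ln x"
          using u by (intro frac_le power_mono) auto
        also have "\<dots> = 3 ^ r * (ln x powi int r / ln x)" by (simp add: power_mult_distrib)
        also have "ln x powi int r / ln x = ln x powi (int r - 1)"
          using u by (subst power_int_diff) auto
        finally show ?thesis .
      qed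
      have L: "LL q ^ (9 * nat \<bar>k\<bar> + 1) \<le> \<Lambda> ^ M * loglog q ^ M"
      proof -
        have L1: "LL q \<ge> 1" by (simp add: LL_def)
        \<comment> \<open>Enlarging the exponent is allowed because \<open>LL q \<ge> 1\<close>;
          only then is \<open>loglog\<close> brought in.\<close>
        have "LL q ^ (9 * nat \<bar>k\<bar> + 1) \<le> LL q ^ M"
          using L1 abs_le_int_encode[of k] by (intro power_increasing) (auto simp: M_def)
        also have "\<dots> \<le> (\<Lambda> * loglog q) ^ M" using L1 \<Lambda>(2)[OF q] by (intro power_mono) auto
        finally show ?thesis by (simp add: power_mult_distrib)
      qed
      have "norm (log_sum g x m q - singular_series g k q * of_real (fact m / fact r * ln x powi int r))
         \<le> D * ((1 + ln x) ^ r / (1 + ln x)) * LL q ^ (9 * nat \<bar>k\<bar> + 1)"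
        using D(2)[OF q g gp, of x] x by simp
      also have "\<dots> \<le> D * (3 ^ r * ln x powi (int r - 1)) * (\<Lambda> ^ M * loglog q ^ M)"
        using D(1) E L u by (intro mult_mono mult_left_mono mult_nonneg_nonneg zero_le_power) (auto simp: LL_def)
      finally show ?thesis by (simp add: mult_ac)
    qed
    show ?thesis unfolding R_def r M_def[symmetric] nat_int
      by (intro exI[of _ "D * 3 ^ r * \<Lambda> ^ M"] allI impI) (rule main; assumption)
  qed (auto simp: R_def)
  then obtain C where "R k m (C k m)" for k m by metis
  then show "\<exists>C. \<forall>k m q g x. int m \<ge> max 0 (- k) \<longrightarrow> q > 0 \<longrightarrow> multiplicative g \<longrightarrow> supported_on_squarefree g \<longrightarrow>
          (\<forall>p. prime p \<longrightarrow> \<not> p dvd q \<longrightarrow>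
             norm (g p - of_int k / of_nat p) \<le> A / real p powr (1 + \<theta>)) \<longrightarrow>
          x \<ge> 2 \<longrightarrow>
          norm (log_sum g x m q
                - singular_series g k q * of_real (fact m / fact (nat (k + int m)) * ln x powi (k + int m)))
            \<le> C k m * (ln x powi (k + int m - 1) * loglog q ^ (9 * int_encode k + 1))"
    unfolding R_def by blast
qed

end
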